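(* Let $\alpha$ be irrational and $\lambda>0$. For every $\omega\in\mathbb T$ that is not $2\alpha$-rational, i.e. $(2\alpha\mathbb Z+2\omega)\cap\mathbb Z=\emptyset$, the operator $\mathcal S_\omega$ has purely singular continuous spectrum in $\sigma^{\mathcal S}\cap(-\lambda,\lambda)$.
   Context: $\mathbb T=\mathbb R/\mathbb Z$, $J=\begin{pmatrix}1&0\\0&0\end{pmatrix}$, $V(\omega)=\lambda\begin{pmatrix}\cos2\pi\omega&i\sin2\pi\omega\\-i\sin2\pi\omega&-\cos2\pi\omega\end{pmatrix}$, and $\mathcal S_\omega$ acts on $\ell^2(\mathbb Z,\mathbb C^2)$ by $(\mathcal S_\omega\boldsymbol u)(n)=J\boldsymbol u(n+1)+J\boldsymbol u(n-1)+V(\omega+2n\alpha)\boldsymbol u(n)$. $\sigma^{\mathcal S}$ is its spectrum, independent of $\omega$. "Purely singular continuous spectrum in $I$" means all spectral measures restricted to $I$ are singular continuous. *)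

theory Defs
  imports "HOL-Analysis.Analysis"
begin

definition l2 :: "(int \<Rightarrow> complex \<times> complex) set" where
  "l2 = {u. (\<lambda>n. (cmod (fst (u n)))\<^sup>2 + (cmod (snd (u n)))\<^sup>2) summable_on UNIV}"

definition l2_inner :: "(int \<Rightarrow> complex \<times> complex) \<Rightarrow> (int \<Rightarrow> complex \<times> complex) \<Rightarrow> complex" where
  "l2_inner u v = (\<Sum>\<^sub>\<infinity>n. cnj (fst (u n)) * fst (v n) + cnj (snd (u n)) * snd (v n))"

text \<open>The operator S_omega: (S u)(n) = J u(n+1) + J u(n-1) + V(omega + 2 n alpha) u(n),
  with J = diag(1,0) and
  V(w) = lambda [[cos 2 pi w, i sin 2 pi w], [-i sin 2 pi w, -cos 2 pi w]].\<close>

definition S_op :: "real \<Rightarrow> real \<Rightarrow> real \<Rightarrow> (int \<Rightarrow> complex \<times> complex) \<Rightarrow> (int \<Rightarrow> complex \<times> complex)" where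
  "S_op lam alpha omega u n =
     (let th = omega + 2 * real_of_int n * alpha;
          c = complex_of_real (cos (2 * pi * th));
          s = complex_of_real (sin (2 * pi * th));
          a = fst (u n); b = snd (u n)
      in (fst (u (n + 1)) + fst (u (n - 1)) + complex_of_real lam * (c * a + \<i> * s * b),
          complex_of_real lam * (- \<i> * s * a - c * b)))"

text \<open>Spectrum (real part; the operator is self-adjoint): E is in the spectrum iff
  S - E is not a bijection of l2 onto itself.\<close>

definition op_spectrum :: "((int \<Rightarrow> complex \<times> complex) \<Rightarrow> (int \<Rightarrow> complex \<times> complex)) \<Rightarrow> real set" where
  "op_spectrum S = {E. \<not> bij_betw (\<lambda>u n. (fst (S u n) - complex_of_real E * fst (u n),
                                            snd (S u n) - complex_of_real E * snd (u n))) l2 l2}"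

text \<open>Spectral measure of the (bounded self-adjoint) operator S at the vector u: a finite
  Borel measure on the reals whose moments are the numbers <u, S^k u>.  For a bounded
  self-adjoint operator such a measure exists and is unique (it is the measure given by the
  spectral theorem).\<close>

definition is_spectral_measure ::
  "((int \<Rightarrow> complex \<times> complex) \<Rightarrow> (int \<Rightarrow> complex \<times> complex)) \<Rightarrow> (int \<Rightarrow> complex \<times> complex) \<Rightarrow> real measure \<Rightarrow> bool" where
  "is_spectral_measure S u \<mu> \<longleftrightarrow>
     sets \<mu> = sets borel \<and> finite_measure \<mu> \<and>
     (\<forall>k::nat. integrable \<mu> (\<lambda>x. x ^ k) \<and>
        complex_of_real (integral\<^sup>L \<mu> (\<lambda>x. x ^ k)) = l2_inner u ((S ^^ k) u))"

definition sing_cont_on :: "real measure \<Rightarrow> real set \<Rightarrow> bool" where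
  "sing_cont_on \<mu> I \<longleftrightarrow>
     (\<forall>x\<in>I. emeasure \<mu> {x} = 0) \<and>
     (\<exists>N\<in>sets borel. emeasure lborel N = 0 \<and>
        (\<forall>A\<in>sets borel. A \<subseteq> I - N \<longrightarrow> emeasure \<mu> A = 0))"

definition purely_sc_spectrum_in ::
  "((int \<Rightarrow> complex \<times> complex) \<Rightarrow> (int \<Rightarrow> complex \<times> complex)) \<Rightarrow> real set \<Rightarrow> bool" where
  "purely_sc_spectrum_in S I \<longleftrightarrow>
     (\<forall>u\<in>l2. \<forall>\<mu>. is_spectral_measure S u \<mu> \<longrightarrow> sing_cont_on \<mu> I)"

end

theory Submission
  imports Defs "HOL-Real_Asymp.Real_Asymp"
begin

text \<open>
  A spectral measure \<open>\<mu>\<close> of \<open>S\<close> at \<open>u\<close> is studied through generalised eigenfunctions: the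
  functional \<open>p \<mapsto> (p(S) u)\<^sub>n\<close> on polynomials is represented by some \<open>\<Phi>\<^sub>n\<close> in \<open>L\<^sup>2(\<mu>)\<close>, and
  \<open>(\<Phi>\<^sub>n(x))\<^sub>n\<close> solves \<open>S \<Phi> = x \<Phi>\<close> for \<open>\<mu>\<close>-almost every \<open>x\<close>.

  No atoms. At an atom \<open>E\<close> Bessel's inequality makes \<open>\<Phi>(E)\<close> an eigenvector \<open>(a, b)\<close> in \<open>\<ell>\<^sup>2\<close>. Let \<open>p, q\<close> be
  the Fourier series of \<open>a + b\<close> and \<open>a - b\<close>, and \<open>C(x) = cos 2\<pi>x\<close>. The eigenvalue equation reads
  \<open>C (p + q) + \<lambda> e\<^sup>-\<^sup>i\<^sup>\<omega> q(x - 2\<alpha>) = E p\<close> and \<open>C (p + q) + \<lambda> e\<^sup>i\<^sup>\<omega> p(x + 2\<alpha>) = E q\<close> (writing \<open>\<omega>\<close> for \<open>2\<pi>\<omega>\<close>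
  in the exponents). Hence \<open>C Im (p cnj q)\<close> is invariant under \<open>x \<mapsto> x + 2\<alpha>\<close>, so it is constant, and the
  constant is \<open>0\<close> because \<open>p cnj q\<close> is integrable while \<open>1/C\<close> is not. So \<open>p cnj q\<close> is real, and
  by the recursion so is \<open>e\<^sup>i\<^sup>m\<^sup>\<omega> p(x + 2m\<alpha>) cnj (p(x))\<close> for all \<open>m\<close>. Integrating,
  \<open>\<Sum> |a\<^sub>n + b\<^sub>n|\<^sup>2 sin (2\<pi>m(\<omega> + 2n\<alpha>)) = 0\<close> for all \<open>m\<close>, which for a phase that is not \<open>2\<alpha>\<close>-rational forces \<open>a + b = 0\<close>.

  No absolutely continuous part. Eliminating the second component, \<open>D\<^sub>n (\<Phi>\<^sub>n\<^sub>+\<^sub>1 + \<Phi>\<^sub>n\<^sub>-\<^sub>1) = (x\<^sup>2 - \<lambda>\<^sup>2) \<Phi>\<^sub>n\<close>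
  for the first components, with \<open>D\<^sub>n = x + \<lambda> cos 2\<pi>(\<omega> + 2n\<alpha>)\<close>. If \<open>\<mu>\<close> has bounded density on \<open>A\<close>, the
  Cauchy transforms \<open>\<Psi>\<^sub>n\<close> of \<open>\<Phi>\<^sub>n\<close> over \<open>A\<close> are bounded in \<open>L\<^sup>2\<close> uniformly in \<open>n\<close>. The Wronskian of \<open>\<Psi>\<close> and
  \<open>\<Phi>\<close> is \<open>O(|D\<^sub>n|)\<close> in mean, almost constant in \<open>n\<close> near \<open>+\<infinity>\<close> and near \<open>-\<infinity>\<close>, and its two limits differ by
  the indicator of \<open>A\<close>. So if \<open>\<mu>(A) > 0\<close> the averages of \<open>1/|D\<^sub>n|\<close> along the orbit stay bounded on a
  set of positive measure; but \<open>1/|x + \<lambda> cos|\<close> is not integrable for \<open>|x| < \<lambda>\<close>.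
\<close>

section \<open>Square-integrable functions\<close>

text \<open>Only the moments of \<open>\<mu>\<close> are given, so the link with the operator is the
  isometry p -> p(S)u on polynomials, and everything lives in their closure \<open>pl2\<close>,
  which contains all indicators. Parseval for the indicator of A is what detects mass: with w the
  coordinates of 1_A(S)u, the sum of w_i cnj Phi_i is 1 on A. These w_i are the sources in the
  Wronskian identity, so summing it over all sites produces exactly the jump between the two ends.
  The factor against D_n is constant because V - x has the same determinant x^2 - lam^2 at every
  site. Cauchy transforms are taken at a height eps > 0, which costs an error of order eps per site;
  D_n may vanish, which costs a cutoff eta. Hence the order of choices: the required size of the
  averages of 1/|D_n|, then eta and the block length N, then the Parseval accuracy and the central
  window, and eps last. Interior energies enter twice: lam^2 - x^2 stays away from 0, and -x/lam is
  a value of cos, so the orbit does approach a zero of D_n. The phase hypothesis also enters twice: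
  it separates the frequencies theta_n from -theta_m when p is killed, and it excludes sin theta_n =
  0 when q is killed.\<close>

definition sqint :: "'a measure \<Rightarrow> ('a \<Rightarrow> complex) \<Rightarrow> bool" where
  "sqint M f \<longleftrightarrow> f \<in> borel_measurable M \<and> integrable M (\<lambda>x. (cmod (f x))\<^sup>2)"

definition l2n :: "'a measure \<Rightarrow> ('a \<Rightarrow> complex) \<Rightarrow> real" where
  "l2n M f = sqrt (\<integral>x. (cmod (f x))\<^sup>2 \<partial>M)"

lemma l2n_nonneg [simp]: "0 \<le> l2n M f"
  by (simp add: l2n_def)

lemma l2n_power2: "(l2n M f)\<^sup>2 = (\<integral>x. (cmod (f x))\<^sup>2 \<partial>M)"
  by (simp add: l2n_def)

lemma integrable_le:
  fixes f :: "'a \<Rightarrow> 'b :: {banach, second_countable_topology}" and g :: "'a \<Rightarrow> real"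
  assumes "integrable M g" "f \<in> borel_measurable M" "\<And>x. norm (f x) \<le> g x"
  shows "integrable M f"
  by (rule Bochner_Integration.integrable_bound[OF assms(1,2)])
     (use assms(3) in \<open>auto intro: order_trans[OF _ abs_ge_self]\<close>)

lemma sqint_norm_mult:
  assumes "sqint M f" "sqint M g"
  shows "integrable M (\<lambda>x. cmod (f x) * cmod (g x))"
proof (rule integrable_le)
  show "integrable M (\<lambda>x. (cmod (f x))\<^sup>2 + (cmod (g x))\<^sup>2)"
    "(\<lambda>x. cmod (f x) * cmod (g x)) \<in> borel_measurable M"
    using assms by (auto simp: sqint_def)
  fix x
  have "2 * (cmod (f x) * cmod (g x)) \<le> (cmod (f x))\<^sup>2 + (cmod (g x))\<^sup>2"
    using sum_squares_bound[of "cmod (f x)" "cmod (g x)"] by simp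
  moreover have "0 \<le> cmod (f x) * cmod (g x)" by simp
  ultimately show "norm (cmod (f x) * cmod (g x)) \<le> (cmod (f x))\<^sup>2 + (cmod (g x))\<^sup>2"
    unfolding real_norm_def by linarith
qed

lemma sqint_mult:
  assumes "sqint M f" "sqint M g"
  shows "integrable M (\<lambda>x. f x * g x)"
proof (rule Bochner_Integration.integrable_bound[OF sqint_norm_mult[OF assms]])
  show "(\<lambda>x. f x * g x) \<in> borel_measurable M"
    using assms by (auto simp: sqint_def)
qed (simp add: norm_mult)

lemma sqint_cmult: "sqint M f \<Longrightarrow> sqint M (\<lambda>x. c * f x)"
  by (auto simp: sqint_def norm_mult power_mult_distrib)

lemma sqint_cnj: "sqint M f \<Longrightarrow> sqint M (\<lambda>x. cnj (f x))"
  unfolding sqint_def by (auto intro: measurable_compose[OF _ borel_measurable_continuous_onI[OF continuous_on_cnj[OF continuous_on_id]]])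

lemma sqint_0: "sqint M (\<lambda>x. 0)"
  by (simp add: sqint_def)

lemma sqint_bound:
  assumes g: "sqint M g" and f: "f \<in> borel_measurable M" and le: "AE x in M. cmod (f x) \<le> cmod (g x)"
  shows "sqint M f" "l2n M f \<le> l2n M g"
proof -
  have gi: "integrable M (\<lambda>x. (cmod (g x))\<^sup>2)" using g by (simp add: sqint_def)
  then have fi: "integrable M (\<lambda>x. (cmod (f x))\<^sup>2)"
    by (rule Bochner_Integration.integrable_bound) (use f le in \<open>auto intro: power_mono\<close>)
  with f show "sqint M f" by (simp add: sqint_def)
  show "l2n M f \<le> l2n M g"
    unfolding l2n_def
    by (intro real_sqrt_le_mono integral_mono_AE fi gi) (use le in \<open>auto intro: power_mono\<close>)
qed

lemma sqint_add:
  assumes "sqint M f" "sqint M g"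
  shows "sqint M (\<lambda>x. f x + g x)"
  unfolding sqint_def
proof
  show m: "(\<lambda>x. f x + g x) \<in> borel_measurable M"
    using assms by (auto simp: sqint_def)
  have "integrable M (\<lambda>x. 2 * (cmod (f x))\<^sup>2 + 2 * (cmod (g x))\<^sup>2)"
    using assms by (auto simp: sqint_def)
  then show "integrable M (\<lambda>x. (cmod (f x + g x))\<^sup>2)"
  proof (rule integrable_le)
    fix x
    have "(cmod (f x + g x))\<^sup>2 \<le> (cmod (f x) + cmod (g x))\<^sup>2"
      by (intro power_mono norm_triangle_ineq) simp
    also have "\<dots> \<le> 2 * (cmod (f x))\<^sup>2 + 2 * (cmod (g x))\<^sup>2"
      using sum_squares_bound[of "cmod (f x)" "cmod (g x)"] by (simp add: power2_sum)
    finally show "norm ((cmod (f x + g x))\<^sup>2) \<le> 2 * (cmod (f x))\<^sup>2 + 2 * (cmod (g x))\<^sup>2" by simp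
  qed (use m in simp)
qed

lemma sqint_diff: "sqint M f \<Longrightarrow> sqint M g \<Longrightarrow> sqint M (\<lambda>x. f x - g x)"
  using sqint_add[of M f "\<lambda>x. (-1) * g x"] sqint_cmult[of M g "-1"] by simp

lemma sqint_sum: "(\<And>i. i \<in> F \<Longrightarrow> sqint M (f i)) \<Longrightarrow> sqint M (\<lambda>x. \<Sum>i\<in>F. f i x)"
  by (induction F rule: infinite_finite_induct) (auto intro: sqint_add sqint_0)

lemma (in finite_measure) sqint_const: "sqint M (\<lambda>x. c)"
  by (simp add: sqint_def)

lemma l2n_cmult: "l2n M (\<lambda>x. c * f x) = cmod c * l2n M f"
  by (simp add: l2n_def norm_mult power_mult_distrib real_sqrt_mult)

lemma l2n_cnj [simp]: "l2n M (\<lambda>x. cnj (f x)) = l2n M f"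
  by (simp add: l2n_def)

lemma l2n_minus_commute: "l2n M (\<lambda>x. f x - g x) = l2n M (\<lambda>x. g x - f x)"
  by (simp add: l2n_def norm_minus_commute)

lemma l2n_eq_0_AE:
  assumes "sqint M f" "l2n M f = 0"
  shows "AE x in M. f x = 0"
proof -
  have i: "integrable M (\<lambda>x. (cmod (f x))\<^sup>2)" using assms by (simp add: sqint_def)
  have "(\<integral>x. (cmod (f x))\<^sup>2 \<partial>M) = 0"
    using assms(2) by (simp add: l2n_def)
  then have "AE x in M. (cmod (f x))\<^sup>2 = 0"
    using integral_nonneg_eq_0_iff_AE[OF i] by simp
  then show ?thesis by simp
qed

text \<open>After the degenerate case, integrate 2ab|f||g| <= b^2|f|^2 + a^2|g|^2 with a and b the
  norms of f and g.\<close>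

lemma l2n_Cauchy_Schwarz_norm:
  assumes "sqint M f" "sqint M g"
  shows "(\<integral>x. cmod (f x) * cmod (g x) \<partial>M) \<le> l2n M f * l2n M g"
proof (cases "l2n M f = 0 \<or> l2n M g = 0")
  case True
  then have "AE x in M. f x = 0 \<or> g x = 0"
    using l2n_eq_0_AE[OF assms(1)] l2n_eq_0_AE[OF assms(2)] by auto
  then have "AE x in M. cmod (f x) * cmod (g x) = 0" by eventually_elim auto
  then have "(\<integral>x. cmod (f x) * cmod (g x) \<partial>M) = 0"
    by (rule integral_eq_zero_AE)
  with True show ?thesis by auto
next
  case False
  define a b where "a = l2n M f" and "b = l2n M g"
  have ab: "a > 0" "b > 0"
    using False l2n_nonneg[of M f] l2n_nonneg[of M g] unfolding a_def b_def by linarith+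
  have fi: "integrable M (\<lambda>x. (cmod (f x))\<^sup>2)" and gi: "integrable M (\<lambda>x. (cmod (g x))\<^sup>2)"
    using assms by (auto simp: sqint_def)
  note fg = sqint_norm_mult[OF assms]
  have "2 * a * b * (\<integral>x. cmod (f x) * cmod (g x) \<partial>M) = (\<integral>x. 2 * a * b * (cmod (f x) * cmod (g x)) \<partial>M)"
    by simp
  also have "\<dots> \<le> (\<integral>x. b\<^sup>2 * (cmod (f x))\<^sup>2 + a\<^sup>2 * (cmod (g x))\<^sup>2 \<partial>M)"
  proof (rule integral_mono)
    show "integrable M (\<lambda>x. b\<^sup>2 * (cmod (f x))\<^sup>2 + a\<^sup>2 * (cmod (g x))\<^sup>2)" using fi gi by auto
    show "integrable M (\<lambda>x. 2 * a * b * (cmod (f x) * cmod (g x)))" using fg by auto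
    show "2 * a * b * (cmod (f x) * cmod (g x)) \<le> b\<^sup>2 * (cmod (f x))\<^sup>2 + a\<^sup>2 * (cmod (g x))\<^sup>2" for x
      using sum_squares_bound[of "b * cmod (f x)" "a * cmod (g x)"]
      by (simp add: power_mult_distrib algebra_simps)
  qed
  also have "\<dots> = b\<^sup>2 * a\<^sup>2 + a\<^sup>2 * b\<^sup>2"
    using fi gi by (simp add: a_def b_def l2n_power2)
  finally have "2 * a * b * (\<integral>x. cmod (f x) * cmod (g x) \<partial>M) \<le> 2 * a * b * (a * b)"
    by (simp add: power2_eq_square algebra_simps)
  then show ?thesis
    using ab unfolding a_def b_def by (simp add: mult_le_cancel_left)
qed

lemma l2n_Cauchy_Schwarz:
  assumes "sqint M f" "sqint M g"
  shows "cmod (\<integral>x. f x * g x \<partial>M) \<le> l2n M f * l2n M g"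
proof -
  have "cmod (\<integral>x. f x * g x \<partial>M) \<le> (\<integral>x. cmod (f x * g x) \<partial>M)"
    by (rule integral_norm_bound)
  also have "\<dots> \<le> l2n M f * l2n M g"
    using l2n_Cauchy_Schwarz_norm[OF assms] by (simp add: norm_mult)
  finally show ?thesis .
qed

lemma l2n_triangle:
  assumes "sqint M f" "sqint M g"
  shows "l2n M (\<lambda>x. f x + g x) \<le> l2n M f + l2n M g"
proof (rule power2_le_imp_le)
  have fi: "integrable M (\<lambda>x. (cmod (f x))\<^sup>2)" and gi: "integrable M (\<lambda>x. (cmod (g x))\<^sup>2)"
    and fgi: "integrable M (\<lambda>x. (cmod (f x + g x))\<^sup>2)"
    using assms sqint_add[OF assms] by (auto simp: sqint_def)
  have "(l2n M (\<lambda>x. f x + g x))\<^sup>2 = (\<integral>x. (cmod (f x + g x))\<^sup>2 \<partial>M)" by (rule l2n_power2)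
  also have "\<dots> \<le> (\<integral>x. (cmod (f x))\<^sup>2 + (cmod (g x))\<^sup>2 + 2 * (cmod (f x) * cmod (g x)) \<partial>M)"
  proof (rule integral_mono[OF fgi])
    show "integrable M (\<lambda>x. (cmod (f x))\<^sup>2 + (cmod (g x))\<^sup>2 + 2 * (cmod (f x) * cmod (g x)))"
      using fi gi sqint_norm_mult[OF assms] by auto
    fix x
    have "(cmod (f x + g x))\<^sup>2 \<le> (cmod (f x) + cmod (g x))\<^sup>2"
      by (intro power_mono norm_triangle_ineq) simp
    then show "(cmod (f x + g x))\<^sup>2 \<le> (cmod (f x))\<^sup>2 + (cmod (g x))\<^sup>2 + 2 * (cmod (f x) * cmod (g x))"
      by (simp add: power2_sum)
  qed
  also have "\<dots> = (l2n M f)\<^sup>2 + (l2n M g)\<^sup>2 + 2 * (\<integral>x. cmod (f x) * cmod (g x) \<partial>M)"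
    using fi gi sqint_norm_mult[OF assms] by (simp add: l2n_power2)
  also have "\<dots> \<le> (l2n M f + l2n M g)\<^sup>2"
    using l2n_Cauchy_Schwarz_norm[OF assms] by (simp add: power2_sum)
  finally show "(l2n M (\<lambda>x. f x + g x))\<^sup>2 \<le> (l2n M f + l2n M g)\<^sup>2" .
qed simp

lemma l2n_triangle_diff:
  assumes "sqint M f" "sqint M g" "sqint M h"
  shows "l2n M (\<lambda>x. f x - h x) \<le> l2n M (\<lambda>x. f x - g x) + l2n M (\<lambda>x. g x - h x)"
  using l2n_triangle[OF sqint_diff[OF assms(1,2)] sqint_diff[OF assms(2,3)]] by simp

text \<open>Riesz-Fischer for a rapidly Cauchy sequence, so that no subsequence has to be extracted:
  the increments are summable in L1, which gives a pointwise limit almost everywhere, and Fatou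
  transfers the norm bounds to it.\<close>

lemma (in finite_measure) sqint_complete:
  assumes f: "\<And>j. sqint M (f j)"
    and c: "\<And>j. l2n M (\<lambda>x. f (Suc j) x - f j x) \<le> (1/2) ^ j"
  shows "\<exists>g. sqint M g \<and> (\<lambda>j. l2n M (\<lambda>x. g x - f j x)) \<longlonglongrightarrow> 0"
proof -
  have [measurable]: "f j \<in> borel_measurable M" for j using f by (simp add: sqint_def)
  define C where "C = l2n M (\<lambda>x. 1)"
  have C0: "C \<ge> 0" by (simp add: C_def)
  have d: "sqint M (\<lambda>x. f (Suc j) x - f j x)" for j using f by (intro sqint_diff)
  have dn: "integrable M (\<lambda>x. cmod (f (Suc j) x - f j x))" for j
    using sqint_norm_mult[OF d[of j] sqint_const[of 1]] by simp
  have "(\<integral>x. cmod (f (Suc j) x - f j x) \<partial>M) \<le> C * (1/2) ^ j" for j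
    using l2n_Cauchy_Schwarz_norm[OF d[of j] sqint_const[of 1]] c[of j] C0
    by (simp add: C_def mult.commute) (meson order_trans mult_left_mono l2n_nonneg)
  then have en: "(\<integral>\<^sup>+x. ennreal (cmod (f (Suc j) x - f j x)) \<partial>M) \<le> ennreal (C * (1/2) ^ j)" for j
    using nn_integral_eq_integral[OF dn[of j]] by (simp add: ennreal_leI)
  have "(\<integral>\<^sup>+x. (\<Sum>j. ennreal (cmod (f (Suc j) x - f j x))) \<partial>M)
      = (\<Sum>j. \<integral>\<^sup>+x. ennreal (cmod (f (Suc j) x - f j x)) \<partial>M)"
    by (rule nn_integral_suminf) simp
  also have "\<dots> \<le> (\<Sum>j. ennreal (C * (1/2) ^ j))"
    by (intro suminf_le en) auto
  also have "\<dots> = ennreal (\<Sum>j. C * (1/2) ^ j)"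
    using C0 by (intro suminf_ennreal2) (auto intro!: summable_mult summable_geometric)
  also have "\<dots> < \<infinity>" by simp
  finally have "(\<integral>\<^sup>+x. (\<Sum>j. ennreal (cmod (f (Suc j) x - f j x))) \<partial>M) \<noteq> \<infinity>" by simp
  then have "AE x in M. (\<Sum>j. ennreal (cmod (f (Suc j) x - f j x))) \<noteq> \<infinity>"
    by (intro nn_integral_PInf_AE) auto
  then have conv: "AE x in M. convergent (\<lambda>j. f j x)"
  proof eventually_elim
    case (elim x)
    then have "summable (\<lambda>j. cmod (f (Suc j) x - f j x))"
      by (intro summable_suminf_not_top) auto
    then have "summable (\<lambda>j. f (Suc j) x - f j x)" by (rule summable_norm_cancel)
    then have "convergent (\<lambda>n. \<Sum>j<n. f (Suc j) x - f j x)"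
      by (simp add: summable_iff_convergent)
    then have "convergent (\<lambda>n. f n x - f 0 x)"
      using sum_lessThan_telescope[of "\<lambda>j. f j x"] by simp
    then show ?case
      using convergent_add[OF _ convergent_const[of "f 0 x"]] by fastforce
  qed
  define g where "g x = lim (\<lambda>j. f j x)" for x
  have [measurable]: "g \<in> borel_measurable M"
    unfolding g_def by measurable
  have far: "l2n M (\<lambda>x. f (j + k) x - f j x) \<le> 2 * (1/2) ^ j" for j k
  proof -
    \<comment> \<open>The subtracted geometric tail makes the bound strong enough for induction on
      \<open>k\<close>.\<close>
    have "l2n M (\<lambda>x. f (j + k) x - f j x) \<le> 2 * (1/2) ^ j - 2 * (1/2) ^ (j + k)"
    proof (induction k)
      case 0 then show ?case by (simp add: l2n_def)
    next
      case (Suc k)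
      have "l2n M (\<lambda>x. f (j + Suc k) x - f j x) \<le> l2n M (\<lambda>x. f (Suc (j + k)) x - f (j + k) x) + l2n M (\<lambda>x. f (j + k) x - f j x)"
        using l2n_triangle_diff[OF f[of "Suc (j+k)"] f[of "j+k"] f[of j]] by simp
      with c[of "j + k"] Suc show ?case by simp
    qed
    moreover have "0 \<le> 2 * (1/2::real) ^ (j + k)" by simp
    ultimately show ?thesis by linarith
  qed
  have nb: "(\<integral>\<^sup>+x. ennreal ((cmod (g x - f j x))\<^sup>2) \<partial>M) \<le> ennreal ((2 * (1/2) ^ j)\<^sup>2)" for j
  proof -
    have "AE x in M. ennreal ((cmod (g x - f j x))\<^sup>2) = liminf (\<lambda>k. ennreal ((cmod (f (j + k) x - f j x))\<^sup>2))"
      using conv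
    proof eventually_elim
      case (elim x)
      then have "(\<lambda>k. f k x) \<longlonglongrightarrow> g x" by (simp add: g_def convergent_LIMSEQ_iff)
      then have "(\<lambda>k. f (j + k) x) \<longlonglongrightarrow> g x"
        using LIMSEQ_ignore_initial_segment[of "\<lambda>k. f k x" "g x" j] by (simp add: add.commute)
      then have "(\<lambda>k. (cmod (f (j + k) x - f j x))\<^sup>2) \<longlonglongrightarrow> (cmod (g x - f j x))\<^sup>2"
        by (intro tendsto_intros)
      then have "(\<lambda>k. ennreal ((cmod (f (j + k) x - f j x))\<^sup>2)) \<longlonglongrightarrow> ennreal ((cmod (g x - f j x))\<^sup>2)"
        by (intro tendsto_ennrealI)
      from lim_imp_Liminf[OF sequentially_bot this] show ?case by (rule sym)
    qed
    then have "(\<integral>\<^sup>+x. ennreal ((cmod (g x - f j x))\<^sup>2) \<partial>M) =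
       (\<integral>\<^sup>+x. liminf (\<lambda>k. ennreal ((cmod (f (j + k) x - f j x))\<^sup>2)) \<partial>M)"
      by (rule nn_integral_cong_AE)
    also have "\<dots> \<le> liminf (\<lambda>k. \<integral>\<^sup>+x. ennreal ((cmod (f (j + k) x - f j x))\<^sup>2) \<partial>M)"
      by (rule nn_integral_liminf) simp
    also have "\<dots> \<le> liminf (\<lambda>k::nat. ennreal ((2 * (1/2) ^ j)\<^sup>2))"
    proof (intro Liminf_mono always_eventually allI)
      fix k
      have "integrable M (\<lambda>x. (cmod (f (j + k) x - f j x))\<^sup>2)"
        using sqint_diff[OF f f] by (simp add: sqint_def)
      then have "(\<integral>\<^sup>+x. ennreal ((cmod (f (j + k) x - f j x))\<^sup>2) \<partial>M) = ennreal ((l2n M (\<lambda>x. f (j + k) x - f j x))\<^sup>2)"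
        by (simp add: nn_integral_eq_integral l2n_power2)
      also have "\<dots> \<le> ennreal ((2 * (1/2) ^ j)\<^sup>2)"
        by (intro ennreal_leI power_mono far) simp
      finally show "(\<integral>\<^sup>+x. ennreal ((cmod (f (j + k) x - f j x))\<^sup>2) \<partial>M) \<le> ennreal ((2 * (1/2) ^ j)\<^sup>2)" .
    qed
    finally show ?thesis by (simp add: Liminf_const)
  qed
  have gf: "sqint M (\<lambda>x. g x - f j x)" for j
    unfolding sqint_def
  proof
    show "integrable M (\<lambda>x. (cmod (g x - f j x))\<^sup>2)"
      by (rule integrableI_bounded) (use nb[of j] in \<open>auto intro: le_less_trans\<close>)
  qed simp
  have "sqint M g" using sqint_add[OF gf[of 0] f[of 0]] by simp
  moreover have "(\<lambda>j. l2n M (\<lambda>x. g x - f j x)) \<longlonglongrightarrow> 0"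
  proof (rule tendsto_sandwich[OF _ _ tendsto_const])
    show "\<forall>\<^sub>F j in sequentially. l2n M (\<lambda>x. g x - f j x) \<le> 2 * (1/2) ^ j"
    proof (rule always_eventually, rule allI)
      fix j
      have "integrable M (\<lambda>x. (cmod (g x - f j x))\<^sup>2)" using gf by (simp add: sqint_def)
      then have "ennreal ((l2n M (\<lambda>x. g x - f j x))\<^sup>2) \<le> ennreal ((2 * (1/2) ^ j)\<^sup>2)"
        using nb[of j] by (simp add: nn_integral_eq_integral l2n_power2)
      then have "(l2n M (\<lambda>x. g x - f j x))\<^sup>2 \<le> (2 * (1/2) ^ j)\<^sup>2" by (simp add: ennreal_le_iff)
      then show "l2n M (\<lambda>x. g x - f j x) \<le> 2 * (1/2) ^ j"
        by (rule power2_le_imp_le) simp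
    qed
    show "(\<lambda>j. 2 * (1/2::real) ^ j) \<longlonglongrightarrow> 0"
      by (intro tendsto_mult_right_zero LIMSEQ_realpow_zero) auto
  qed simp
  ultimately show ?thesis by blast
qed

section \<open>Polynomials in the space of square-integrable functions\<close>

abbreviation pev :: "complex poly \<Rightarrow> real \<Rightarrow> complex" where
  "pev p x \<equiv> poly p (complex_of_real x)"

text \<open>The argument is real, so conjugating the coefficients suffices.\<close>

lemma cnj_pev: "\<exists>q. \<forall>x. cnj (pev p x) = pev q x"
proof (induction p)
  case 0
  show ?case by (rule exI[of _ 0]) simp
next
  case (pCons a p)
  then obtain q where "\<forall>x. cnj (pev p x) = pev q x" by blast
  then have "\<forall>x. cnj (pev (pCons a p) x) = pev (pCons (cnj a) q) x" by simp
  then show ?case by blast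
qed

lemma continuous_on_pev: "continuous_on A (pev p)"
  by (intro continuous_intros)

text \<open>Bounded support makes every polynomial square-integrable and multiplication by x a
  bounded operator.\<close>

locale compact_measure = finite_measure M for M :: "real measure" +
  fixes \<rho> :: real
  assumes sets_M [measurable_cong, simp]: "sets M = sets borel"
    and support: "AE x in M. \<bar>x\<bar> \<le> \<rho>"
begin

lemma sqint_continuous:
  assumes "continuous_on UNIV (f :: real \<Rightarrow> complex)"
  shows "sqint M f"
proof -
  have "compact (f ` {-\<rho>..\<rho>})"
    by (intro compact_continuous_image continuous_on_subset[OF assms]) auto
  then obtain B where B: "\<And>y. y \<in> f ` {-\<rho>..\<rho>} \<Longrightarrow> cmod y \<le> B"
    using compact_imp_bounded bounded_iff by metis
  show ?thesis
  proof (rule sqint_bound(1)[OF sqint_const[of "of_real B"]])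
    show "f \<in> borel_measurable M"
      using borel_measurable_continuous_onI[OF assms] by (simp add: measurable_cong_sets[OF sets_M refl])
    show "AE x in M. cmod (f x) \<le> cmod (complex_of_real B)"
      using support
    proof eventually_elim
      case (elim x)
      then have "cmod (f x) \<le> B" by (intro B) (auto simp: abs_le_iff)
      then show ?case by simp
    qed
  qed
qed

lemma sqint_pev: "sqint M (pev p)"
  by (rule sqint_continuous[OF continuous_on_pev])

text \<open>The L2 closure of the polynomials, the space on which moments decide: a member
  orthogonal to all polynomials vanishes almost everywhere.\<close>

definition pl2 :: "(real \<Rightarrow> complex) \<Rightarrow> bool" where
  "pl2 f \<longleftrightarrow> sqint M f \<and> (\<forall>e>0. \<exists>p. l2n M (\<lambda>x. f x - pev p x) < e)"

lemma pl2_sqint: "pl2 f \<Longrightarrow> sqint M f"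
  by (simp add: pl2_def)

lemma pl2_pev: "pl2 (pev p)"
  unfolding pl2_def using sqint_pev by (auto intro!: exI[of _ p] simp: l2n_def)

lemma pl2_limit:
  assumes "sqint M f" "\<And>e. e > 0 \<Longrightarrow> \<exists>g. pl2 g \<and> l2n M (\<lambda>x. f x - g x) < e"
  shows "pl2 f"
  unfolding pl2_def
proof (intro conjI allI impI)
  fix e :: real assume "e > 0"
  then obtain g where g: "pl2 g" "l2n M (\<lambda>x. f x - g x) < e / 2" using assms(2)[of "e/2"] by auto
  then obtain p where p: "l2n M (\<lambda>x. g x - pev p x) < e / 2" using \<open>e > 0\<close> unfolding pl2_def
    by (metis half_gt_zero)
  have "l2n M (\<lambda>x. f x - pev p x) < e"
    using l2n_triangle_diff[OF assms(1) pl2_sqint[OF g(1)] sqint_pev[of p]] g p by linarith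
  then show "\<exists>p. l2n M (\<lambda>x. f x - pev p x) < e" by blast
qed fact

lemma pl2_add:
  assumes "pl2 f" "pl2 g" shows "pl2 (\<lambda>x. f x + g x)"
  unfolding pl2_def
proof (intro conjI allI impI)
  show "sqint M (\<lambda>x. f x + g x)" using assms by (intro sqint_add pl2_sqint)
  fix e :: real assume e: "e > 0"
  obtain p q where pq: "l2n M (\<lambda>x. f x - pev p x) < e / 2" "l2n M (\<lambda>x. g x - pev q x) < e / 2"
    using assms e unfolding pl2_def by (metis half_gt_zero)
  have "l2n M (\<lambda>x. (f x - pev p x) + (g x - pev q x)) < e"
    using l2n_triangle[OF sqint_diff[OF pl2_sqint[OF assms(1)] sqint_pev[of p]] sqint_diff[OF pl2_sqint[OF assms(2)] sqint_pev[of q]]] pq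
    by linarith
  also have "(\<lambda>x. (f x - pev p x) + (g x - pev q x)) = (\<lambda>x. f x + g x - pev (p + q) x)"
    by (auto simp: algebra_simps)
  finally show "\<exists>p. l2n M (\<lambda>x. f x + g x - pev p x) < e" by blast
qed

lemma pl2_cmult:
  assumes "pl2 f" shows "pl2 (\<lambda>x. c * f x)"
proof (cases "c = 0")
  case True then show ?thesis using pl2_pev[of 0] by simp
next
  case False
  show ?thesis
    unfolding pl2_def
  proof (intro conjI allI impI)
    show "sqint M (\<lambda>x. c * f x)" using assms by (intro sqint_cmult pl2_sqint)
    fix e :: real assume e: "e > 0"
    then obtain p where p: "l2n M (\<lambda>x. f x - pev p x) < e / cmod c"
      using assms False unfolding pl2_def by (metis divide_pos_pos zero_less_norm_iff)
    then have "l2n M (\<lambda>x. c * (f x - pev p x)) < e"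
      using False by (simp only: l2n_cmult) (simp add: field_simps)
    also have "(\<lambda>x. c * (f x - pev p x)) = (\<lambda>x. c * f x - pev (smult c p) x)"
      by (auto simp: algebra_simps)
    finally show "\<exists>p. l2n M (\<lambda>x. c * f x - pev p x) < e" by blast
  qed
qed

lemma pl2_diff: "pl2 f \<Longrightarrow> pl2 g \<Longrightarrow> pl2 (\<lambda>x. f x - g x)"
  using pl2_add[of f "\<lambda>x. (-1) * g x"] pl2_cmult[of g "-1"] by simp

lemma pl2_sum: "(\<And>i. i \<in> F \<Longrightarrow> pl2 (f i)) \<Longrightarrow> pl2 (\<lambda>x. \<Sum>i\<in>F. f i x)"
  using pl2_pev[of 0] by (induction F rule: infinite_finite_induct) (auto intro: pl2_add)

lemma pl2_cnj:
  assumes "pl2 f" shows "pl2 (\<lambda>x. cnj (f x))"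
  unfolding pl2_def
proof (intro conjI allI impI)
  show "sqint M (\<lambda>x. cnj (f x))" using assms by (intro sqint_cnj pl2_sqint)
  fix e :: real assume "e > 0"
  then obtain p where p: "l2n M (\<lambda>x. f x - pev p x) < e" using assms unfolding pl2_def by blast
  obtain q where q: "\<forall>x. cnj (pev p x) = pev q x" using cnj_pev by blast
  have "l2n M (\<lambda>x. cnj (f x) - pev q x) < e"
    using p q l2n_cnj[of M "\<lambda>x. f x - pev p x"] by simp
  then show "\<exists>p. l2n M (\<lambda>x. cnj (f x) - pev p x) < e" by blast
qed

lemma l2n_xmult_le:
  assumes "sqint M f"
  shows "sqint M (\<lambda>x. of_real x * f x)" "l2n M (\<lambda>x. of_real x * f x) \<le> \<bar>\<rho>\<bar> * l2n M f"
proof -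
  have b: "AE x in M. cmod (of_real x * f x) \<le> cmod (of_real \<rho> * f x)"
    using support by eventually_elim (auto simp: norm_mult intro!: mult_right_mono)
  have [measurable]: "f \<in> borel_measurable M" using assms by (simp add: sqint_def)
  show s: "sqint M (\<lambda>x. of_real x * f x)"
    by (rule sqint_bound(1)[OF sqint_cmult[OF assms, of "of_real \<rho>"] _ b]) measurable
  have "l2n M (\<lambda>x. of_real x * f x) \<le> l2n M (\<lambda>x. of_real \<rho> * f x)"
    by (rule sqint_bound(2)[OF sqint_cmult[OF assms] _ b]) measurable
  then show "l2n M (\<lambda>x. of_real x * f x) \<le> \<bar>\<rho>\<bar> * l2n M f"
    by (simp add: l2n_cmult)
qed

lemma pl2_xmult:
  assumes "pl2 f" shows "pl2 (\<lambda>x. of_real x * f x)"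
  unfolding pl2_def
proof (intro conjI allI impI)
  show "sqint M (\<lambda>x. of_real x * f x)" using assms by (intro l2n_xmult_le pl2_sqint)
  fix e :: real assume e: "e > 0"
  then have "e / (\<bar>\<rho>\<bar> + 1) > 0" by simp
  then obtain p where p: "l2n M (\<lambda>x. f x - pev p x) < e / (\<bar>\<rho>\<bar> + 1)" using assms unfolding pl2_def by blast
  have "l2n M (\<lambda>x. of_real x * (f x - pev p x)) \<le> \<bar>\<rho>\<bar> * l2n M (\<lambda>x. f x - pev p x)"
    by (intro l2n_xmult_le sqint_diff pl2_sqint assms sqint_pev)
  also have "\<dots> \<le> (\<bar>\<rho>\<bar> + 1) * l2n M (\<lambda>x. f x - pev p x)"
    by (intro mult_right_mono) auto
  also have "\<dots> < e" using p by (simp add: field_simps add_pos_nonneg)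
  also have "(\<lambda>x. of_real x * (f x - pev p x)) = (\<lambda>x. of_real x * f x - pev (pCons 0 p) x)"
    by (auto simp: algebra_simps)
  finally show "\<exists>p. l2n M (\<lambda>x. of_real x * f x - pev p x) < e" by blast
qed

text \<open>Stone-Weierstrass on [-\<rho>, \<rho>]; a uniform error e' there costs e' times the norm
  of 1.\<close>

lemma pl2_continuous:
  assumes "continuous_on UNIV (f :: real \<Rightarrow> real)"
  shows "pl2 (\<lambda>x. of_real (f x))"
  unfolding pl2_def
proof (intro conjI allI impI)
  have c: "continuous_on UNIV (\<lambda>x. complex_of_real (f x))" using assms by (intro continuous_intros)
  show s: "sqint M (\<lambda>x. complex_of_real (f x))" by (rule sqint_continuous[OF c])
  fix e :: real assume e: "e > 0"
  define C where "C = l2n M (\<lambda>x. 1)"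
  have C: "C \<ge> 0" by (simp add: C_def)
  define e' where "e' = e / (C + 1)"
  have e': "e' > 0" using e C by (simp add: e'_def)
  obtain g where g: "real_polynomial_function g" "\<And>x. x \<in> {-\<rho>..\<rho>} \<Longrightarrow> \<bar>f x - g x\<bar> < e'"
    using Stone_Weierstrass_real_polynomial_function[OF compact_Icc continuous_on_subset[OF assms] e']
    by (metis subset_UNIV)
  then obtain a n where an: "g = (\<lambda>x. \<Sum>i\<le>n. a i * x^i)"
    using real_polynomial_function_iff_sum by auto
  define p where "p = (\<Sum>i\<le>(n::nat). monom (complex_of_real (a i)) i)"
  have p: "pev p x = of_real (g x)" for x
    by (simp add: p_def an poly_sum poly_monom)
  have d: "sqint M (\<lambda>x. complex_of_real (f x) - pev p x)" by (intro sqint_diff s sqint_pev)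
  have "l2n M (\<lambda>x. complex_of_real (f x) - pev p x) \<le> l2n M (\<lambda>x. of_real e' * 1)"
  proof (rule sqint_bound(2))
    show "sqint M (\<lambda>x. of_real e' * 1)" by (intro sqint_cmult sqint_const)
    show "(\<lambda>x. complex_of_real (f x) - pev p x) \<in> borel_measurable M" using d by (simp add: sqint_def)
    show "AE x in M. cmod (complex_of_real (f x) - pev p x) \<le> cmod (of_real e' * 1)"
      using support
    proof eventually_elim
      case (elim x)
      then have "\<bar>f x - g x\<bar> < e'" by (intro g) (auto simp: abs_le_iff)
      then show ?case unfolding p of_real_diff[symmetric] norm_of_real norm_mult by simp
    qed
  qed
  also have "\<dots> = e' * C" unfolding l2n_cmult C_def using e' by simp
  also have "\<dots> < e" using e C unfolding e'_def by (simp add: field_simps add_pos_nonneg)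
  finally show "\<exists>p. l2n M (\<lambda>x. complex_of_real (f x) - pev p x) < e" by blast
qed

lemma pl2_bounded_limit:
  assumes g: "\<And>k. pl2 (g k)" and lim: "\<And>x. (\<lambda>k. g k x) \<longlonglongrightarrow> f x" and B: "\<And>k x. cmod (g k x) \<le> B"
  shows "pl2 f"
proof -
  have [measurable]: "g k \<in> borel_measurable M" for k using g pl2_sqint sqint_def by blast
  have [measurable]: "f \<in> borel_measurable M"
    by (rule borel_measurable_LIMSEQ_metric[OF _ lim]) measurable
  have fB: "cmod (f x) \<le> B" for x
    by (rule Lim_bounded[OF tendsto_norm[OF lim]]) (use B in auto)
  have B0: "B \<ge> 0" using B norm_ge_zero order_trans by blast
  have sf: "sqint M f"
    by (rule sqint_bound(1)[OF sqint_const[of "of_real B"]]) (use fB B0 in auto)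
  have "(\<lambda>k. \<integral>x. (cmod (f x - g k x))\<^sup>2 \<partial>M) \<longlonglongrightarrow> (\<integral>x. 0 \<partial>M)"
  proof (rule integral_dominated_convergence[where w = "\<lambda>x. (2 * B)\<^sup>2"])
    show "AE x in M. (\<lambda>k. (cmod (f x - g k x))\<^sup>2) \<longlonglongrightarrow> 0"
    proof (rule AE_I2)
      fix x
      have "(\<lambda>k. (cmod (f x - g k x))\<^sup>2) \<longlonglongrightarrow> (cmod (f x - f x))\<^sup>2"
        by (intro tendsto_intros lim)
      then show "(\<lambda>k. (cmod (f x - g k x))\<^sup>2) \<longlonglongrightarrow> 0" by simp
    qed
    show "AE x in M. norm ((cmod (f x - g k x))\<^sup>2) \<le> (2 * B)\<^sup>2" for k
    proof (rule AE_I2)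
      fix x
      have "cmod (f x - g k x) \<le> 2 * B"
        using norm_triangle_ineq4[of "f x" "g k x"] fB[of x] B[of k x] by linarith
      then show "norm ((cmod (f x - g k x))\<^sup>2) \<le> (2 * B)\<^sup>2"
        unfolding real_norm_def abs_power2 by (rule power_mono) simp
    qed
  qed auto
  then have "(\<lambda>k. l2n M (\<lambda>x. f x - g k x)) \<longlonglongrightarrow> 0"
    unfolding l2n_def using tendsto_real_sqrt by fastforce
  then have "\<exists>k. l2n M (\<lambda>x. f x - g k x) < e" if "e > 0" for e
    using order_tendstoD(2)[OF \<open>_ \<longlonglongrightarrow> 0\<close> that] by (auto simp: eventually_sequentially)
  then show ?thesis by (intro pl2_limit[OF sf]) (use g in blast)
qed

text \<open>Half-lines are bounded limits of continuous ramps; complements and disjoint unions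
  follow by linearity and bounded limits, so the pi-lambda theorem reaches every Borel set.\<close>

lemma pl2_indicator:
  assumes "A \<in> sets borel"
  shows "pl2 (indicator A)"
proof -
  have A: "A \<in> sigma_sets UNIV (range (\<lambda>a::real. {..a}))"
    using assms borel_eq_atMost by (metis sets_measure_of top_greatest Pow_UNIV)
  show ?thesis
  proof (rule sigma_sets_induct_disjoint[OF _ _ A])
    show "Int_stable (range (\<lambda>a::real. {..a}))"
      by (auto simp: Int_stable_def)
    show "range (\<lambda>a::real. {..a}) \<subseteq> Pow UNIV" by simp
    show "pl2 (indicator {})" using pl2_pev[of 0] by (simp add: indicator_def[abs_def])
  next
    fix B assume "pl2 (indicator B)"
    then have "pl2 (\<lambda>x. pev 1 x - indicator B x)" by (intro pl2_diff pl2_pev)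
    also have "(\<lambda>x. pev 1 x - indicator B x) = indicator (UNIV - B)"
      by (auto simp: fun_eq_iff indicator_def)
    finally show "pl2 (indicator (UNIV - B))" .
  next
    fix B assume "B \<in> range (\<lambda>a::real. {..a})"
    then obtain a where B: "B = {..a}" by auto
    \<comment> \<open>For k > 0 the ramp falls linearly from 1 at \<open>a\<close> to 0 at
      \<open>a + 1/k\<close>.\<close>
    define h where "h k x = max 0 (min 1 (1 - real k * (x - a)))" for k x
    show "pl2 (indicator B)"
    proof (rule pl2_bounded_limit[where B = 1])
      show "pl2 (\<lambda>x. complex_of_real (h k x))" for k
        unfolding h_def by (intro pl2_continuous continuous_intros)
      show "cmod (complex_of_real (h k x)) \<le> 1" for k x by (simp add: h_def)
      fix x
      show "(\<lambda>k. complex_of_real (h k x)) \<longlonglongrightarrow> indicator B x"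
      proof (cases "x \<le> a")
        case True
        then have "h k x = 1" for k by (simp add: h_def mult_nonneg_nonpos)
        then show ?thesis using True B by simp
      next
        case False
        obtain N :: nat where N: "real N > 1 / (x - a)" using reals_Archimedean2 by blast
        have "h k x = 0" if "k \<ge> N" for k
        proof -
          have "real k * (x - a) \<ge> real N * (x - a)" using that False by (intro mult_right_mono) auto
          moreover have "real N * (x - a) > 1" using N False by (simp add: field_simps)
          ultimately show ?thesis by (simp add: h_def)
        qed
        then have "(\<lambda>k. complex_of_real (h k x)) \<longlonglongrightarrow> 0"
          by (intro tendsto_eventually eventually_sequentiallyI[of N]) auto
        then show ?thesis using False B by simp
      qed
    qed
  next
    fix B :: "nat \<Rightarrow> real set"
    assume d: "disjoint_family B" and p: "\<And>i. pl2 (indicator (B i))"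
    have fin: "pl2 (indicator (\<Union>i<k. B i))" for k
    proof (induction k)
      case 0 then show ?case using pl2_pev[of 0] by (simp add: indicator_def[abs_def])
    next
      case (Suc k)
      have "indicator (\<Union>i<Suc k. B i) x = indicator (\<Union>i<k. B i) x + (indicator (B k) x :: complex)" for x
      proof (cases "x \<in> B k")
        case True
        have "B k \<inter> B j = {}" if "j < k" for j
          using d that by (auto simp: disjoint_family_on_def)
        with True have "x \<notin> (\<Union>i<k. B i)" by blast
        then show ?thesis using True by (auto simp: indicator_def lessThan_Suc)
      qed (auto simp: indicator_def lessThan_Suc)
      then have "indicator (\<Union>i<Suc k. B i) = (\<lambda>x. indicator (\<Union>i<k. B i) x + (indicator (B k) x :: complex))"
        by (rule ext)
      with pl2_add[OF Suc p[of k]] show ?case by simp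
    qed
    show "pl2 (indicator (\<Union>i. B i))"
      by (rule pl2_bounded_limit[OF fin LIMSEQ_indicator_UN, where B = 1]) (simp add: indicator_def)
  qed
qed

text \<open>Duality on the closure of the polynomials. The pairing carries no conjugate, so
  \<open>f\<close> is tested against polynomials near \<open>cnj f\<close>, where the pairing is the
  squared norm of \<open>f\<close>.\<close>

lemma pl2_norm_bound:
  assumes f: "pl2 f" and c0: "0 \<le> c"
    and c: "\<And>p. cmod (\<integral>x. pev p x * f x \<partial>M) \<le> c * l2n M (pev p)"
  shows "l2n M f \<le> c"
proof -
  define a where "a = l2n M f"
  have a0: "a \<ge> 0" by (simp add: a_def)
  have key: "a\<^sup>2 \<le> c * a + e * (a + c)" if e: "e > 0" for e
  proof -
    obtain p where p: "l2n M (\<lambda>x. cnj (f x) - pev p x) < e"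
      using pl2_cnj[OF f] e unfolding pl2_def by blast
    have sf: "sqint M f" "sqint M (\<lambda>x. cnj (f x))" using f pl2_sqint sqint_cnj by auto
    have i1: "integrable M (\<lambda>x. (cnj (f x) - pev p x) * f x)" by (intro sqint_mult sqint_diff sf sqint_pev)
    have i2: "integrable M (\<lambda>x. pev p x * f x)" by (intro sqint_mult sf sqint_pev)
    have "of_real (a\<^sup>2) = (\<integral>x. complex_of_real ((cmod (f x))\<^sup>2) \<partial>M)"
      unfolding a_def l2n_power2 by (rule integral_complex_of_real[symmetric])
    also have "\<dots> = (\<integral>x. (cnj (f x) - pev p x) * f x + pev p x * f x \<partial>M)"
    proof (rule Bochner_Integration.integral_cong[OF refl])
      fix x
      have "complex_of_real ((cmod (f x))\<^sup>2) = cnj (f x) * f x"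
        using complex_norm_square[of "f x"] by (simp add: mult.commute)
      then show "complex_of_real ((cmod (f x))\<^sup>2) = (cnj (f x) - pev p x) * f x + pev p x * f x"
        by (simp add: algebra_simps)
    qed
    also have "\<dots> = (\<integral>x. (cnj (f x) - pev p x) * f x \<partial>M) + (\<integral>x. pev p x * f x \<partial>M)"
      by (rule Bochner_Integration.integral_add[OF i1 i2])
    finally have eq: "of_real (a\<^sup>2) = (\<integral>x. (cnj (f x) - pev p x) * f x \<partial>M) + (\<integral>x. pev p x * f x \<partial>M)" .
    have "a\<^sup>2 = cmod (of_real (a\<^sup>2))" unfolding norm_of_real by simp
    also have "\<dots> \<le> cmod (\<integral>x. (cnj (f x) - pev p x) * f x \<partial>M) + cmod (\<integral>x. pev p x * f x \<partial>M)"
      unfolding eq by (rule norm_triangle_ineq)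
    also have "\<dots> \<le> e * a + c * l2n M (pev p)"
    proof (intro add_mono c)
      have "cmod (\<integral>x. (cnj (f x) - pev p x) * f x \<partial>M) \<le> l2n M (\<lambda>x. cnj (f x) - pev p x) * a"
        unfolding a_def by (intro l2n_Cauchy_Schwarz sqint_diff sf sqint_pev)
      also have "\<dots> \<le> e * a" using p by (intro mult_right_mono) (auto simp: a_def)
      finally show "cmod (\<integral>x. (cnj (f x) - pev p x) * f x \<partial>M) \<le> e * a" .
    qed
    also have "c * l2n M (pev p) \<le> c * (e + a)"
    proof (rule mult_left_mono[OF _ c0])
      have "l2n M (\<lambda>x. (pev p x - cnj (f x)) + cnj (f x)) \<le> l2n M (\<lambda>x. pev p x - cnj (f x)) + l2n M (\<lambda>x. cnj (f x))"
        by (intro l2n_triangle sqint_diff sf sqint_pev)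
      then show "l2n M (pev p) \<le> e + a"
        using p l2n_minus_commute[of M "pev p" "\<lambda>x. cnj (f x)"] by (simp add: a_def)
    qed
    finally show ?thesis by (simp add: algebra_simps)
  qed
  have "a\<^sup>2 \<le> c * a"
  proof (rule field_le_epsilon)
    fix e :: real assume e: "e > 0"
    have "a\<^sup>2 \<le> c * a + e / (a + c + 1) * (a + c)"
      using e a0 c0 by (intro key) simp
    also have "e / (a + c + 1) * (a + c) \<le> e"
      using e a0 c0 by (simp add: field_simps)
    finally show "a\<^sup>2 \<le> c * a + e" by simp
  qed
  then show ?thesis
    using a0 c0 by (cases "a = 0") (auto simp: power2_eq_square a_def[symmetric])
qed

text \<open>Riesz representation: a minimising sequence of \<open>\<parallel>p\<parallel>\<^sup>2 - 2 Re (L p)\<close> is Cauchy, by the parallelogram law.\<close>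

lemma pl2_Riesz:
  fixes L :: "complex poly \<Rightarrow> complex"
  assumes add: "\<And>p q. L (p + q) = L p + L q" and smult: "\<And>a p. L (smult a p) = a * L p"
    and bd: "\<And>p. cmod (L p) \<le> c * l2n M (pev p)"
  shows "\<exists>f. pl2 f \<and> (\<forall>p. L p = (\<integral>x. pev p x * f x \<partial>M))"
proof -
  define q where "q p = (l2n M (pev p))\<^sup>2 - 2 * Re (L p)" for p
  have lb: "q p \<ge> - c\<^sup>2" for p
  proof -
    have "Re (L p) \<le> c * l2n M (pev p)" using bd[of p] complex_Re_le_cmod order_trans by blast
    moreover have "2 * c * l2n M (pev p) \<le> c\<^sup>2 + (l2n M (pev p))\<^sup>2" by (rule sum_squares_bound)
    ultimately show ?thesis unfolding q_def by linarith
  qed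
  define m where "m = (INF p. q p)"
  have bdd: "bdd_below (range q)" using lb by (auto simp: bdd_below_def)
  have m_le: "m \<le> q p" for p unfolding m_def by (rule cINF_lower[OF bdd]) simp
  \<comment> \<open>With this slack the parallelogram bound for the squared increments is 5/16 times
    (1/4)^j, within the geometric rate demanded by \<open>sqint_complete\<close>.\<close>
  have "\<exists>p. q p < m + (1/4)^j / 8" for j
    using cINF_less_iff[of UNIV q "m + (1/4)^j / 8"] bdd unfolding m_def by auto
  then obtain P where P: "\<And>j. q (P j) < m + (1/4)^j / 8" by metis
  have par: "(l2n M (\<lambda>x. pev p x - pev p' x))\<^sup>2 \<le> 2 * q p + 2 * q p' - 4 * m" for p p'
  proof -
    let ?h = "smult (1/2) (p + p')"
    have I: "integrable M (\<lambda>x. (cmod (pev r x))\<^sup>2)" for r using sqint_pev[of r] by (simp add: sqint_def)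
    have "(cmod (pev p x - pev p' x))\<^sup>2 = 2 * (cmod (pev p x))\<^sup>2 + 2 * (cmod (pev p' x))\<^sup>2 - 4 * (cmod (pev ?h x))\<^sup>2" for x
      unfolding cmod_power2 by (simp add: power2_eq_square algebra_simps)
    then have "(l2n M (\<lambda>x. pev p x - pev p' x))\<^sup>2
      = (\<integral>x. 2 * (cmod (pev p x))\<^sup>2 + 2 * (cmod (pev p' x))\<^sup>2 - 4 * (cmod (pev ?h x))\<^sup>2 \<partial>M)"
      by (simp only: l2n_power2)
    also have "\<dots> = 2 * (l2n M (pev p))\<^sup>2 + 2 * (l2n M (pev p'))\<^sup>2 - 4 * (l2n M (pev ?h))\<^sup>2"
      unfolding l2n_power2 using I[of p] I[of p'] I[of ?h]
      by (subst Bochner_Integration.integral_diff) (auto simp del: poly_smult)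
    also have "\<dots> = 2 * q p + 2 * q p' - 4 * q ?h"
      by (simp add: q_def smult add algebra_simps del: poly_smult)
    finally show ?thesis using m_le[of ?h] by linarith
  qed
  have "l2n M (\<lambda>x. pev (P (Suc j)) x - pev (P j) x) \<le> (1/2) ^ j" for j
  proof (rule power2_le_imp_le)
    have "(l2n M (\<lambda>x. pev (P (Suc j)) x - pev (P j) x))\<^sup>2 \<le> 2 * ((1/4)^Suc j / 8) + 2 * ((1/4)^j / 8)"
      using par[of "P (Suc j)" "P j"] P[of j] P[of "Suc j"] by linarith
    also have "\<dots> \<le> (1/4)^j" by simp
    also have "(1/4::real)^j = ((1/2)^j)\<^sup>2" by (simp add: power2_eq_square flip: power_mult_distrib)
    finally show "(l2n M (\<lambda>x. pev (P (Suc j)) x - pev (P j) x))\<^sup>2 \<le> ((1/2)^j)\<^sup>2" .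
  qed simp
  from sqint_complete[of "\<lambda>j. pev (P j)", OF sqint_pev this]
  obtain g where g: "sqint M g" and lim: "(\<lambda>j. l2n M (\<lambda>x. g x - pev (P j) x)) \<longlonglongrightarrow> 0" by blast
  have plg: "pl2 g"
    unfolding pl2_def
  proof (intro conjI g allI impI)
    fix e :: real assume "e > 0"
    from order_tendstoD(2)[OF lim this] show "\<exists>p. l2n M (\<lambda>x. g x - pev p x) < e"
      unfolding eventually_sequentially by blast
  qed
  \<comment> \<open>The minimiser \<open>g\<close> represents \<open>L\<close> through
    \<open>cnj g\<close>, since the pairing is bilinear rather than sesquilinear.\<close>
  have "L p = (\<integral>x. pev p x * cnj (g x) \<partial>M)" for p
  proof -
    define z where "z j = L p - (\<integral>x. pev p x * cnj (pev (P j) x) \<partial>M)" for j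
    define z0 where "z0 = L p - (\<integral>x. pev p x * cnj (g x) \<partial>M)"
    have zl: "z \<longlonglongrightarrow> z0"
    proof (rule LIM_zero_cancel, rule Lim_null_comparison)
      show "(\<lambda>j. l2n M (pev p) * l2n M (\<lambda>x. g x - pev (P j) x)) \<longlonglongrightarrow> 0"
        by (rule tendsto_mult_right_zero[OF lim])
      show "\<forall>\<^sub>F j in sequentially. norm (z j - z0) \<le> l2n M (pev p) * l2n M (\<lambda>x. g x - pev (P j) x)"
      proof (intro always_eventually allI)
        fix j
        have "z j - z0 = (\<integral>x. pev p x * cnj (g x) \<partial>M) - (\<integral>x. pev p x * cnj (pev (P j) x) \<partial>M)"
          by (simp add: z_def z0_def)
        also have "\<dots> = (\<integral>x. pev p x * cnj (g x) - pev p x * cnj (pev (P j) x) \<partial>M)"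
          by (intro Bochner_Integration.integral_diff[symmetric] sqint_mult sqint_cnj g sqint_pev)
        also have "\<dots> = (\<integral>x. pev p x * cnj (g x - pev (P j) x) \<partial>M)"
          by (simp add: algebra_simps)
        finally show "norm (z j - z0) \<le> l2n M (pev p) * l2n M (\<lambda>x. g x - pev (P j) x)"
          using l2n_Cauchy_Schwarz[OF sqint_pev[of p] sqint_cnj[OF sqint_diff[OF g sqint_pev[of "P j"]]]]
          by (simp only: l2n_cnj)
      qed
    qed
    \<comment> \<open>Move the near-minimiser in the direction \<open>p\<close> by
      \<open>s = t cnj (z j)\<close>: the infimum \<open>m\<close> cannot be undercut, so the
      first-order term is at most the slack plus the second-order term.\<close>
    have var: "2 * t * (cmod (z j))\<^sup>2 \<le> (1/4)^j / 8 + t\<^sup>2 * (cmod (z j))\<^sup>2 * (l2n M (pev p))\<^sup>2" for t j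
    proof -
      define s where "s = of_real t * cnj (z j)"
      have I: "integrable M (\<lambda>x. (cmod (pev r x))\<^sup>2)" for r using sqint_pev[of r] by (simp add: sqint_def)
      have I2: "integrable M (\<lambda>x. pev p x * cnj (pev (P j) x))" by (intro sqint_mult sqint_cnj sqint_pev)
      have "(cmod (pev (P j + smult s p) x))\<^sup>2 = (cmod (pev (P j) x))\<^sup>2 + 2 * Re (s * (pev p x * cnj (pev (P j) x))) + (cmod s)\<^sup>2 * (cmod (pev p x))\<^sup>2" for x
        unfolding cmod_power2 by (simp add: power2_eq_square algebra_simps)
      then have "(l2n M (pev (P j + smult s p)))\<^sup>2 = (\<integral>x. (cmod (pev (P j) x))\<^sup>2 + 2 * Re (s * (pev p x * cnj (pev (P j) x))) + (cmod s)\<^sup>2 * (cmod (pev p x))\<^sup>2 \<partial>M)"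
        by (simp only: l2n_power2)
      also have "\<dots> = (l2n M (pev (P j)))\<^sup>2 + 2 * Re (s * (\<integral>x. pev p x * cnj (pev (P j) x) \<partial>M)) + (cmod s)\<^sup>2 * (l2n M (pev p))\<^sup>2"
        unfolding l2n_power2 using I[of "P j"] I[of p] I2
        by (simp add: Bochner_Integration.integral_add integrable_Re integral_Re del: Re_complex_of_real times_complex.simps)
      finally have "q (P j + smult s p) = q (P j) - 2 * Re (s * z j) + (cmod s)\<^sup>2 * (l2n M (pev p))\<^sup>2"
        by (simp add: q_def add smult z_def algebra_simps)
      moreover have "Re (s * z j) = t * (cmod (z j))\<^sup>2"
        unfolding s_def cmod_power2 by (simp add: power2_eq_square algebra_simps)
      moreover have "(cmod s)\<^sup>2 = t\<^sup>2 * (cmod (z j))\<^sup>2"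
        by (simp add: s_def norm_mult power_mult_distrib)
      ultimately show ?thesis using m_le[of "P j + smult s p"] P[of j] by simp
    qed
    have lim2: "2 * t * (cmod z0)\<^sup>2 \<le> t\<^sup>2 * (cmod z0)\<^sup>2 * (l2n M (pev p))\<^sup>2" for t
    proof (rule LIMSEQ_le)
      show "(\<lambda>j. 2 * t * (cmod (z j))\<^sup>2) \<longlonglongrightarrow> 2 * t * (cmod z0)\<^sup>2" by (intro tendsto_intros zl)
      have "(\<lambda>j. (1/4::real)^j / 8 + t\<^sup>2 * (cmod (z j))\<^sup>2 * (l2n M (pev p))\<^sup>2) \<longlonglongrightarrow> 0 / 8 + t\<^sup>2 * (cmod z0)\<^sup>2 * (l2n M (pev p))\<^sup>2"
        by (intro tendsto_intros zl LIMSEQ_realpow_zero) auto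
      then show "(\<lambda>j. (1/4::real)^j / 8 + t\<^sup>2 * (cmod (z j))\<^sup>2 * (l2n M (pev p))\<^sup>2) \<longlonglongrightarrow> t\<^sup>2 * (cmod z0)\<^sup>2 * (l2n M (pev p))\<^sup>2"
        by simp
      show "\<exists>N. \<forall>j\<ge>N. 2 * t * (cmod (z j))\<^sup>2 \<le> (1/4)^j / 8 + t\<^sup>2 * (cmod (z j))\<^sup>2 * (l2n M (pev p))\<^sup>2"
        using var by blast
    qed
    have "z0 = 0"
    proof (rule ccontr)
      assume nz: "z0 \<noteq> 0"
      define b where "b = (l2n M (pev p))\<^sup>2 + 1"
      have b: "b > 0" by (simp add: b_def add_nonneg_pos)
      \<comment> \<open>At t = 1/b, with \<open>b\<close> exceeding the squared norm of
        \<open>p\<close>, the quadratic term is too small to balance the linear one.\<close>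
      have "2 * (1/b) * (cmod z0)\<^sup>2 \<le> (1/b)\<^sup>2 * (cmod z0)\<^sup>2 * (b - 1)"
        using lim2[of "1/b"] by (simp add: b_def)
      also have "\<dots> \<le> (1/b)\<^sup>2 * (cmod z0)\<^sup>2 * b" by (intro mult_left_mono) auto
      also have "\<dots> = (1/b) * (cmod z0)\<^sup>2" using b by (simp add: power2_eq_square)
      finally have "(1/b) * (cmod z0)\<^sup>2 \<le> 0" by simp
      then show False using nz b by (simp add: divide_le_0_iff)
    qed
    then show ?thesis by (simp add: z0_def)
  qed
  then show ?thesis using pl2_cnj[OF plg] by blast
qed

text \<open>Applied with \<open>V p i\<close> the i-th coordinate of p(S)u. Bessel on a singleton
  bounds each coordinate functional, and Riesz represents it.\<close>

lemma kernel_exists: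
  fixes V :: "complex poly \<Rightarrow> 'i \<Rightarrow> complex"
  assumes add: "\<And>p q i. V (p + q) i = V p i + V q i" and smult: "\<And>a p i. V (smult a p) i = a * V p i"
    and bessel: "\<And>p F. finite F \<Longrightarrow> (\<Sum>i\<in>F. (cmod (V p i))\<^sup>2) \<le> (l2n M (pev p))\<^sup>2"
  shows "\<exists>\<Phi>. \<forall>i. pl2 (\<Phi> i) \<and> (\<forall>p. V p i = (\<integral>x. pev p x * \<Phi> i x \<partial>M))"
proof -
  have "\<exists>f. pl2 f \<and> (\<forall>p. V p i = (\<integral>x. pev p x * f x \<partial>M))" for i
  proof (rule pl2_Riesz[where c = 1])
    fix p
    have "(cmod (V p i))\<^sup>2 \<le> (l2n M (pev p))\<^sup>2" using bessel[of "{i}" p] by simp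
    then have "cmod (V p i) \<le> l2n M (pev p)" by (rule power2_le_imp_le) simp
    then show "cmod (V p i) \<le> 1 * l2n M (pev p)" by simp
  qed (auto simp: add smult)
  then have "\<forall>i. \<exists>f. pl2 f \<and> (\<forall>p. V p i = (\<integral>x. pev p x * f x \<partial>M))" by blast
  from choice[OF this] show ?thesis .
qed

end

text \<open>\<open>\<Phi>\<close> is the kernel of an isometry from the polynomials into
  square-summable families. The isometry is stated as Bessel plus attainment up to e, the form that
  finite sums allow.\<close>

locale spectral_kernel = compact_measure +
  fixes \<Phi> :: "'i \<Rightarrow> real \<Rightarrow> complex"
  assumes pl2_\<Phi>: "pl2 (\<Phi> i)"
    and bessel_pev: "finite F \<Longrightarrow> (\<Sum>i\<in>F. (cmod (\<integral>x. pev p x * \<Phi> i x \<partial>M))\<^sup>2) \<le> (l2n M (pev p))\<^sup>2"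
    and parseval_pev: "e > 0 \<Longrightarrow> \<exists>F. finite F \<and> (l2n M (pev p))\<^sup>2 - (\<Sum>i\<in>F. (cmod (\<integral>x. pev p x * \<Phi> i x \<partial>M))\<^sup>2) < e"
begin

lemma sqint_\<Phi> [simp]: "sqint M (\<Phi> i)"
  using pl2_\<Phi> pl2_sqint by blast

lemma integral_sum_\<Phi>:
  assumes "sqint M h"
  shows "(\<integral>x. h x * (\<Sum>i\<in>F. c i * \<Phi> i x) \<partial>M) = (\<Sum>i\<in>F. c i * (\<integral>x. h x * \<Phi> i x \<partial>M))"
proof -
  have "(\<integral>x. h x * (\<Sum>i\<in>F. c i * \<Phi> i x) \<partial>M) = (\<integral>x. (\<Sum>i\<in>F. c i * (h x * \<Phi> i x)) \<partial>M)"
    by (simp add: sum_distrib_left algebra_simps)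
  also have "\<dots> = (\<Sum>i\<in>F. c i * (\<integral>x. h x * \<Phi> i x \<partial>M))"
    using sqint_mult[OF assms sqint_\<Phi>] by simp
  finally show ?thesis .
qed

text \<open>These sums are the adjoint of a contraction applied to \<open>c\<close>: Cauchy-Schwarz
  and Bessel on polynomials bound their pairings, and duality bounds their norm.\<close>

lemma l2n_sum_\<Phi>:
  assumes F: "finite F"
  shows "l2n M (\<lambda>x. \<Sum>i\<in>F. c i * \<Phi> i x) \<le> L2_set (\<lambda>i. cmod (c i)) F"
proof (rule pl2_norm_bound)
  show "pl2 (\<lambda>x. \<Sum>i\<in>F. c i * \<Phi> i x)" by (intro pl2_sum pl2_cmult pl2_\<Phi>)
  show "0 \<le> L2_set (\<lambda>i. cmod (c i)) F" by simp
  fix p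
  define v where "v i = (\<integral>x. pev p x * \<Phi> i x \<partial>M)" for i
  have "cmod (\<integral>x. pev p x * (\<Sum>i\<in>F. c i * \<Phi> i x) \<partial>M) = cmod (\<Sum>i\<in>F. c i * v i)"
    unfolding integral_sum_\<Phi>[OF sqint_pev] v_def ..
  also have "\<dots> \<le> (\<Sum>i\<in>F. \<bar>cmod (c i)\<bar> * \<bar>cmod (v i)\<bar>)"
    by (rule order_trans[OF norm_sum]) (simp add: norm_mult)
  also have "\<dots> \<le> L2_set (\<lambda>i. cmod (c i)) F * L2_set (\<lambda>i. cmod (v i)) F" by (rule L2_set_mult_ineq)
  also have "\<dots> \<le> L2_set (\<lambda>i. cmod (c i)) F * l2n M (pev p)"
    using bessel_pev[OF F, of p] unfolding L2_set_def v_def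
    by (intro mult_left_mono real_le_lsqrt) (auto intro: sum_nonneg)
  finally show "cmod (\<integral>x. pev p x * (\<Sum>i\<in>F. c i * \<Phi> i x) \<partial>M) \<le> L2_set (\<lambda>i. cmod (c i)) F * l2n M (pev p)" .
qed

text \<open>A second duality carries Bessel from polynomials to every square-integrable
  \<open>h\<close>: test \<open>h\<close> against the finite sum built from its own
  coefficients.\<close>

lemma bessel:
  assumes F: "finite F" and h: "sqint M h"
  shows "L2_set (\<lambda>i. cmod (\<integral>x. h x * \<Phi> i x \<partial>M)) F \<le> l2n M h"
proof -
  define w where "w i = (\<integral>x. h x * \<Phi> i x \<partial>M)" for i
  define s where "s = L2_set (\<lambda>i. cmod (w i)) F"
  have s0: "s \<ge> 0" by (simp add: s_def)
  have s2: "complex_of_real (s\<^sup>2) = (\<Sum>i\<in>F. cnj (w i) * w i)"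
    unfolding s_def L2_set_def using sum_nonneg[of F "\<lambda>i. (cmod (w i))\<^sup>2"]
    by (simp add: complex_norm_square mult.commute del: of_real_power)
  have "s\<^sup>2 = cmod (complex_of_real (s\<^sup>2))" unfolding norm_of_real by simp
  also have "\<dots> = cmod (\<integral>x. h x * (\<Sum>i\<in>F. cnj (w i) * \<Phi> i x) \<partial>M)"
    unfolding s2 integral_sum_\<Phi>[OF h] w_def ..
  also have "\<dots> \<le> l2n M h * l2n M (\<lambda>x. \<Sum>i\<in>F. cnj (w i) * \<Phi> i x)"
    by (intro l2n_Cauchy_Schwarz h sqint_sum sqint_cmult sqint_\<Phi>)
  also have "\<dots> \<le> l2n M h * s"
    using l2n_sum_\<Phi>[OF F, of "\<lambda>i. cnj (w i)"] by (intro mult_left_mono) (auto simp: s_def)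
  finally have "s * s \<le> l2n M h * s" by (simp add: power2_eq_square)
  then show ?thesis
    using s0 unfolding s_def[symmetric] w_def[symmetric] by (cases "s = 0") auto
qed

text \<open>Parseval as norm convergence of the expansion, uniform over all finite sets containing
  \<open>F\<close>; the uniformity later gives small tails. The limit is \<open>cnj h\<close>
  because the coefficients are taken without conjugation.\<close>

lemma parseval:
  assumes h: "pl2 h" and e: "e > 0"
  shows "\<exists>F. finite F \<and> (\<forall>F'. finite F' \<longrightarrow> F \<subseteq> F' \<longrightarrow>
     l2n M (\<lambda>x. (\<Sum>i\<in>F'. cnj (\<integral>y. h y * \<Phi> i y \<partial>M) * \<Phi> i x) - cnj (h x)) < e)"
proof -
  obtain p where p: "l2n M (\<lambda>x. h x - pev p x) < e / 4"
    using h e unfolding pl2_def by (metis zero_less_divide_iff zero_less_numeral)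
  have "(e/4)\<^sup>2 > 0" using e by simp
  from parseval_pev[OF this, of p] obtain F where F: "finite F"
    "(l2n M (pev p))\<^sup>2 - (\<Sum>i\<in>F. (cmod (\<integral>x. pev p x * \<Phi> i x \<partial>M))\<^sup>2) < (e/4)\<^sup>2" by blast
  have "l2n M (\<lambda>x. (\<Sum>i\<in>F'. cnj (\<integral>y. h y * \<Phi> i y \<partial>M) * \<Phi> i x) - cnj (h x)) < e"
    if F': "finite F'" "F \<subseteq> F'" for F'
  proof -
    define w where "w i = (\<integral>x. h x * \<Phi> i x \<partial>M)" for i
    define v where "v i = (\<integral>x. pev p x * \<Phi> i x \<partial>M)" for i
    define S where "S x = (\<Sum>i\<in>F'. cnj (w i) * \<Phi> i x)" for x
    define T where "T x = (\<Sum>i\<in>F'. cnj (v i) * \<Phi> i x)" for x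
    have sS: "sqint M S" and sT: "sqint M T" unfolding S_def T_def by (auto intro!: sqint_sum sqint_cmult)
    have sh: "sqint M h" using h pl2_sqint by blast
    have shp: "sqint M (\<lambda>x. h x - pev p x)" using sh by (intro sqint_diff sqint_pev)
    define r where "r = (\<Sum>i\<in>F'. (cmod (v i))\<^sup>2)"
    have r0: "r \<ge> 0" by (simp add: r_def sum_nonneg)
    have "(\<Sum>i\<in>F. (cmod (v i))\<^sup>2) \<le> r" unfolding r_def by (intro sum_mono2 F') auto
    then have r: "(l2n M (pev p))\<^sup>2 - r < (e/4)\<^sup>2" using F(2) by (simp add: v_def)
    \<comment> \<open>\<open>T\<close> has squared norm at most \<open>r\<close> and pairing exactly
      \<open>r\<close> with \<open>p\<close>; expanding the square bounds its squared distance to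
      \<open>cnj p\<close> by the Parseval defect.\<close>
    have T1: "(l2n M T)\<^sup>2 \<le> r"
    proof -
      have "l2n M T \<le> sqrt r"
        using l2n_sum_\<Phi>[OF F'(1), of "\<lambda>i. cnj (v i)"] by (simp add: L2_set_def r_def T_def[abs_def])
      then have "(l2n M T)\<^sup>2 \<le> (sqrt r)\<^sup>2" by (intro power_mono) auto
      then show ?thesis using r0 by simp
    qed
    have T2: "(\<integral>x. pev p x * T x \<partial>M) = of_real r"
      unfolding T_def integral_sum_\<Phi>[OF sqint_pev] v_def[symmetric] r_def
      by (simp add: complex_norm_square mult.commute del: of_real_power)
    have I: "integrable M (\<lambda>x. (cmod (T x))\<^sup>2)" "integrable M (\<lambda>x. (cmod (pev p x))\<^sup>2)" "integrable M (\<lambda>x. pev p x * T x)"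
      using sT sqint_pev[of p] sqint_mult[OF sqint_pev[of p] sT] by (auto simp: sqint_def)
    have "(cmod (T x - cnj (pev p x)))\<^sup>2 = (cmod (T x))\<^sup>2 - 2 * Re (pev p x * T x) + (cmod (pev p x))\<^sup>2" for x
      unfolding cmod_power2 by (simp add: power2_eq_square algebra_simps)
    then have "(l2n M (\<lambda>x. T x - cnj (pev p x)))\<^sup>2 = (\<integral>x. (cmod (T x))\<^sup>2 - 2 * Re (pev p x * T x) + (cmod (pev p x))\<^sup>2 \<partial>M)"
      by (simp only: l2n_power2)
    also have "\<dots> = (l2n M T)\<^sup>2 - 2 * r + (l2n M (pev p))\<^sup>2"
      unfolding l2n_power2 using I T2 by (simp add: integral_Re del: times_complex.simps)
    also have "\<dots> < (e/4)\<^sup>2" using T1 r by linarith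
    finally have T3: "l2n M (\<lambda>x. T x - cnj (pev p x)) < e/4"
      by (rule power2_less_imp_less) (use e in simp)
    have "l2n M (\<lambda>x. S x - T x) = l2n M (\<lambda>x. \<Sum>i\<in>F'. cnj (w i - v i) * \<Phi> i x)"
      by (simp add: S_def T_def sum_subtractf algebra_simps)
    also have "\<dots> \<le> L2_set (\<lambda>i. cmod (cnj (w i - v i))) F'" by (rule l2n_sum_\<Phi>[OF F'(1)])
    also have "\<dots> = L2_set (\<lambda>i. cmod (\<integral>x. (h x - pev p x) * \<Phi> i x \<partial>M)) F'"
    proof -
      have "w i - v i = (\<integral>x. (h x - pev p x) * \<Phi> i x \<partial>M)" for i
        unfolding w_def v_def left_diff_distrib
        by (intro Bochner_Integration.integral_diff[symmetric] sqint_mult sh sqint_pev sqint_\<Phi>)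
      then show ?thesis by simp
    qed
    also have "\<dots> \<le> l2n M (\<lambda>x. h x - pev p x)" by (rule bessel[OF F'(1) shp])
    finally have ST: "l2n M (\<lambda>x. S x - T x) < e/4" using p by linarith
    have ph: "l2n M (\<lambda>x. cnj (pev p x) - cnj (h x)) < e/4"
      using p l2n_cnj[of M "\<lambda>x. h x - pev p x"] l2n_minus_commute[of M "\<lambda>x. cnj (h x)" "\<lambda>x. cnj (pev p x)"] by simp
    have "l2n M (\<lambda>x. S x - cnj (h x)) \<le> l2n M (\<lambda>x. S x - T x) + l2n M (\<lambda>x. T x - cnj (h x))"
      by (intro l2n_triangle_diff sS sT sqint_cnj sh)
    also have "l2n M (\<lambda>x. T x - cnj (h x)) \<le> l2n M (\<lambda>x. T x - cnj (pev p x)) + l2n M (\<lambda>x. cnj (pev p x) - cnj (h x))"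
      by (intro l2n_triangle_diff sT sqint_cnj sh sqint_pev)
    finally show ?thesis using ST T3 ph e by (simp add: S_def w_def)
  qed
  then show ?thesis using F(1) by blast
qed

end

section \<open>Cauchy transforms of measures with bounded density\<close>

text \<open>The Cauchy kernel 1/(x - z) at z = s + i \<epsilon>; positive height keeps it bounded on
  the real line.\<close>

definition ck :: "real \<Rightarrow> real \<Rightarrow> real \<Rightarrow> complex" where
  "ck \<epsilon> x s = 1 / (of_real x - of_real s - \<i> * of_real \<epsilon>)"

lemma ck_denom_nz: "\<epsilon> > 0 \<Longrightarrow> complex_of_real x - of_real s - \<i> * of_real \<epsilon> \<noteq> 0"
  by (auto simp: complex_eq_iff)

lemma cmod_ck_power2: "(cmod (ck \<epsilon> x s))\<^sup>2 = 1 / ((s - x)\<^sup>2 + \<epsilon>\<^sup>2)"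
  by (simp add: ck_def norm_divide power_divide cmod_power2 power2_commute)

lemma cmod_ck_le: "\<epsilon> > 0 \<Longrightarrow> cmod (ck \<epsilon> x s) \<le> 1 / \<epsilon>"
  by (rule power2_le_imp_le) (auto simp: cmod_ck_power2 power_divide intro!: divide_left_mono mult_pos_pos add_nonneg_pos)

lemma ck_measurable [measurable]: "case_prod (ck \<epsilon>) \<in> borel_measurable (borel \<Otimes>\<^sub>M borel)"
  unfolding ck_def by measurable

lemma ck_borel1 [measurable]: "(\<lambda>x. ck \<epsilon> x s) \<in> borel_measurable borel"
  unfolding ck_def by measurable

lemma ck_borel2 [measurable]: "ck \<epsilon> x \<in> borel_measurable borel"
  unfolding ck_def by measurable

text \<open>The squared modulus is a multiple of the Poisson kernel, with an arctan
  primitive.\<close>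

lemma has_integral_ck_norm:
  assumes e: "\<epsilon> > 0"
  shows "integrable lborel (\<lambda>s. (cmod (ck \<epsilon> x s))\<^sup>2)" "(\<integral>s. (cmod (ck \<epsilon> x s))\<^sup>2 \<partial>lborel) = pi / \<epsilon>"
proof -
  define F where "F s = arctan ((s - x) / \<epsilon>) / \<epsilon>" for s
  have pos: "(s - x)\<^sup>2 + \<epsilon>\<^sup>2 > 0" for s using e by (simp add: add_nonneg_pos)
  have D: "DERIV F s :> (cmod (ck \<epsilon> x s))\<^sup>2" for s
  proof -
    have "DERIV F s :> inverse (1 + ((s - x) / \<epsilon>)\<^sup>2) * (1 / \<epsilon>) / \<epsilon>"
      unfolding F_def using e by (auto intro!: derivative_eq_intros)
    also have "inverse (1 + ((s - x) / \<epsilon>)\<^sup>2) * (1 / \<epsilon>) / \<epsilon> = (cmod (ck \<epsilon> x s))\<^sup>2"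
    proof -
      have "1 + ((s - x) / \<epsilon>)\<^sup>2 = ((s - x)\<^sup>2 + \<epsilon>\<^sup>2) / \<epsilon>\<^sup>2"
        using e by (simp add: power_divide add_divide_distrib)
      then show ?thesis unfolding cmod_ck_power2 using e by (simp add: power2_eq_square)
    qed
    finally show ?thesis .
  qed
  have C: "isCont (\<lambda>s. (cmod (ck \<epsilon> x s))\<^sup>2) s" for s
    unfolding cmod_ck_power2 using pos[of s] by (intro continuous_intros) auto
  have A: "((F \<circ> real_of_ereal) \<longlongrightarrow> - (pi * inverse \<epsilon> / 2)) (at_right (-\<infinity>))"
    unfolding F_def ereal_tendsto_simps using e by real_asymp
  have B: "((F \<circ> real_of_ereal) \<longlongrightarrow> pi * inverse \<epsilon> / 2) (at_left \<infinity>)"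
    unfolding F_def ereal_tendsto_simps using e by real_asymp
  have 1: "set_integrable lborel (einterval (-\<infinity>) \<infinity>) (\<lambda>s. (cmod (ck \<epsilon> x s))\<^sup>2)"
    by (rule interval_integral_FTC_nonneg(1)[OF _ D C _ A B]) auto
  then show "integrable lborel (\<lambda>s. (cmod (ck \<epsilon> x s))\<^sup>2)"
    by (simp add: set_integrable_def)
  have "(LBINT s=-\<infinity>..\<infinity>. (cmod (ck \<epsilon> x s))\<^sup>2) = pi * inverse \<epsilon> / 2 - - (pi * inverse \<epsilon> / 2)"
    by (rule interval_integral_FTC_nonneg(2)[OF _ D C _ A B]) auto
  then show "(\<integral>s. (cmod (ck \<epsilon> x s))\<^sup>2 \<partial>lborel) = pi / \<epsilon>"
    by (simp add: interval_lebesgue_integral_def set_lebesgue_integral_def field_simps)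
qed

lemma sqint_ck: "\<epsilon> > 0 \<Longrightarrow> sqint lborel (ck \<epsilon> x)"
  unfolding sqint_def using has_integral_ck_norm(1) by auto

lemma l2n_ck: "\<epsilon> > 0 \<Longrightarrow> l2n lborel (ck \<epsilon> x) = sqrt (pi / \<epsilon>)"
  unfolding l2n_def using has_integral_ck_norm(2) by simp

text \<open>Partial fractions write the product as the difference of the two factors divided by
  \<open>c\<close>. In the primitive the logarithms cancel at both ends and the arctangents
  contribute 2 pi i. The heights of the two factors add, which is the source of the doubling in
  Cotlar's trick.\<close>

lemma integral_ck_ck:
  assumes e: "\<epsilon> > 0"
  shows "(\<integral>s. ck \<epsilon> x s * cnj (ck \<epsilon> y s) \<partial>lborel) = - 2 * pi * \<i> * ck (2 * \<epsilon>) x y"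
proof -
  define G where "G s = complex_of_real (ln ((s - y)\<^sup>2 + \<epsilon>\<^sup>2) / 2 - ln ((s - x)\<^sup>2 + \<epsilon>\<^sup>2) / 2)
      + \<i> * of_real (arctan ((s - x) / \<epsilon>) + arctan ((s - y) / \<epsilon>))" for s
  define c where "c = complex_of_real y - of_real x + 2 * \<i> * of_real \<epsilon>"
  have c: "c \<noteq> 0" using e by (auto simp: c_def complex_eq_iff)
  have pos: "(s - t)\<^sup>2 + \<epsilon>\<^sup>2 > 0" for s t using e by (simp add: add_nonneg_pos)
  define g where "g s = complex_of_real ((s - y) / ((s - y)\<^sup>2 + \<epsilon>\<^sup>2) - (s - x) / ((s - x)\<^sup>2 + \<epsilon>\<^sup>2))
      + \<i> * of_real (\<epsilon> / ((s - x)\<^sup>2 + \<epsilon>\<^sup>2) + \<epsilon> / ((s - y)\<^sup>2 + \<epsilon>\<^sup>2))" for s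
  have at: "DERIV (\<lambda>s. arctan ((s - t) / \<epsilon>)) s :> \<epsilon> / ((s - t)\<^sup>2 + \<epsilon>\<^sup>2)" for s t
  proof -
    have "DERIV (\<lambda>s. arctan ((s - t) / \<epsilon>)) s :> inverse (1 + ((s - t) / \<epsilon>)\<^sup>2) * (1 / \<epsilon>)"
      using e by (auto intro!: derivative_eq_intros)
    also have "inverse (1 + ((s - t) / \<epsilon>)\<^sup>2) * (1 / \<epsilon>) = \<epsilon> / ((s - t)\<^sup>2 + \<epsilon>\<^sup>2)"
    proof -
      have "1 + ((s - t) / \<epsilon>)\<^sup>2 = ((s - t)\<^sup>2 + \<epsilon>\<^sup>2) / \<epsilon>\<^sup>2"
        using e by (simp add: power_divide add_divide_distrib)
      then show ?thesis using e by (simp add: power2_eq_square)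
    qed
    finally show ?thesis .
  qed
  have lt: "DERIV (\<lambda>s. ln ((s - t)\<^sup>2 + \<epsilon>\<^sup>2) / 2) s :> (s - t) / ((s - t)\<^sup>2 + \<epsilon>\<^sup>2)" for s t
  proof -
    have "DERIV (\<lambda>s. (s - t)\<^sup>2 + \<epsilon>\<^sup>2) s :> 2 * (s - t)"
      by (auto intro!: derivative_eq_intros)
    from DERIV_chain2[OF DERIV_ln_divide[OF pos] this]
    have "DERIV (\<lambda>s. ln ((s - t)\<^sup>2 + \<epsilon>\<^sup>2) / 2) s :> (1 / ((s - t)\<^sup>2 + \<epsilon>\<^sup>2) * (2 * (s - t))) / 2"
      by (rule DERIV_cdivide)
    moreover have "(1 / d * (2 * a)) / 2 = a / d" for a d :: real by simp
    ultimately show ?thesis by (simp only:)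
  qed
  have D: "(G has_vector_derivative g s) (at s)" for s
    unfolding G_def g_def
    by (intro has_vector_derivative_add has_vector_derivative_mult_right has_vector_derivative_of_real
        DERIV_diff DERIV_add at lt)
  have eq: "ck \<epsilon> x s * cnj (ck \<epsilon> y s) = g s / c" for s
  proof -
    let ?a = "complex_of_real x - of_real s - \<i> * of_real \<epsilon>" and ?b = "complex_of_real y - of_real s + \<i> * of_real \<epsilon>"
    have nz: "?a \<noteq> 0" "?b \<noteq> 0" using e by (auto simp: complex_eq_iff)
    have "1 / ?a = (complex_of_real (x - s) + \<i> * of_real \<epsilon>) / of_real ((s - x)\<^sup>2 + \<epsilon>\<^sup>2)"
    proof -
      have "(complex_of_real (x - s) + \<i> * of_real \<epsilon>) * ?a = of_real ((s - x)\<^sup>2 + \<epsilon>\<^sup>2)"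
        by (simp add: complex_eq_iff power2_eq_square algebra_simps)
      moreover have "complex_of_real ((s - x)\<^sup>2 + \<epsilon>\<^sup>2) \<noteq> 0" using pos[of s x] by (simp only: of_real_eq_0_iff)
      ultimately show ?thesis using nz(1) by (simp add: frac_eq_eq)
    qed
    moreover have "1 / ?b = (complex_of_real (y - s) - \<i> * of_real \<epsilon>) / of_real ((s - y)\<^sup>2 + \<epsilon>\<^sup>2)"
    proof -
      have "(complex_of_real (y - s) - \<i> * of_real \<epsilon>) * ?b = of_real ((s - y)\<^sup>2 + \<epsilon>\<^sup>2)"
        by (simp add: complex_eq_iff power2_eq_square algebra_simps)
      moreover have "complex_of_real ((s - y)\<^sup>2 + \<epsilon>\<^sup>2) \<noteq> 0" using pos[of s y] by (simp only: of_real_eq_0_iff)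
      ultimately show ?thesis using nz(2) by (simp add: frac_eq_eq)
    qed
    ultimately have "1 / ?a - 1 / ?b = g s"
      unfolding g_def complex_eq_iff by (simp add: Re_divide_of_real Im_divide_of_real diff_divide_distrib)
    moreover have "?b - ?a = c" by (simp add: c_def)
    moreover have "(1 / ?a - 1 / ?b) = (?b - ?a) * (1 / ?a * (1 / ?b))"
      using nz by (simp add: field_simps)
    ultimately have "g s = c * (1 / ?a * (1 / ?b))" by simp
    then show ?thesis using c by (simp add: ck_def)
  qed
  have I: "integrable lborel (\<lambda>s. ck \<epsilon> x s * cnj (ck \<epsilon> y s))"
    by (intro sqint_mult sqint_cnj sqint_ck e)
  have "integrable lborel (\<lambda>s. c * (ck \<epsilon> x s * cnj (ck \<epsilon> y s)))"
    using I by simp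
  then have Ig: "integrable lborel g"
    using c by (simp add: eq)
  have L: "((\<lambda>s. f s) \<longlongrightarrow> l) F \<Longrightarrow> ((\<lambda>s. h s) \<longlongrightarrow> m) F \<Longrightarrow>
     ((\<lambda>s. complex_of_real (f s) + \<i> * of_real (h s)) \<longlongrightarrow> of_real l + \<i> * of_real m) F" for f h l m and F :: "real filter"
    by (intro tendsto_intros)
  have A: "((G \<circ> real_of_ereal) \<longlongrightarrow> of_real 0 + \<i> * of_real (- pi)) (at_right (-\<infinity>))"
    unfolding G_def ereal_tendsto_simps
  proof (rule L)
    show "((\<lambda>s. ln ((s - y)\<^sup>2 + \<epsilon>\<^sup>2) / 2 - ln ((s - x)\<^sup>2 + \<epsilon>\<^sup>2) / 2) \<longlongrightarrow> 0) at_bot" by real_asymp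
    show "((\<lambda>s. arctan ((s - x) / \<epsilon>) + arctan ((s - y) / \<epsilon>)) \<longlongrightarrow> - pi) at_bot" using e by real_asymp
  qed
  have B: "((G \<circ> real_of_ereal) \<longlongrightarrow> of_real 0 + \<i> * of_real pi) (at_left \<infinity>)"
    unfolding G_def ereal_tendsto_simps
  proof (rule L)
    show "((\<lambda>s. ln ((s - y)\<^sup>2 + \<epsilon>\<^sup>2) / 2 - ln ((s - x)\<^sup>2 + \<epsilon>\<^sup>2) / 2) \<longlongrightarrow> 0) at_top" by real_asymp
    show "((\<lambda>s. arctan ((s - x) / \<epsilon>) + arctan ((s - y) / \<epsilon>)) \<longlongrightarrow> pi) at_top" using e by real_asymp
  qed
  have cont: "isCont g s" for s
    unfolding g_def using pos[of s x] pos[of s y] by (intro continuous_intros) auto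
  have "(LBINT s=-\<infinity>..\<infinity>. g s) = (of_real 0 + \<i> * of_real pi) - (of_real 0 + \<i> * of_real (- pi))"
    by (rule interval_integral_FTC_integrable[OF _ D cont _ A B])
       (use Ig in \<open>auto simp: set_integrable_def\<close>)
  then have "(\<integral>s. g s \<partial>lborel) = 2 * pi * \<i>"
    by (simp add: interval_lebesgue_integral_def set_lebesgue_integral_def)
  then have "(\<integral>s. ck \<epsilon> x s * cnj (ck \<epsilon> y s) \<partial>lborel) = 2 * pi * \<i> / c"
    by (simp add: eq)
  also have "\<dots> = - 2 * pi * \<i> * ck (2 * \<epsilon>) x y"
  proof -
    have "c = - (complex_of_real x - of_real y - \<i> * of_real (2 * \<epsilon>))" by (simp add: c_def)
    then show ?thesis by (simp add: ck_def divide_minus_right del: minus_diff_eq)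
  qed
  finally show ?thesis .
qed

text \<open>A Lebesgue density bounded by \<open>K\<close>, stated on sets so that no density
  function has to be chosen.\<close>

locale lipschitz_measure = finite_measure M for M :: "real measure" +
  fixes K :: real
  assumes sets_M [measurable_cong, simp]: "sets M = sets borel"
    and K: "K > 0" "\<And>B. B \<in> sets borel \<Longrightarrow> emeasure M B \<le> ennreal K * emeasure lborel B"
begin

lemma nn_integral_le:
  assumes "f \<in> borel_measurable borel"
  shows "(\<integral>\<^sup>+x. f x \<partial>M) \<le> ennreal K * (\<integral>\<^sup>+x. f x \<partial>lborel)"
proof -
  have "M \<le> scale_measure (ennreal K) lborel"
    using K by (subst le_measure) auto
  then have "(\<integral>\<^sup>+x. f x \<partial>M) \<le> (\<integral>\<^sup>+x. f x \<partial>scale_measure (ennreal K) lborel)"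
    by (intro nn_integral_mono_measure) auto
  then show ?thesis using assms by (simp add: nn_integral_scale_measure)
qed

lemma sqint_transfer:
  assumes "sqint lborel f"
  shows "sqint M f" "(l2n M f)\<^sup>2 \<le> K * (l2n lborel f)\<^sup>2"
proof -
  have m: "f \<in> borel_measurable borel" using assms by (simp add: sqint_def)
  have i: "integrable lborel (\<lambda>x. (cmod (f x))\<^sup>2)" using assms by (simp add: sqint_def)
  have "(\<integral>\<^sup>+x. ennreal ((cmod (f x))\<^sup>2) \<partial>M) \<le> ennreal K * (\<integral>\<^sup>+x. ennreal ((cmod (f x))\<^sup>2) \<partial>lborel)"
    using m by (intro nn_integral_le) measurable
  also have "\<dots> = ennreal (K * (l2n lborel f)\<^sup>2)"
    using K by (simp add: nn_integral_eq_integral[OF i] l2n_power2 ennreal_mult)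
  finally have b: "(\<integral>\<^sup>+x. ennreal ((cmod (f x))\<^sup>2) \<partial>M) \<le> ennreal (K * (l2n lborel f)\<^sup>2)" .
  have mM: "f \<in> borel_measurable M" using m measurable_cong_sets[OF sets_M refl] by blast
  show s: "sqint M f"
    unfolding sqint_def
  proof
    show "integrable M (\<lambda>x. (cmod (f x))\<^sup>2)"
      by (rule integrableI_bounded) (use mM b in \<open>auto intro: le_less_trans\<close>)
  qed fact
  then have "integrable M (\<lambda>x. (cmod (f x))\<^sup>2)" by (simp add: sqint_def)
  then show "(l2n M f)\<^sup>2 \<le> K * (l2n lborel f)\<^sup>2"
    using b K by (simp add: nn_integral_eq_integral l2n_power2 ennreal_le_iff)
qed

text \<open>The Cauchy transform of \<open>g\<close> against \<open>M\<close>, read as an operator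
  on L2 of the same measure \<open>M\<close>.\<close>

definition T :: "real \<Rightarrow> (real \<Rightarrow> complex) \<Rightarrow> real \<Rightarrow> complex" where
  "T \<epsilon> g s = (\<integral>x. g x * ck \<epsilon> x s \<partial>M)"

lemma sqint_ckM: "\<epsilon> > 0 \<Longrightarrow> sqint M (\<lambda>x. ck \<epsilon> x s)"
  by (rule sqint_bound(1)[OF sqint_const[of "of_real (1/\<epsilon>)"]])
     (use cmod_ck_le in \<open>auto simp: measurable_cong_sets[OF sets_M refl] norm_divide\<close>)

lemma T_measurable:
  assumes "g \<in> borel_measurable borel"
  shows "T \<epsilon> g \<in> borel_measurable borel"
proof -
  note [measurable] = assms
  interpret sigma_finite_measure M by unfold_locales
  show ?thesis unfolding T_def by measurable
qed

lemma cmod_T_le: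
  assumes g: "sqint M g" and e: "\<epsilon> > 0"
  shows "cmod (T \<epsilon> g s) \<le> l2n M g * l2n M (\<lambda>x. 1) / \<epsilon>"
proof -
  have "cmod (T \<epsilon> g s) \<le> (\<integral>x. cmod (g x * ck \<epsilon> x s) \<partial>M)"
    unfolding T_def by (rule integral_norm_bound)
  also have "\<dots> \<le> (\<integral>x. cmod (g x) * cmod (1::complex) / \<epsilon> \<partial>M)"
  proof (rule integral_mono)
    show "integrable M (\<lambda>x. cmod (g x * ck \<epsilon> x s))"
      using sqint_mult[OF g sqint_ckM[OF e]] by simp
    show "integrable M (\<lambda>x. cmod (g x) * cmod (1::complex) / \<epsilon>)"
      using sqint_norm_mult[OF g sqint_const[of 1]] by simp
    show "cmod (g x * ck \<epsilon> x s) \<le> cmod (g x) * cmod (1::complex) / \<epsilon>" for x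
      using mult_left_mono[OF cmod_ck_le[OF e, of x s], of "cmod (g x)"] by (simp add: norm_mult)
  qed
  also have "\<dots> = (\<integral>x. cmod (g x) * cmod (1::complex) \<partial>M) / \<epsilon>" by simp
  also have "\<dots> \<le> l2n M g * l2n M (\<lambda>x. 1) / \<epsilon>"
    using l2n_Cauchy_Schwarz_norm[OF g sqint_const[of 1]] e by (simp add: divide_right_mono)
  finally show ?thesis .
qed

lemma sqint_T:
  assumes g: "sqint M g" and e: "\<epsilon> > 0"
  shows "sqint M (T \<epsilon> g)" "l2n M (T \<epsilon> g) \<le> l2n M g * (l2n M (\<lambda>x. 1))\<^sup>2 / \<epsilon>"
proof -
  define B where "B = l2n M g * l2n M (\<lambda>x. 1) / \<epsilon>"
  have B: "B \<ge> 0" "\<And>s. cmod (T \<epsilon> g s) \<le> B" using e cmod_T_le[OF g e] by (auto simp: B_def)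
  have gm: "g \<in> borel_measurable borel" using g by (simp add: sqint_def measurable_cong_sets[OF sets_M refl])
  have Tm: "T \<epsilon> g \<in> borel_measurable M"
    using T_measurable[OF gm] by (simp add: measurable_cong_sets[OF sets_M refl])
  have le: "AE x in M. cmod (T \<epsilon> g x) \<le> cmod (of_real B * 1)" using B by simp
  note b = sqint_bound[OF sqint_cmult[OF sqint_const] Tm le]
  show "sqint M (T \<epsilon> g)" by (rule b(1))
  have "l2n M (T \<epsilon> g) \<le> l2n M (\<lambda>x. of_real B * 1)" by (rule b(2))
  also have "\<dots> = B * l2n M (\<lambda>x. 1)"
    unfolding l2n_cmult norm_of_real using B(1) by simp
  also have "\<dots> = l2n M g * (l2n M (\<lambda>x. 1))\<^sup>2 / \<epsilon>"
    by (simp add: B_def power2_eq_square)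
  finally show "l2n M (T \<epsilon> g) \<le> l2n M g * (l2n M (\<lambda>x. 1))\<^sup>2 / \<epsilon>" .
qed

text \<open>Write the square as a double integral over x and y and integrate over s first:
  \<open>integral_ck_ck\<close> turns the kernel into the one at height 2 \<epsilon>, leaving the
  pairing of \<open>cnj g\<close> with \<open>T (2 * \<epsilon>) g\<close>.\<close>

lemma T_lborel:
  assumes g: "sqint M g" and e: "\<epsilon> > 0"
  shows "sqint lborel (T \<epsilon> g)" "(l2n lborel (T \<epsilon> g))\<^sup>2 \<le> 2 * pi * l2n M g * l2n M (T (2 * \<epsilon>) g)"
proof -
  have gm [measurable]: "g \<in> borel_measurable borel" using g by (simp add: sqint_def measurable_cong_sets[OF sets_M refl])
  interpret S: sigma_finite_measure M by unfold_locales
  interpret PM: pair_sigma_finite M M by unfold_locales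
  interpret P: pair_sigma_finite "M \<Otimes>\<^sub>M M" lborel
    by (intro pair_sigma_finite.intro PM.P.sigma_finite_measure_axioms lborel.sigma_finite_measure_axioms)
  define H where "H = (\<lambda>p s. g (fst p) * ck \<epsilon> (fst p) s * cnj (g (snd p) * ck \<epsilon> (snd p) s))"
  have setsMM: "sets (M \<Otimes>\<^sub>M M) = sets (borel \<Otimes>\<^sub>M borel)" by (rule sets_pair_measure_cong) auto
  have cnjm [measurable]: "cnj \<in> borel_measurable borel"
    by (intro borel_measurable_continuous_onI continuous_intros)
  have Hm: "case_prod H \<in> borel_measurable ((M \<Otimes>\<^sub>M M) \<Otimes>\<^sub>M lborel)"
    unfolding H_def ck_def by measurable
  have gi: "integrable M (\<lambda>x. cmod (g x))"
    using sqint_norm_mult[OF g sqint_const[of 1]] by simp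
  have prod_int: "integrable (M \<Otimes>\<^sub>M M) (\<lambda>p. f (fst p) * h (snd p))"
    if "integrable M f" "integrable M h" for f h :: "real \<Rightarrow> real"
  proof (rule PM.Fubini_integrable)
    have [measurable]: "f \<in> borel_measurable M" "h \<in> borel_measurable M" using that by auto
    show "(\<lambda>p. f (fst p) * h (snd p)) \<in> borel_measurable (M \<Otimes>\<^sub>M M)" by measurable
    show "integrable M (\<lambda>x. \<integral>y. norm (f (fst (x, y)) * h (snd (x, y))) \<partial>M)"
      using that by (simp add: abs_mult)
    show "AE x in M. integrable M (\<lambda>y. f (fst (x, y)) * h (snd (x, y)))" using that by simp
  qed
  have cki: "integrable lborel (\<lambda>s. cmod (ck \<epsilon> x s) * cmod (ck \<epsilon> y s))"
    "(\<integral>s. cmod (ck \<epsilon> x s) * cmod (ck \<epsilon> y s) \<partial>lborel) \<le> pi / \<epsilon>" for x y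
    using sqint_norm_mult[OF sqint_ck sqint_ck, OF e e] l2n_Cauchy_Schwarz_norm[OF sqint_ck sqint_ck, OF e e, of x y] e
    by (auto simp: l2n_ck)
  have ckH: "(\<integral>s. H p s \<partial>lborel) = g (fst p) * cnj (g (snd p)) * (- 2 * pi * \<i> * ck (2 * \<epsilon>) (fst p) (snd p))" for p
  proof -
    have "(\<integral>s. H p s \<partial>lborel) = (\<integral>s. g (fst p) * cnj (g (snd p)) * (ck \<epsilon> (fst p) s * cnj (ck \<epsilon> (snd p) s)) \<partial>lborel)"
      by (simp add: H_def mult_ac)
    then show ?thesis unfolding integral_mult_right_zero integral_ck_ck[OF e] by simp
  qed
  have Hint: "integrable ((M \<Otimes>\<^sub>M M) \<Otimes>\<^sub>M lborel) (case_prod H)"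
  proof (rule P.Fubini_integrable[OF Hm])
    show "integrable (M \<Otimes>\<^sub>M M) (\<lambda>p. \<integral>s. norm (case_prod H (p, s)) \<partial>lborel)"
    proof (rule integrable_le)
      show "integrable (M \<Otimes>\<^sub>M M) (\<lambda>p. cmod (g (fst p)) * cmod (g (snd p)) * (pi / \<epsilon>))"
        using prod_int[OF gi gi] by simp
      show "(\<lambda>p. \<integral>s. norm (case_prod H (p, s)) \<partial>lborel) \<in> borel_measurable (M \<Otimes>\<^sub>M M)"
        using measurable_compose[OF Hm borel_measurable_norm]
        by (intro lborel.borel_measurable_lebesgue_integral) (simp add: case_prod_beta')
      fix p
      have "(\<integral>s. norm (case_prod H (p, s)) \<partial>lborel) = (\<integral>s. (cmod (g (fst p)) * cmod (g (snd p))) * (cmod (ck \<epsilon> (fst p) s) * cmod (ck \<epsilon> (snd p) s)) \<partial>lborel)"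
        by (simp add: H_def norm_mult mult_ac)
      also have "\<dots> \<le> cmod (g (fst p)) * cmod (g (snd p)) * (pi / \<epsilon>)"
        unfolding integral_mult_right_zero using cki(2) by (intro mult_left_mono) auto
      finally show "norm (\<integral>s. norm (case_prod H (p, s)) \<partial>lborel) \<le> cmod (g (fst p)) * cmod (g (snd p)) * (pi / \<epsilon>)" by simp
    qed
    show "AE p in M \<Otimes>\<^sub>M M. integrable lborel (\<lambda>s. case_prod H (p, s))"
    proof (rule AE_I2)
      fix p
      have "integrable lborel (\<lambda>s. g (fst p) * cnj (g (snd p)) * (ck \<epsilon> (fst p) s * cnj (ck \<epsilon> (snd p) s)))"
        by (intro integrable_mult_right sqint_mult sqint_cnj sqint_ck e)
      then show "integrable lborel (\<lambda>s. case_prod H (p, s))"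
        by (simp add: H_def mult_ac)
    qed
  qed
  have gck: "integrable M (\<lambda>x. g x * ck \<epsilon> x s)" for s by (intro sqint_mult g sqint_ckM e)
  have inner: "(\<integral>p. H p s \<partial>(M \<Otimes>\<^sub>M M)) = T \<epsilon> g s * cnj (T \<epsilon> g s)" for s
  proof -
    have i: "integrable (M \<Otimes>\<^sub>M M) (\<lambda>p. H p s)"
    proof (rule Bochner_Integration.integrable_bound)
      show "integrable (M \<Otimes>\<^sub>M M) (\<lambda>p. cmod (g (fst p) * ck \<epsilon> (fst p) s) * cmod (g (snd p) * ck \<epsilon> (snd p) s))"
        using prod_int[OF integrable_norm[OF gck[of s]] integrable_norm[OF gck[of s]]] .
      show "(\<lambda>p. H p s) \<in> borel_measurable (M \<Otimes>\<^sub>M M)" unfolding H_def ck_def by measurable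
    qed (auto simp: H_def norm_mult)
    have "(\<integral>p. H p s \<partial>(M \<Otimes>\<^sub>M M)) = (\<integral>x. \<integral>y. H (x, y) s \<partial>M \<partial>M)"
      using PM.integral_fst'[OF i] by simp
    also have "\<dots> = (\<integral>x. \<integral>y. (g x * ck \<epsilon> x s) * cnj (g y * ck \<epsilon> y s) \<partial>M \<partial>M)"
      by (simp add: H_def)
    also have "\<dots> = (\<integral>x. (g x * ck \<epsilon> x s) * cnj (T \<epsilon> g s) \<partial>M)"
      unfolding integral_mult_right_zero T_def by (simp only: Bochner_Integration.integral_cnj)
    also have "\<dots> = T \<epsilon> g s * cnj (T \<epsilon> g s)"
      unfolding integral_mult_left_zero T_def ..
    finally show ?thesis .
  qed
  have "integrable lborel (\<lambda>s. \<integral>p. H p s \<partial>(M \<Otimes>\<^sub>M M))"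
    by (rule P.integrable_snd[OF Hint])
  then have Ti: "integrable lborel (\<lambda>s. T \<epsilon> g s * cnj (T \<epsilon> g s))" by (simp only: inner)
  have Tn: "T \<epsilon> g s * cnj (T \<epsilon> g s) = of_real ((cmod (T \<epsilon> g s))\<^sup>2)" for s
    by (rule complex_norm_square[symmetric])
  from Ti have Ti': "integrable lborel (\<lambda>s. (cmod (T \<epsilon> g s))\<^sup>2)"
    unfolding Tn complex_of_real_integrable_eq .
  then show "sqint lborel (T \<epsilon> g)"
    unfolding sqint_def using T_measurable[OF gm] by simp
  have "complex_of_real ((l2n lborel (T \<epsilon> g))\<^sup>2) = (\<integral>s. T \<epsilon> g s * cnj (T \<epsilon> g s) \<partial>lborel)"
    unfolding Tn l2n_power2 by (rule integral_complex_of_real[symmetric])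
  also have "\<dots> = (\<integral>s. (\<integral>p. H p s \<partial>(M \<Otimes>\<^sub>M M)) \<partial>lborel)" by (simp only: inner)
  also have "\<dots> = (\<integral>p. (\<integral>s. H p s \<partial>lborel) \<partial>(M \<Otimes>\<^sub>M M))" by (rule P.Fubini_integral[OF Hint])
  also have "\<dots> = (\<integral>y. \<integral>x. g x * cnj (g y) * (- 2 * pi * \<i> * ck (2 * \<epsilon>) x y) \<partial>M \<partial>M)"
    using PM.integral_snd[of "\<lambda>x y. g x * cnj (g y) * (- 2 * pi * \<i> * ck (2 * \<epsilon>) x y)"] P.integrable_fst[OF Hint]
    unfolding ckH by (simp only: case_prod_beta')
  also have "\<dots> = (\<integral>y. (- 2 * pi * \<i>) * (cnj (g y) * T (2 * \<epsilon>) g y) \<partial>M)"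
  proof (rule Bochner_Integration.integral_cong[OF refl])
    fix y
    have "(\<integral>x. g x * cnj (g y) * (- 2 * pi * \<i> * ck (2 * \<epsilon>) x y) \<partial>M) = (\<integral>x. (- 2 * pi * \<i> * cnj (g y)) * (g x * ck (2 * \<epsilon>) x y) \<partial>M)"
      by (simp add: mult_ac)
    then show "(\<integral>x. g x * cnj (g y) * (- 2 * pi * \<i> * ck (2 * \<epsilon>) x y) \<partial>M) = (- 2 * pi * \<i>) * (cnj (g y) * T (2 * \<epsilon>) g y)"
      unfolding integral_mult_right_zero T_def by (simp add: mult_ac)
  qed
  also have "\<dots> = (- 2 * pi * \<i>) * (\<integral>y. cnj (g y) * T (2 * \<epsilon>) g y \<partial>M)" by (rule integral_mult_right_zero)
  finally have "cmod (complex_of_real ((l2n lborel (T \<epsilon> g))\<^sup>2)) = 2 * pi * cmod (\<integral>y. cnj (g y) * T (2 * \<epsilon>) g y \<partial>M)"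
    by (simp add: norm_mult)
  then have "(l2n lborel (T \<epsilon> g))\<^sup>2 = 2 * pi * cmod (\<integral>y. cnj (g y) * T (2 * \<epsilon>) g y \<partial>M)"
    unfolding norm_of_real by simp
  also have "\<dots> \<le> 2 * pi * (l2n M (\<lambda>y. cnj (g y)) * l2n M (T (2 * \<epsilon>) g))"
    using e by (intro mult_left_mono l2n_Cauchy_Schwarz sqint_cnj g sqint_T) auto
  finally show "(l2n lborel (T \<epsilon> g))\<^sup>2 \<le> 2 * pi * l2n M g * l2n M (T (2 * \<epsilon>) g)" by (simp add: mult_ac)
qed

text \<open>Cotlar's trick: \<open>T\<^sub>\<epsilon>\<^sup>* T\<^sub>\<epsilon>\<close> is a multiple of \<open>T\<^sub>2\<^sub>\<epsilon>\<close>, so a norm bound at \<open>2\<epsilon>\<close> gives the same bound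
  at \<open>\<epsilon>\<close>, and for huge \<open>\<epsilon>\<close> the bound is trivial.\<close>

lemma l2n_T_step:
  assumes "sqint M g" "\<epsilon> > 0"
  shows "(l2n M (T \<epsilon> g))\<^sup>2 \<le> (2 * pi * K * l2n M g) * l2n M (T (2 * \<epsilon>) g)"
proof -
  have "(l2n M (T \<epsilon> g))\<^sup>2 \<le> K * (l2n lborel (T \<epsilon> g))\<^sup>2" by (rule sqint_transfer(2)[OF T_lborel(1)[OF assms]])
  also have "\<dots> \<le> K * (2 * pi * l2n M g * l2n M (T (2 * \<epsilon>) g))"
    using T_lborel(2)[OF assms] K by (intro mult_left_mono) auto
  finally show ?thesis by (simp add: mult_ac)
qed

lemma l2n_T:
  assumes g: "sqint M g" and e: "\<epsilon> > 0"
  shows "l2n M (T \<epsilon> g) \<le> 2 * pi * K * l2n M g"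
proof -
  define c where "c = 2 * pi * K * l2n M g"
  have c0: "c \<ge> 0" using K by (simp add: c_def)
  have step: "l2n M (T \<delta> g) \<le> c" if "l2n M (T (2 * \<delta>) g) \<le> c" "\<delta> > 0" for \<delta>
  proof -
    have "(l2n M (T \<delta> g))\<^sup>2 \<le> c * l2n M (T (2 * \<delta>) g)"
      using l2n_T_step[OF g that(2)] by (simp add: c_def)
    also have "\<dots> \<le> c\<^sup>2" using that c0 by (simp add: power2_eq_square mult_left_mono)
    finally show ?thesis using c0 by (rule power2_le_imp_le)
  qed
  have down: "l2n M (T (2 ^ k * \<epsilon>) g) \<le> c \<Longrightarrow> l2n M (T \<epsilon> g) \<le> c" for k
  proof (induction k)
    case (Suc k)
    then have "l2n M (T (2 * (2 ^ k * \<epsilon>)) g) \<le> c" by (simp add: mult_ac)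
    then have "l2n M (T (2 ^ k * \<epsilon>) g) \<le> c" by (rule step) (use e in simp)
    then show ?case by (rule Suc.IH)
  qed simp
  \<comment> \<open>Once 2^k exceeds \<open>B\<close>, the trivial bound of \<open>sqint_T\<close>
    at height 2^k \<epsilon> is already at most \<open>c\<close>.\<close>
  define B where "B = (l2n M (\<lambda>x. 1))\<^sup>2 / (2 * pi * K * \<epsilon>)"
  obtain k where k: "B < 2 ^ k" using real_arch_pow[of 2 B] by auto
  have "l2n M (T (2 ^ k * \<epsilon>) g) \<le> l2n M g * (l2n M (\<lambda>x. 1))\<^sup>2 / (2 ^ k * \<epsilon>)"
    using e by (intro sqint_T g) simp
  also have "\<dots> = l2n M g * (2 * pi * K) * (B / 2 ^ k)"
    using e K by (simp add: B_def field_simps)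
  also have "\<dots> \<le> l2n M g * (2 * pi * K) * 1"
    using k K by (intro mult_left_mono) auto
  finally show ?thesis using down[of k] by (simp add: c_def mult_ac)
qed

end

section \<open>Orbit sums of a non-integrable singularity\<close>

text \<open>Coprimality makes the map injective on \<open>q\<close> consecutive indices, and
  counting makes it onto.\<close>

lemma bij_betw_mult_mod:
  fixes p q m :: int
  assumes q: "q > 0" and cop: "coprime p q"
  shows "bij_betw (\<lambda>n. (m + int n * p) mod q) {1..nat q} {0..<q}"
proof -
  have inj: "inj_on (\<lambda>n. (m + int n * p) mod q) {1..nat q}"
  proof (rule inj_onI)
    fix a b assume ab: "a \<in> {1..nat q}" "b \<in> {1..nat q}" "(m + int a * p) mod q = (m + int b * p) mod q"
    then have "q dvd (m + int a * p) - (m + int b * p)" by (simp add: mod_eq_dvd_iff)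
    then have "q dvd (int a - int b) * p" by (simp add: algebra_simps)
    then have "q dvd int a - int b" using cop by (simp add: coprime_dvd_mult_left_iff coprime_commute)
    moreover have "\<bar>int a - int b\<bar> < q" using ab by auto
    ultimately have "int a - int b = 0" using dvd_imp_le_int[of "int a - int b" q] q by linarith
    then show "a = b" by simp
  qed
  have sub: "(\<lambda>n. (m + int n * p) mod q) ` {1..nat q} \<subseteq> {0..<q}" using q by auto
  have "(\<lambda>n. (m + int n * p) mod q) ` {1..nat q} = {0..<q}"
  proof (rule card_subset_eq[OF _ sub])
    show "card ((\<lambda>n. (m + int n * p) mod q) ` {1..nat q}) = card {0..<q}"
      using card_image[OF inj] q by simp
  qed simp
  with inj show ?thesis by (simp add: bij_betw_def)
qed

lemma abs_cos_diff_le: "\<bar>cos a - cos b\<bar> \<le> \<bar>a - b :: real\<bar>"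
proof -
  have "\<bar>cos a - cos b\<bar> = 2 * (\<bar>sin ((a + b) / 2)\<bar> * \<bar>sin ((b - a) / 2)\<bar>)"
    by (simp add: cos_diff_cos abs_mult)
  also have "\<dots> \<le> 2 * (1 * \<bar>(b - a) / 2\<bar>)"
    by (intro mult_left_mono mult_mono abs_sin_x_le_abs_x) auto
  finally show ?thesis by simp
qed

text \<open>The harmonic series, with the shift 3 that the errors of the orbit estimate
  produce.\<close>

lemma ex_harm_ge: "\<exists>n. C \<le> (\<Sum>r<n. 1 / (real r + 3))"
proof (rule ccontr)
  assume "\<not> ?thesis"
  then have b: "(\<Sum>r<n. 1 / (real r + 3)) \<le> C" for n by (simp add: not_le less_imp_le)
  have "summable (\<lambda>r. 1 / (real r + 3))"
    by (rule bounded_imp_summable[where B = C]) (simp_all only: lessThan_Suc_atMost[symmetric] b, simp)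
  then have "summable (\<lambda>r. inverse (real (r + 3)))" by (simp add: inverse_eq_divide)
  then have "summable (\<lambda>r. inverse (real r))" using summable_iff_shift[of "\<lambda>r. inverse (real r)" 3] by simp
  then show False using not_summable_harmonic by blast
qed

text \<open>If \<open>q\<close> is the denominator of a Dirichlet approximation of \<open>2\<alpha>\<close>, then \<open>q\<close> consecutive orbit points are
  spread over the residue classes modulo \<open>q\<close>, so the sum is at least a constant times \<open>q log q\<close>.\<close>

lemma dirichlet_sum_large:
  assumes irr: "alpha \<notin> \<rat>" and lam: "lam > 0"
  shows "\<exists>\<eta>>0. \<exists>N>0. \<forall>th E. \<bar>E\<bar> \<le> lam \<longrightarrow>
    L * real N \<le> (\<Sum>n=1..N. 1 / (\<bar>E + lam * cos (2 * pi * (th + 2 * real n * alpha))\<bar> + \<eta>))"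
proof -
  define \<beta> where "\<beta> = 2 * alpha"
  have "\<beta> \<notin> \<rat>"
  proof
    assume "\<beta> \<in> \<rat>"
    then have "\<beta> / 2 \<in> \<rat>" by (intro Rats_divide) auto
    then show False using irr by (simp add: \<beta>_def)
  qed
  then have inf: "infinite (approx_set \<beta>)" using rational_iff_finite_approx_set by blast
  \<comment> \<open>A Lipschitz constant of y -> lam cos (2 pi y).\<close>
  define c where "c = 2 * pi * lam"
  have c: "c > 0" using lam by (simp add: c_def)
  obtain n0 where n0: "L * c \<le> (\<Sum>r<n0. 1 / (real r + 3))" using ex_harm_ge by blast
  obtain p q where pq: "(p, q) \<in> approx_set \<beta>" "q > int n0" using infinite_approx_set[OF inf] by blast
  then have q: "q > 0" and cop: "coprime p q" and ap: "\<bar>\<beta> - of_int p / of_int q\<bar> < 1 / (of_int q)\<^sup>2"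
    by (auto simp: approx_set_def)
  define N where "N = nat q"
  have N: "N > 0" "real N = of_int q" using q by (auto simp: N_def)
  \<comment> \<open>A cutoff matching one grid spacing 1/N, so that it costs no more than the other
    errors.\<close>
  define \<eta> where "\<eta> = c / real N"
  have \<eta>: "\<eta> > 0" using c N by (simp add: \<eta>_def)
  have "L * real N \<le> (\<Sum>n=1..N. 1 / (\<bar>E + lam * cos (2 * pi * (th + 2 * real n * alpha))\<bar> + \<eta>))"
    if E: "\<bar>E\<bar> \<le> lam" for th E
  proof -
    \<comment> \<open>A zero of y -> E + lam cos (2 pi y), available because |E| <= lam; distances
      to it modulo 1 control the denominators.\<close>
    define \<phi> where "\<phi> = arccos (- E / lam) / (2 * pi)"
    have "- E / lam \<le> 1" "- 1 \<le> - E / lam" using E lam by (auto simp: field_simps abs_le_iff)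
    then have E': "E = - lam * cos (2 * pi * \<phi>)"
      using lam by (simp add: \<phi>_def cos_arccos)
    have lip: "\<bar>E + lam * cos (2 * pi * y)\<bar> \<le> c * \<bar>y - \<phi> - of_int j\<bar>" for y :: real and j :: int
    proof -
      have "cos (2 * pi * y) = cos (2 * pi * (y - of_int j))"
        using cos_int_2pin[of j] sin_int_2pin[of j] by (simp add: right_diff_distrib cos_diff mult_ac)
      then have "E + lam * cos (2 * pi * y) = lam * (cos (2 * pi * (y - of_int j)) - cos (2 * pi * \<phi>))"
        unfolding E' by (simp add: right_diff_distrib)
      then have "\<bar>E + lam * cos (2 * pi * y)\<bar> = lam * \<bar>cos (2 * pi * (y - of_int j)) - cos (2 * pi * \<phi>)\<bar>"
        using lam by (simp add: abs_mult)
      also have "\<dots> \<le> lam * \<bar>2 * pi * (y - of_int j) - 2 * pi * \<phi>\<bar>"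
        using lam by (intro mult_left_mono abs_cos_diff_le) auto
      also have "\<dots> = c * \<bar>y - \<phi> - of_int j\<bar>"
      proof -
        have "2 * pi * (y - of_int j) - 2 * pi * \<phi> = 2 * pi * (y - \<phi> - of_int j)" by (simp add: algebra_simps)
        then show ?thesis by (simp add: c_def abs_mult)
      qed
      finally show ?thesis .
    qed
    \<comment> \<open>\<open>m\<close> and \<open>t\<close> are the integer and fractional parts of
      the starting offset in units of 1/N; the residue \<open>r n\<close> then locates the n-th
      point on that grid.\<close>
    define m where "m = \<lfloor>(th - \<phi>) * real N\<rfloor>"
    define t where "t = (th - \<phi>) * real N - of_int m"
    have t: "0 \<le> t" "t < 1" unfolding t_def m_def by linarith+
    define r where "r n = (m + int n * p) mod q" for n
    have each: "real N / c * (1 / (of_int (r n) + 3)) \<le> 1 / (\<bar>E + lam * cos (2 * pi * (th + 2 * real n * alpha))\<bar> + \<eta>)"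
      if n: "n \<in> {1..N}" for n
    proof -
      define j where "j = (m + int n * p) div q"
      have rj: "m + int n * p = q * j + r n" by (simp add: r_def j_def)
      have r0: "r n \<ge> 0" using q by (simp add: r_def)
      define e where "e = \<beta> - of_int p / of_int q"
      \<comment> \<open>The Dirichlet error 1/q^2 accumulates to at most 1/N over n <= N
        steps.\<close>
      have e: "\<bar>real n * e\<bar> \<le> 1 / real N"
      proof -
        have "\<bar>real n * e\<bar> \<le> real N * (1 / (real N)\<^sup>2)"
          unfolding abs_mult using n ap N by (intro mult_mono) (auto simp: e_def)
        also have "\<dots> = 1 / real N" using N by (simp add: power2_eq_square)
        finally show ?thesis .
      qed
      have "th + 2 * real n * alpha - \<phi> - of_int j = (of_int m + t) / real N + real n * of_int p / real N - of_int j + real n * e"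
        using N by (simp add: t_def e_def \<beta>_def field_simps)
      also have "(of_int m + t) / real N + real n * of_int p / real N - of_int j = (of_int (r n) + t) / real N"
      proof -
        have "of_int m + real n * of_int p = real N * of_int j + of_int (r n)"
          using arg_cong[OF rj, of "of_int :: int \<Rightarrow> real"] N by simp
        then have "of_int (r n) + t = of_int m + t + real n * of_int p - real N * of_int j" by simp
        then show ?thesis using N(1) by (simp add: diff_divide_distrib add_divide_distrib)
      qed
      finally have "\<bar>th + 2 * real n * alpha - \<phi> - of_int j\<bar> \<le> \<bar>(of_int (r n) + t) / real N\<bar> + \<bar>real n * e\<bar>"
        by (simp only: abs_triangle_ineq)
      also have "\<dots> \<le> (of_int (r n) + 1) / real N + 1 / real N"
        using e t r0 N by (intro add_mono) (auto simp: divide_right_mono)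
      finally have le0: "\<bar>E + lam * cos (2 * pi * (th + 2 * real n * alpha))\<bar> \<le> c * ((of_int (r n) + 1) / real N + 1 / real N)"
        by (intro order_trans[OF lip[of "th + 2 * real n * alpha" j]] mult_left_mono) (use c in auto)
      \<comment> \<open>The 3 collects the fractional part \<open>t\<close>, the Dirichlet error and
        \<eta>, at most one unit c/N each.\<close>
      then have le: "\<bar>E + lam * cos (2 * pi * (th + 2 * real n * alpha))\<bar> + \<eta> \<le> c * (of_int (r n) + 3) / real N"
      proof -
        have "c * ((of_int (r n) + 1) / real N + 1 / real N) + \<eta> = c * (of_int (r n) + 3) / real N"
          using N(1) by (simp add: \<eta>_def field_simps)
        with le0 show ?thesis by linarith
      qed
      have "1 / (c * (of_int (r n) + 3) / real N) \<le> 1 / (\<bar>E + lam * cos (2 * pi * (th + 2 * real n * alpha))\<bar> + \<eta>)"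
        by (rule divide_left_mono[OF le]) (use \<eta> c r0 N in \<open>auto intro!: mult_pos_pos divide_pos_pos add_nonneg_pos\<close>)
      then show ?thesis by (simp add: field_simps)
    qed
    have "L * c \<le> (\<Sum>k<N. 1 / (real k + 3))"
    proof -
      have "(\<Sum>k<n0. 1 / (real k + 3)) \<le> (\<Sum>k<N. 1 / (real k + 3))"
        using pq(2) by (intro sum_mono2) (auto simp: N_def)
      then show ?thesis using n0 by linarith
    qed
    then have "L * real N \<le> real N / c * (\<Sum>k<N. 1 / (real k + 3))"
      using c N by (simp add: field_simps)
    also have "(\<Sum>k<N. 1 / (real k + 3)) = (\<Sum>i\<in>{0..<q}. 1 / (of_int i + 3))"
      by (rule sum.reindex_bij_witness[where i = nat and j = int]) (use q in \<open>auto simp: N_def\<close>)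
    also have "\<dots> = (\<Sum>n=1..N. 1 / (of_int (r n) + 3))"
      unfolding N_def r_def by (rule sum.reindex_bij_betw[OF bij_betw_mult_mod[OF q cop], symmetric])
    also have "real N / c * \<dots> = (\<Sum>n=1..N. real N / c * (1 / (of_int (r n) + 3)))"
      by (rule sum_distrib_left)
    also have "\<dots> \<le> (\<Sum>n=1..N. 1 / (\<bar>E + lam * cos (2 * pi * (th + 2 * real n * alpha))\<bar> + \<eta>))"
      by (rule sum_mono[OF each])
    finally show ?thesis .
  qed
  then show ?thesis using \<eta> N(1) by blast
qed

section \<open>Absence of eigenvectors\<close>

text \<open>Series over the integers are integrals against counting measure, so the L2 inequalities
  above and dominated convergence apply to sequences.\<close>

abbreviation cZ :: "int measure" where "cZ \<equiv> count_space UNIV"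

lemma integrable_cZ_shift:
  fixes f :: "int \<Rightarrow> 'a :: {banach, second_countable_topology}"
  shows "integrable cZ (\<lambda>n. f (n + k)) \<longleftrightarrow> integrable cZ f"
proof -
  have "distr cZ cZ (\<lambda>n. n + k) = cZ"
    by (rule distr_bij_count_space) (auto intro: bij_betw_byWitness[where f' = "\<lambda>n. n - k"])
  then show ?thesis
    using integrable_distr_eq[of "\<lambda>n. n + k" cZ cZ f] by simp
qed

lemma integral_cZ_shift:
  fixes f :: "int \<Rightarrow> 'a :: {banach, second_countable_topology}"
  shows "(\<integral>n. f (n + k) \<partial>cZ) = (\<integral>n. f n \<partial>cZ)"
proof -
  have "distr cZ cZ (\<lambda>n. n + k) = cZ"
    by (rule distr_bij_count_space) (auto intro: bij_betw_byWitness[where f' = "\<lambda>n. n - k"])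
  then show ?thesis
    using integral_distr[of "\<lambda>n. n + k" cZ cZ f] by simp
qed

abbreviation sqZ :: "(int \<Rightarrow> complex) \<Rightarrow> bool" where "sqZ \<equiv> sqint cZ"

lemma sqZ_shift: "sqZ f \<Longrightarrow> sqZ (\<lambda>n. f (n + k))"
  unfolding sqint_def using integrable_cZ_shift[of "\<lambda>n. (cmod (f n))\<^sup>2" k] by simp

lemma sqZ_shift': "sqZ f \<Longrightarrow> sqZ (\<lambda>n. f (n - k))"
  using sqZ_shift[of f "-k"] by simp

lemma l2n_shift: "l2n cZ (\<lambda>n. f (n + k)) = l2n cZ f"
  unfolding l2n_def using integral_cZ_shift[of "\<lambda>n. (cmod (f n))\<^sup>2" k] by simp

lemma sqZ_unimod:
  assumes "\<And>n. cmod (d n) = 1" "sqZ f" shows "sqZ (\<lambda>n. d n * f n)"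
  using assms by (simp add: sqint_def norm_mult)

text \<open>On the side of Fourier series: \<open>corr f g k\<close> is the \<open>k\<close>-th Fourier coefficient of \<open>f cnj g\<close>, so
  \<open>corr_diff f g = 0\<close> below says that \<open>f cnj g\<close> is real, and \<open>Ct t\<close> with \<open>t = e\<^sup>i\<^sup>s\<close> is multiplication by
  \<open>cos (x + s)\<close> up to orientation. Injectivity of \<open>Ct t\<close> on null sequences (\<open>vanishing_alternating\<close>)
  replaces the non-integrability of \<open>1/cos\<close>.\<close>

definition corr :: "(int \<Rightarrow> complex) \<Rightarrow> (int \<Rightarrow> complex) \<Rightarrow> int \<Rightarrow> complex" where
  "corr f g k = (\<integral>n. f (n + k) * cnj (g n) \<partial>cZ)"

lemma corr_integrable: "sqZ f \<Longrightarrow> sqZ g \<Longrightarrow> integrable cZ (\<lambda>n. f (n + k) * cnj (g n))"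
  by (intro sqint_mult sqint_cnj sqZ_shift)

lemma corr_add_left: "sqZ f \<Longrightarrow> sqZ f' \<Longrightarrow> sqZ g \<Longrightarrow> corr (\<lambda>n. f n + f' n) g k = corr f g k + corr f' g k"
  unfolding corr_def using corr_integrable by (simp add: distrib_right)

lemma corr_add_right: "sqZ f \<Longrightarrow> sqZ g \<Longrightarrow> sqZ g' \<Longrightarrow> corr f (\<lambda>n. g n + g' n) k = corr f g k + corr f g' k"
  unfolding corr_def using corr_integrable by (simp add: distrib_left)

lemma corr_cmult_left: "corr (\<lambda>n. c * f n) g k = c * corr f g k"
  unfolding corr_def by (simp add: mult.assoc)

lemma corr_cmult_right: "corr f (\<lambda>n. c * g n) k = cnj c * corr f g k"
  unfolding corr_def by (simp add: mult.left_commute)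

lemma corr_shift_left: "corr (\<lambda>n. f (n + j)) g k = corr f g (k + j)"
  unfolding corr_def by (simp add: add.assoc)

lemma corr_shift_right: "corr f (\<lambda>n. g (n + j)) k = corr f g (k - j)"
  unfolding corr_def using integral_cZ_shift[of "\<lambda>n. f (n + (k - j)) * cnj (g n)" j] by (simp add: add.assoc)

text \<open>Convergence to 0 at both infinities, phrased without a filter so that finiteness
  arguments apply directly.\<close>

definition vanishing :: "(int \<Rightarrow> complex) \<Rightarrow> bool" where
  "vanishing s \<longleftrightarrow> (\<forall>e>0. finite {k. e \<le> cmod (s k)})"

lemma sqZ_vanishing:
  assumes "sqZ f" shows "vanishing f"
  unfolding vanishing_def
proof (intro allI impI)
  fix e :: real assume e: "e > 0"
  have i: "integrable cZ (\<lambda>n. (cmod (f n))\<^sup>2)" using assms by (simp add: sqint_def)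
  have "emeasure cZ {x \<in> space cZ. e\<^sup>2 \<le> (cmod (f x))\<^sup>2} \<le> (1/e\<^sup>2) * (\<integral>x. (cmod (f x))\<^sup>2 \<partial>cZ)"
    by (rule integral_Markov_inequality[OF i]) (use e in auto)
  also have "\<dots> < \<infinity>" by simp
  finally have "finite {x. e\<^sup>2 \<le> (cmod (f x))\<^sup>2}"
    by (simp add: emeasure_count_space split: if_splits)
  then show "finite {k. e \<le> cmod (f k)}"
    by (rule rev_finite_subset) (use e in \<open>auto intro: power_mono\<close>)
qed

lemma vanishing_diff: "vanishing s \<Longrightarrow> vanishing t \<Longrightarrow> vanishing (\<lambda>k. s k - t k)"
  unfolding vanishing_def
proof (intro allI impI)
  fix e :: real
  assume h: "\<forall>e>0. finite {k. e \<le> cmod (s k)}" "\<forall>e>0. finite {k. e \<le> cmod (t k)}" and e: "e > 0"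
  have "{k. e \<le> cmod (s k - t k)} \<subseteq> {k. e / 2 \<le> cmod (s k)} \<union> {k. e / 2 \<le> cmod (t k)}"
  proof
    fix k assume "k \<in> {k. e \<le> cmod (s k - t k)}"
    then show "k \<in> {k. e / 2 \<le> cmod (s k)} \<union> {k. e / 2 \<le> cmod (t k)}"
      using norm_triangle_ineq4[of "s k" "t k"] by auto
  qed
  then show "finite {k. e \<le> cmod (s k - t k)}"
    using h e by (meson finite_UnI finite_subset half_gt_zero)
qed

text \<open>Away from 0 the modulus is constant along steps of 2, so a nonzero value would recur
  infinitely often. Excluding k = 0 matches the invariance argument, which says nothing about the
  zeroth coefficient.\<close>

lemma vanishing_alternating:
  assumes "vanishing s" and eq: "\<And>k. k \<noteq> 0 \<Longrightarrow> cmod (s (k + 1)) = cmod (s (k - 1))"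
  shows "s k = 0"
proof (rule ccontr)
  assume nz: "s k \<noteq> 0"
  \<comment> \<open>Stepping away from 0 keeps the midpoints at which \<open>eq\<close> is used
    different from 0.\<close>
  define \<sigma> :: int where "\<sigma> = (if k \<ge> 0 then 2 else -2)"
  have "cmod (s (k + \<sigma> * int j)) = cmod (s k)" for j
  proof (induction j)
    case (Suc j)
    show ?case
    proof (cases "k \<ge> 0")
      case True
      then show ?thesis using eq[of "k + 2 * int j + 1"] Suc by (simp add: \<sigma>_def algebra_simps)
    next
      case False
      then show ?thesis using eq[of "k - 2 * int j - 1"] Suc by (simp add: \<sigma>_def algebra_simps)
    qed
  qed simp
  then have "range (\<lambda>j. k + \<sigma> * int j) \<subseteq> {i. cmod (s k) \<le> cmod (s i)}" by auto
  moreover have "finite {i. cmod (s k) \<le> cmod (s i)}" using assms(1) nz by (simp add: vanishing_def)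
  ultimately have "finite (range (\<lambda>j. k + \<sigma> * int j))" by (rule finite_subset)
  moreover have "inj (\<lambda>j::nat. k + \<sigma> * int j)" by (auto simp: inj_on_def \<sigma>_def split: if_splits)
  ultimately show False using finite_imageD infinite_UNIV_nat by blast
qed

text \<open>The Riemann-Lebesgue lemma for f cnj g: a finite window of \<open>g\<close> reduces the
  claim to finitely many shifts of \<open>f\<close>, and Cauchy-Schwarz controls the rest.\<close>

lemma corr_vanishing:
  assumes f: "sqZ f" and g: "sqZ g"
  shows "vanishing (corr f g)"
  unfolding vanishing_def
proof (intro allI impI)
  fix e :: real assume e: "e > 0"
  define gt where "gt N n = (if n \<in> {- int N..int N} then 0 else g n)" for N n
  have gi: "integrable cZ (\<lambda>n. (cmod (g n))\<^sup>2)" using g by (simp add: sqint_def)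
  have sgt: "sqZ (gt N)" for N by (rule sqint_bound(1)[OF g]) (auto simp: gt_def)
  have "(\<lambda>N. \<integral>n. (cmod (gt N n))\<^sup>2 \<partial>cZ) \<longlonglongrightarrow> (\<integral>n. 0 \<partial>cZ)"
  proof (rule integral_dominated_convergence[where w = "\<lambda>n. (cmod (g n))\<^sup>2"])
    show "AE n in cZ. (\<lambda>N. (cmod (gt N n))\<^sup>2) \<longlonglongrightarrow> 0"
    proof (rule AE_I2)
      fix n
      show "(\<lambda>N. (cmod (gt N n))\<^sup>2) \<longlonglongrightarrow> 0"
        by (intro tendsto_eventually eventually_sequentiallyI[of "nat \<bar>n\<bar>"]) (auto simp: gt_def)
    qed
  qed (use gi in \<open>auto simp: gt_def\<close>)
  then have "(\<lambda>N. l2n cZ (gt N)) \<longlonglongrightarrow> 0" unfolding l2n_def using tendsto_real_sqrt by fastforce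
  then have "(\<lambda>N. l2n cZ f * l2n cZ (gt N)) \<longlonglongrightarrow> 0" by (rule tendsto_mult_right_zero)
  then obtain N where N: "l2n cZ f * l2n cZ (gt N) < e / 2"
    using e order_tendstoD(2)[of _ 0 sequentially "e/2"] by (auto simp: eventually_sequentially)
  define F where "F = {- int N..int N}"
  have split: "corr f g k = (\<Sum>n\<in>F. f (n + k) * cnj (g n)) + (\<integral>n. f (n + k) * cnj (gt N n) \<partial>cZ)" for k
  proof -
    have "corr f g k = (\<integral>n. (if n \<in> F then f (n + k) * cnj (g n) else 0) + f (n + k) * cnj (gt N n) \<partial>cZ)"
      unfolding corr_def by (rule Bochner_Integration.integral_cong) (auto simp: gt_def F_def)
    also have "\<dots> = (\<integral>n. (if n \<in> F then f (n + k) * cnj (g n) else 0) \<partial>cZ) + (\<integral>n. f (n + k) * cnj (gt N n) \<partial>cZ)"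
    proof (rule Bochner_Integration.integral_add)
      show "integrable cZ (\<lambda>n. if n \<in> F then f (n + k) * cnj (g n) else 0)"
        by (rule Bochner_Integration.integrable_bound[OF corr_integrable[OF f g, of k]]) auto
      show "integrable cZ (\<lambda>n. f (n + k) * cnj (gt N n))" by (rule corr_integrable[OF f sgt])
    qed
    also have "(\<integral>n. (if n \<in> F then f (n + k) * cnj (g n) else 0) \<partial>cZ) = (\<Sum>n\<in>F. f (n + k) * cnj (g n))"
    proof -
      have "(\<integral>n. (if n \<in> F then f (n + k) * cnj (g n) else 0) \<partial>cZ) = (\<integral>n. indicator F n *\<^sub>R (f (n + k) * cnj (g n)) \<partial>cZ)"
        by (intro Bochner_Integration.integral_cong) (auto simp: indicator_def)
      also have "\<dots> = (\<Sum>n\<in>F. f (n + k) * cnj (g n))"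
        using integral_restrict_space[of F cZ "\<lambda>n. f (n + k) * cnj (g n)"]
        by (simp add: restrict_count_space lebesgue_integral_count_space_finite F_def)
      finally show ?thesis .
    qed
    finally show ?thesis .
  qed
  have tail: "cmod (\<integral>n. f (n + k) * cnj (gt N n) \<partial>cZ) < e / 2" for k
    using l2n_Cauchy_Schwarz[OF sqZ_shift[OF f, of k] sqint_cnj[OF sgt[of N]]] N
    by (simp add: l2n_shift)
  define G where "G = (\<Sum>n\<in>F. cmod (g n)) + 1"
  have G: "G > 0" by (simp add: G_def add_nonneg_pos sum_nonneg)
  define \<delta> where "\<delta> = e / (2 * G)"
  have \<delta>: "\<delta> > 0" using e G by (simp add: \<delta>_def)
  have "{k. e \<le> cmod (corr f g k)} \<subseteq> (\<Union>n\<in>F. (\<lambda>i. i - n) ` {i. \<delta> \<le> cmod (f i)})"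
  proof
    fix k assume "k \<in> {k. e \<le> cmod (corr f g k)}"
    then have "e / 2 < cmod (\<Sum>n\<in>F. f (n + k) * cnj (g n))"
      using split[of k] tail[of k] norm_triangle_ineq[of "\<Sum>n\<in>F. f (n + k) * cnj (g n)" "\<integral>n. f (n + k) * cnj (gt N n) \<partial>cZ"] by auto
    also have "\<dots> \<le> (\<Sum>n\<in>F. cmod (f (n + k)) * cmod (g n))"
      by (rule order_trans[OF norm_sum]) (simp add: norm_mult)
    finally have lt: "e / 2 < (\<Sum>n\<in>F. cmod (f (n + k)) * cmod (g n))" .
    have "\<exists>n\<in>F. \<delta> \<le> cmod (f (n + k))"
    proof (rule ccontr)
      assume "\<not> ?thesis"
      then have "(\<Sum>n\<in>F. cmod (f (n + k)) * cmod (g n)) \<le> (\<Sum>n\<in>F. \<delta> * cmod (g n))"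
        by (intro sum_mono mult_right_mono) (auto simp: not_le intro: less_imp_le)
      also have "\<dots> = \<delta> * (G - 1)" by (simp add: G_def sum_distrib_left)
      also have "\<dots> \<le> \<delta> * G" using \<delta> by simp
      also have "\<dots> = e / 2" using G by (simp add: \<delta>_def)
      finally show False using lt by simp
    qed
    then obtain n where "n \<in> F" "\<delta> \<le> cmod (f (n + k))" by blast
    then show "k \<in> (\<Union>n\<in>F. (\<lambda>i. i - n) ` {i. \<delta> \<le> cmod (f i)})"
      by (auto intro!: bexI[of _ n] image_eqI[of _ _ "n + k"])
  qed
  moreover have "finite (\<Union>n\<in>F. (\<lambda>i. i - n) ` {i. \<delta> \<le> cmod (f i)})"
    using sqZ_vanishing[OF f] \<delta> by (auto simp: vanishing_def F_def)
  ultimately show "finite {k. e \<le> cmod (corr f g k)}" by (rule finite_subset)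
qed

definition corr_diff :: "(int \<Rightarrow> complex) \<Rightarrow> (int \<Rightarrow> complex) \<Rightarrow> int \<Rightarrow> complex" where
  "corr_diff f g k = corr f g k - corr g f k"

definition Ct :: "complex \<Rightarrow> (int \<Rightarrow> complex) \<Rightarrow> int \<Rightarrow> complex" where
  "Ct t f n = (cnj t * f (n + 1) + t * f (n - 1)) / 2"

lemma sqZ_Ct: "sqZ f \<Longrightarrow> sqZ (Ct t f)"
  unfolding Ct_def[abs_def] divide_inverse mult.commute[of _ "inverse 2"]
  by (intro sqint_cmult sqint_add sqZ_shift sqZ_shift')

lemma Ct_add: "Ct t (\<lambda>n. f n + g n) n = Ct t f n + Ct t g n"
  by (simp add: Ct_def algebra_simps add_divide_distrib)

lemma corr_Ct_left:
  assumes "sqZ f" "sqZ g" shows "corr (Ct t f) g k = Ct t (corr f g) k"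
proof -
  have "corr (Ct t f) g k = corr (\<lambda>n. (cnj t / 2) * f (n + 1) + (t / 2) * f (n + (-1))) g k"
    by (simp add: Ct_def[abs_def] add_divide_distrib)
  also have "\<dots> = (cnj t / 2) * corr f g (k + 1) + (t / 2) * corr f g (k + (-1))"
    by (simp only: corr_add_left[OF sqint_cmult[OF sqZ_shift[OF assms(1)]] sqint_cmult[OF sqZ_shift[OF assms(1)]] assms(2)]
      corr_cmult_left corr_shift_left)
  finally show ?thesis by (simp add: Ct_def add_divide_distrib)
qed

lemma corr_Ct_right:
  assumes "sqZ f" "sqZ g" shows "corr f (Ct t g) k = Ct t (corr f g) k"
proof -
  have "corr f (Ct t g) k = corr f (\<lambda>n. (cnj t / 2) * g (n + 1) + (t / 2) * g (n + (-1))) k"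
    by (simp add: Ct_def[abs_def] add_divide_distrib)
  also have "\<dots> = cnj (cnj t / 2) * corr f g (k - 1) + cnj (t / 2) * corr f g (k - (-1))"
    by (simp only: corr_add_right[OF assms(1) sqint_cmult[OF sqZ_shift[OF assms(2)]] sqint_cmult[OF sqZ_shift[OF assms(2)]]]
      corr_cmult_right corr_shift_right)
  finally show ?thesis by (simp add: Ct_def add_divide_distrib)
qed

lemma corr_diff_self [simp]: "corr_diff f f k = 0"
  by (simp add: corr_diff_def)

text \<open>Multiplication by a real function, here a cosine, pulls out of the imaginary part of f
  cnj g.\<close>

lemma corr_diff_Ct_left: "sqZ f \<Longrightarrow> sqZ g \<Longrightarrow> corr_diff (Ct t f) g k = Ct t (corr_diff f g) k"
  by (simp add: corr_diff_def[abs_def] corr_Ct_left corr_Ct_right Ct_def algebra_simps diff_divide_distrib add_divide_distrib)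

lemma corr_diff_add_left: "sqZ f \<Longrightarrow> sqZ f' \<Longrightarrow> sqZ g \<Longrightarrow> corr_diff (\<lambda>n. f n + f' n) g k = corr_diff f g k + corr_diff f' g k"
  by (simp add: corr_diff_def corr_add_left corr_add_right)

lemma corr_diff_swap: "corr_diff g f k = - corr_diff f g k"
  by (simp add: corr_diff_def)

lemma corr_diff_cmult_left: "corr_diff (\<lambda>n. of_real c * f n) g k = of_real c * corr_diff f g k"
  by (simp add: corr_diff_def corr_cmult_left corr_cmult_right algebra_simps)

lemma corr_diff_vanishing: "sqZ f \<Longrightarrow> sqZ g \<Longrightarrow> vanishing (corr_diff f g)"
  unfolding corr_diff_def[abs_def] by (intro vanishing_diff corr_vanishing)

section \<open>The eigenvalue equation along the orbit of translations\<close>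

lemma cis_2pi_eq_1: "cis (2 * pi * x) = 1 \<longleftrightarrow> x \<in> \<int>"
proof
  assume "cis (2 * pi * x) = 1"
  then have "cos (2 * pi * x) = 1" by (simp add: complex_eq_iff)
  then obtain n :: int where "2 * pi * x = of_int n * 2 * pi" by (auto simp: cos_one_2pi_int)
  then show "x \<in> \<int>" by simp
next
  assume "x \<in> \<int>"
  then obtain n where "x = of_int n" by (auto elim: Ints_cases)
  then show "cis (2 * pi * x) = 1" using cos_int_2pin[of n] sin_int_2pin[of n] by (simp add: complex_eq_iff mult_ac)
qed

text \<open>The geometric sums stay bounded by 2 / |1 - z|.\<close>

lemma unimod_mean_tendsto_0:
  fixes z :: complex
  assumes "cmod z = 1" "z \<noteq> 1"
  shows "(\<lambda>M. (\<Sum>m<M. z ^ m) / of_nat M) \<longlonglongrightarrow> 0"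
proof (rule Lim_null_comparison)
  show "(\<lambda>M. (2 / cmod (1 - z)) * inverse (real M)) \<longlonglongrightarrow> 0"
    by (intro tendsto_mult_right_zero lim_inverse_n)
  show "\<forall>\<^sub>F M in sequentially. norm ((\<Sum>m<M. z ^ m) / of_nat M) \<le> (2 / cmod (1 - z)) * inverse (real M)"
  proof (intro always_eventually allI)
    fix M
    have "(\<Sum>m<M. z ^ m) = (1 - z ^ M) / (1 - z)" using assms(2) by (simp add: sum_gp_strict)
    moreover have "cmod (1 - z ^ M) \<le> 2"
      using norm_triangle_ineq4[of 1 "z ^ M"] assms(1) by (simp add: norm_power)
    ultimately have "norm ((\<Sum>m<M. z ^ m) / of_nat M) \<le> 2 / cmod (1 - z) / real M"
      by (simp add: norm_divide divide_right_mono del: divide_divide_eq_left)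
    then show "norm ((\<Sum>m<M. z ^ m) / of_nat M) \<le> (2 / cmod (1 - z)) * inverse (real M)"
      by (simp add: divide_inverse)
  qed
qed

text \<open>\<open>R1\<close> and \<open>R2\<close> are the sum and the difference of the two
  components of the eigenvalue equation, with p = a + b and q = a - b. Then p + q = 2a, so
  \<open>Ct 1\<close> is exactly the hopping term, and the potential becomes a unimodular phase
  exchanging p and q.\<close>

locale eigen_relation =
  fixes alpha lam omega E :: real and p q :: "int \<Rightarrow> complex"
  assumes irr: "alpha \<notin> \<rat>" and lam: "lam > 0"
    and nonres: "\<And>k::int. 2 * alpha * real_of_int k + 2 * omega \<notin> \<int>"
    and p: "sqZ p" and q: "sqZ q"
    and R1: "\<And>n. Ct 1 (\<lambda>n. p n + q n) n + of_real lam * (cnj (cis (2 * pi * (omega + 2 * real_of_int n * alpha))) * q n) = of_real E * p n"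
    and R2: "\<And>n. Ct 1 (\<lambda>n. p n + q n) n + of_real lam * (cis (2 * pi * (omega + 2 * real_of_int n * alpha)) * p n) = of_real E * q n"
begin

definition d :: "int \<Rightarrow> complex" where "d n = cis (2 * pi * (omega + 2 * real_of_int n * alpha))"
definition \<tau> :: complex where "\<tau> = cis (2 * pi * (2 * alpha))"
text \<open>On the Fourier side, multiplication by \<open>d n ^ m\<close> translates by 2m alpha and
  multiplies by a constant phase, so \<open>P m\<close> and \<open>Q m\<close> are the m-th points
  of the orbit of (p, q).\<close>

definition P :: "nat \<Rightarrow> int \<Rightarrow> complex" where "P m n = d n ^ m * p n"
definition Q :: "nat \<Rightarrow> int \<Rightarrow> complex" where "Q m n = d n ^ m * q n"

lemma d_cnj: "d n * cnj (d n) = 1" "cnj (d n) * d n = 1" and d_norm [simp]: "cmod (d n) = 1"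
  by (auto simp: d_def cis_cnj cis_mult)

lemma d_Suc: "d (n + 1) = d n * \<tau>" "d (n - 1) = d n * cnj \<tau>" "\<tau> * cnj \<tau> = 1" "cnj \<tau> * \<tau> = 1"
  by (auto simp: d_def \<tau>_def cis_cnj cis_mult algebra_simps)

lemma sqP: "sqZ (P m)" and sqQ: "sqZ (Q m)"
  unfolding P_def[abs_def] Q_def[abs_def] by (auto intro!: sqZ_unimod p q simp: norm_power)

lemma P0: "P 0 = p" "Q 0 = q" by (auto simp: P_def Q_def)

text \<open>Translation turns the cosine into a shifted cosine, recorded by
  \<open>\<tau> ^ m\<close>: the factors \<tau> undo the change of \<open>d\<close> between
  neighbouring sites.\<close>

lemma Ct_P: "Ct (\<tau> ^ m) (\<lambda>n. P m n + Q m n) n = d n ^ m * Ct 1 (\<lambda>n. p n + q n) n"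
proof -
  have "cnj \<tau> * d (n + 1) = d n * (cnj \<tau> * \<tau>)" "\<tau> * d (n - 1) = d n * (cnj \<tau> * \<tau>)"
    by (simp_all add: d_Suc(1,2) mult_ac)
  then have "cnj (\<tau> ^ m) * d (n + 1) ^ m = d n ^ m" "\<tau> ^ m * d (n - 1) ^ m = d n ^ m"
    by (simp_all add: d_Suc(4) flip: power_mult_distrib)
  then have e: "cnj (\<tau> ^ m) * (d (n + 1) ^ m * u) = d n ^ m * u" "\<tau> ^ m * (d (n - 1) ^ m * u) = d n ^ m * u" for u
    by (metis mult.assoc)+
  have "Ct (\<tau> ^ m) (\<lambda>n. P m n + Q m n) n = (cnj (\<tau> ^ m) * (d (n + 1) ^ m * (p (n + 1) + q (n + 1))) + \<tau> ^ m * (d (n - 1) ^ m * (p (n - 1) + q (n - 1)))) / 2"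
    by (simp only: Ct_def P_def Q_def distrib_left)
  also have "\<dots> = d n ^ m * Ct 1 (\<lambda>n. p n + q n) n"
    unfolding e by (simp add: Ct_def algebra_simps)
  finally show ?thesis .
qed

text \<open>\<open>R1\<close> multiplied by \<open>d n ^ Suc m\<close>. It expresses
  \<open>Q m\<close> through the orbit point Suc m, while \<open>PQ2\<close> expresses
  \<open>P (Suc m)\<close> through the orbit point m.\<close>

lemma PQ1: "of_real lam * Q m n = of_real E * P (Suc m) n + of_real (-1) * (Ct (\<tau> ^ Suc m) (P (Suc m)) n + Ct (\<tau> ^ Suc m) (Q (Suc m)) n)"
proof -
  have "d n ^ Suc m * (Ct 1 (\<lambda>n. p n + q n) n + of_real lam * (cnj (d n) * q n)) = d n ^ Suc m * (of_real E * p n)"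
    using R1[of n] by (simp add: d_def)
  moreover have "d n ^ Suc m * (of_real lam * (cnj (d n) * q n)) = of_real lam * Q m n"
    using d_cnj[of n] by (simp add: Q_def mult.left_commute mult.assoc[symmetric])
  moreover have "d n ^ Suc m * (of_real E * p n) = of_real E * P (Suc m) n" by (simp add: P_def)
  ultimately have "Ct (\<tau> ^ Suc m) (\<lambda>n. P (Suc m) n + Q (Suc m) n) n + of_real lam * Q m n = of_real E * P (Suc m) n"
    unfolding Ct_P by (simp only: distrib_left)
  then show ?thesis by (simp add: Ct_add algebra_simps del: power_Suc)
qed

lemma PQ2: "of_real lam * P (Suc m) n = of_real E * Q m n + of_real (-1) * (Ct (\<tau> ^ m) (P m) n + Ct (\<tau> ^ m) (Q m) n)"
proof -
  have "d n ^ m * (Ct 1 (\<lambda>n. p n + q n) n + of_real lam * (d n * p n)) = d n ^ m * (of_real E * q n)"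
    using R2[of n] by (simp add: d_def)
  moreover have "d n ^ m * (of_real lam * (d n * p n)) = of_real lam * P (Suc m) n"
    by (simp add: P_def mult_ac)
  moreover have "d n ^ m * (of_real E * q n) = of_real E * Q m n" by (simp add: Q_def)
  ultimately have "Ct (\<tau> ^ m) (\<lambda>n. P m n + Q m n) n + of_real lam * P (Suc m) n = of_real E * Q m n"
    unfolding Ct_P by (simp only: distrib_left)
  then show ?thesis by (simp add: Ct_add algebra_simps)
qed

lemma corr_diff_PQ1:
  assumes g: "sqZ g"
  shows "of_real lam * corr_diff (Q m) g k = of_real E * corr_diff (P (Suc m)) g k - (Ct (\<tau> ^ Suc m) (corr_diff (P (Suc m)) g) k + Ct (\<tau> ^ Suc m) (corr_diff (Q (Suc m)) g) k)"
proof -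
  have "of_real lam * corr_diff (Q m) g k = corr_diff (\<lambda>n. of_real lam * Q m n) g k" by (simp add: corr_diff_cmult_left)
  also have "\<dots> = of_real E * corr_diff (P (Suc m)) g k + of_real (-1) * (corr_diff (Ct (\<tau> ^ Suc m) (P (Suc m))) g k + corr_diff (Ct (\<tau> ^ Suc m) (Q (Suc m))) g k)"
    unfolding PQ1
    by (simp only: corr_diff_add_left corr_diff_cmult_left sqint_add sqint_cmult sqZ_Ct sqP sqQ g)
  finally show ?thesis by (simp add: corr_diff_Ct_left sqP sqQ g del: power_Suc)
qed

lemma corr_diff_PQ2:
  assumes g: "sqZ g"
  shows "of_real lam * corr_diff (P (Suc m)) g k = of_real E * corr_diff (Q m) g k - (Ct (\<tau> ^ m) (corr_diff (P m) g) k + Ct (\<tau> ^ m) (corr_diff (Q m) g) k)"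
proof -
  have "of_real lam * corr_diff (P (Suc m)) g k = corr_diff (\<lambda>n. of_real lam * P (Suc m) n) g k" by (simp add: corr_diff_cmult_left)
  also have "\<dots> = of_real E * corr_diff (Q m) g k + of_real (-1) * (corr_diff (Ct (\<tau> ^ m) (P m)) g k + corr_diff (Ct (\<tau> ^ m) (Q m)) g k)"
    unfolding PQ2
    by (simp only: corr_diff_add_left corr_diff_cmult_left sqint_add sqint_cmult sqZ_Ct sqP sqQ g)
  finally show ?thesis by (simp add: corr_diff_Ct_left sqP sqQ g)
qed

text \<open>Translating both functions translates f cnj g, which changes its k-th Fourier
  coefficient by a phase only.\<close>

lemma corr_d: "corr (\<lambda>n. d n * f n) (\<lambda>n. d n * g n) k = cis (2 * pi * (2 * real_of_int k * alpha)) * corr f g k"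
proof -
  have "d (n + k) * cnj (d n) = cis (2 * pi * (2 * real_of_int k * alpha))" for n
    by (simp add: d_def cis_cnj cis_mult algebra_simps)
  moreover have "d (n + k) * f (n + k) * cnj (d n * g n) = (d (n + k) * cnj (d n)) * (f (n + k) * cnj (g n))" for n
    by (simp add: mult_ac)
  ultimately show ?thesis unfolding corr_def by (simp only: integral_mult_right_zero)
qed

lemma irr_Ints: "k \<noteq> 0 \<Longrightarrow> 2 * real_of_int k * alpha \<notin> \<int>"
proof
  assume k: "k \<noteq> 0" and "2 * real_of_int k * alpha \<in> \<int>"
  then obtain j where "2 * real_of_int k * alpha = of_int j" by (auto elim: Ints_cases)
  then have "alpha = of_int j / of_int (2 * k)" using k by (simp add: field_simps)
  then show False using irr by (metis Rats_divide Rats_of_int)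
qed

text \<open>The invariance of \<open>C Im (p cnj q)\<close>: its \<open>k\<close>-th coefficient is multiplied by \<open>e\<^sup>4\<^sup>\<pi>\<^sup>i\<^sup>k\<^sup>\<alpha>\<close>, which is not \<open>1\<close> for \<open>k \<noteq> 0\<close>.\<close>

lemma corr_diff_QP_0: "corr_diff q p k = 0"
proof (rule vanishing_alternating[OF corr_diff_vanishing[OF q p]])
  fix k :: int assume k: "k \<noteq> 0"
  \<comment> \<open>Pairing with \<open>P 1\<close>, and below with \<open>Q 0\<close>, kills the
    self-terms; \<open>1\<close> and \<open>2\<close> then compute the same quantity at two
    consecutive orbit points.\<close>
  have 1: "of_real lam * corr_diff (Q 0) (P 1) k = - Ct (\<tau> ^ 1) (corr_diff (Q 1) (P 1)) k"
    using corr_diff_PQ1[OF sqP[of 1], of 0 k] by (simp add: Ct_def)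
  have "of_real lam * corr_diff (P 1) (Q 0) k = - Ct 1 (corr_diff (P 0) (Q 0)) k"
    using corr_diff_PQ2[OF sqQ[of 0], of 0 k] by (simp add: Ct_def)
  then have 2: "of_real lam * corr_diff (Q 0) (P 1) k = - Ct 1 (corr_diff (Q 0) (P 0)) k"
    by (simp add: corr_diff_swap[of "Q 0"] Ct_def field_simps)
  have 3: "corr_diff (Q 1) (P 1) j = cis (2 * pi * (2 * real_of_int j * alpha)) * corr_diff q p j" for j
    using corr_d[of q p j] corr_d[of p q j] by (simp add: corr_diff_def P_def[abs_def] Q_def[abs_def] right_diff_distrib)
  define w where "w = cis (2 * pi * (2 * real_of_int k * alpha))"
  have "cis (2 * pi * (2 * real_of_int (k + 1) * alpha)) = w * \<tau>" "cis (2 * pi * (2 * real_of_int (k - 1) * alpha)) = w * cnj \<tau>"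
    by (simp_all add: w_def \<tau>_def cis_mult cis_cnj algebra_simps)
  then have "Ct (\<tau> ^ 1) (corr_diff (Q 1) (P 1)) k = (cnj \<tau> * \<tau> * (w * corr_diff q p (k + 1)) + \<tau> * cnj \<tau> * (w * corr_diff q p (k - 1))) / 2"
    unfolding Ct_def 3 by (simp add: mult_ac)
  also have "\<dots> = w * Ct 1 (corr_diff q p) k"
    by (simp add: d_Suc Ct_def algebra_simps)
  finally have "w * Ct 1 (corr_diff q p) k = Ct 1 (corr_diff q p) k" using 1 2 by (simp add: P0)
  moreover have "w \<noteq> 1" unfolding w_def cis_2pi_eq_1 using irr_Ints[OF k] .
  ultimately have "Ct 1 (corr_diff q p) k = 0" by simp
  then have "corr_diff q p (k + 1) = - corr_diff q p (k - 1)" by (simp add: Ct_def add_eq_0_iff2)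
  then show "cmod (corr_diff q p (k + 1)) = cmod (corr_diff q p (k - 1))" by simp
qed

text \<open>\<open>PQ2\<close> settles \<open>P (Suc m)\<close> at once. For
  \<open>Q (Suc m)\<close>, \<open>PQ1\<close> only shows that a cosine times the quantity is 0, and
  injectivity of that multiplication on null sequences finishes.\<close>

lemma corr_diff_P_zero: "corr_diff (P m) p = (\<lambda>k. 0) \<and> corr_diff (Q m) p = (\<lambda>k. 0)"
proof (induction m)
  case 0
  show ?case using corr_diff_QP_0 by (auto simp: P0)
next
  case (Suc m)
  have "of_real lam * corr_diff (P (Suc m)) p k = 0" for k
    using corr_diff_PQ2[OF p, of m k] Suc by (simp add: Ct_def)
  then have x: "corr_diff (P (Suc m)) p = (\<lambda>k. 0)" using lam by auto
  have "Ct (\<tau> ^ Suc m) (corr_diff (Q (Suc m)) p) k = 0" for k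
    using corr_diff_PQ1[OF p, of m k] Suc x by (simp add: Ct_def)
  then have "cnj (\<tau> ^ Suc m) * corr_diff (Q (Suc m)) p (k + 1) = - (\<tau> ^ Suc m * corr_diff (Q (Suc m)) p (k - 1))" for k
    by (simp add: Ct_def add_eq_0_iff2 del: power_Suc)
  then have "cmod (cnj (\<tau> ^ Suc m) * corr_diff (Q (Suc m)) p (k + 1)) = cmod (\<tau> ^ Suc m * corr_diff (Q (Suc m)) p (k - 1))" for k
    by (simp del: power_Suc)
  moreover have "cmod \<tau> = 1" by (simp add: \<tau>_def)
  ultimately have "cmod (corr_diff (Q (Suc m)) p (k + 1)) = cmod (corr_diff (Q (Suc m)) p (k - 1))" for k
    by (simp add: norm_mult norm_power)
  then have "corr_diff (Q (Suc m)) p k = 0" for k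
    by (rule vanishing_alternating[OF corr_diff_vanishing[OF sqQ p]])
  with x show ?case by auto
qed

text \<open>Averaging over \<open>m\<close> against \<open>e\<^sup>-\<^sup>i\<^sup>m\<^sup>\<theta>\<close> with \<open>\<theta> = 2\<pi>(\<omega> + 2n\<^sub>0\<alpha>)\<close> isolates the term \<open>n\<^sub>0\<close>.\<close>

lemma p_zero: "p n0 = 0"
proof -
  have pi: "integrable cZ (\<lambda>n. (cmod (p n))\<^sup>2)" using p by (simp add: sqint_def)
  define w where "w n = complex_of_real ((cmod (p n))\<^sup>2)" for n
  have wi: "integrable cZ w" unfolding w_def complex_of_real_integrable_eq by (rule pi)
  have pw: "p n * cnj (p n) = w n" for n unfolding w_def by (rule complex_norm_square[symmetric])
  \<comment> \<open>This is the zeroth coefficient: the summand is |p n|^2 times 2i sin of m times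
    the phase at n.\<close>
  have moment: "(\<integral>n. w n * (d n ^ m - cnj (d n) ^ m) \<partial>cZ) = 0" for m
  proof -
    have "integrable cZ (\<lambda>n. w n * d n ^ m)" "integrable cZ (\<lambda>n. w n * cnj (d n) ^ m)"
      by (rule Bochner_Integration.integrable_bound[OF wi]; simp add: norm_mult norm_power)+
    then have "(\<integral>n. w n * (d n ^ m - cnj (d n) ^ m) \<partial>cZ) = (\<integral>n. w n * d n ^ m \<partial>cZ) - (\<integral>n. w n * cnj (d n) ^ m \<partial>cZ)"
      by (simp add: right_diff_distrib)
    also have "\<dots> = corr_diff (P m) p 0"
      unfolding corr_diff_def corr_def P_def pw[symmetric] by (simp add: mult_ac)
    finally show ?thesis using corr_diff_P_zero[of m] by simp
  qed
  define B where "B M n = (\<Sum>m<M. (d n ^ m - cnj (d n) ^ m) * cnj (d n0) ^ m) / of_nat M" for M n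
  have B1: "B M n = (\<Sum>m<M. (d n * cnj (d n0)) ^ m) / of_nat M - (\<Sum>m<M. (cnj (d n) * cnj (d n0)) ^ m) / of_nat M" for M n
    by (simp add: B_def left_diff_distrib sum_subtractf diff_divide_distrib power_mult_distrib)
  have Bz: "(\<integral>n. w n * B M n \<partial>cZ) = 0" for M
  proof -
    have i: "integrable cZ (\<lambda>n. w n * (d n ^ m - cnj (d n) ^ m))" for m
    proof (rule Bochner_Integration.integrable_bound)
      show "integrable cZ (\<lambda>n. w n * 2)" using wi by simp
      show "AE n in cZ. norm (w n * (d n ^ m - cnj (d n) ^ m)) \<le> norm (w n * 2)"
      proof (rule AE_I2)
        fix n
        have "cmod (d n ^ m - cnj (d n) ^ m) \<le> 2"
          using norm_triangle_ineq4[of "d n ^ m" "cnj (d n) ^ m"] by (simp add: norm_power)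
        then show "norm (w n * (d n ^ m - cnj (d n) ^ m)) \<le> norm (w n * 2)"
          by (simp add: norm_mult mult_left_mono)
      qed
    qed simp
    have "(\<integral>n. w n * B M n \<partial>cZ) = (\<integral>n. (\<Sum>m<M. (cnj (d n0) ^ m / of_nat M) * (w n * (d n ^ m - cnj (d n) ^ m))) \<partial>cZ)"
      by (simp add: B_def sum_distrib_left sum_divide_distrib mult_ac)
    also have "\<dots> = (\<Sum>m<M. (cnj (d n0) ^ m / of_nat M) * (\<integral>n. w n * (d n ^ m - cnj (d n) ^ m) \<partial>cZ))"
      using i by simp
    finally show ?thesis by (simp add: moment)
  qed
  have "(\<lambda>M. \<integral>n. w n * B M n \<partial>cZ) \<longlonglongrightarrow> (\<integral>n. w n * (if n = n0 then 1 else 0) \<partial>cZ)"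
  proof (rule integral_dominated_convergence[where w = "\<lambda>n. 2 * (cmod (p n))\<^sup>2"])
    show "AE n in cZ. (\<lambda>M. w n * B M n) \<longlonglongrightarrow> w n * (if n = n0 then 1 else 0)"
    proof (intro AE_I2 tendsto_mult_left)
      fix n
      \<comment> \<open>The phase hypothesis acts here: \<open>cnj (d n)\<close> never equals
        \<open>d n0\<close>, not even at n = n0, so the second mean dies everywhere while the first
        survives only at n0.\<close>
      have "cnj (d n) * cnj (d n0) = cis (2 * pi * (- (2 * alpha * real_of_int (n + n0) + 2 * omega)))"
        by (simp add: d_def cis_cnj cis_mult algebra_simps)
      then have "cnj (d n) * cnj (d n0) \<noteq> 1"
        by (simp only: cis_2pi_eq_1 minus_in_Ints_iff nonres not_False_eq_True)
      then have l2: "(\<lambda>M. (\<Sum>m<M. (cnj (d n) * cnj (d n0)) ^ m) / of_nat M) \<longlonglongrightarrow> 0"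
        by (intro unimod_mean_tendsto_0) (auto simp: norm_mult)
      have l1: "(\<lambda>M. (\<Sum>m<M. (d n * cnj (d n0)) ^ m) / of_nat M) \<longlonglongrightarrow> (if n = n0 then 1 else 0)"
      proof (cases "n = n0")
        case True
        then have "\<forall>\<^sub>F M in sequentially. (\<Sum>m<M. (d n * cnj (d n0)) ^ m) / of_nat M = 1"
          by (intro eventually_sequentiallyI[of 1]) (simp add: d_cnj)
        then show ?thesis using True by (simp add: tendsto_eventually)
      next
        case False
        have "d n * cnj (d n0) = cis (2 * pi * (2 * real_of_int (n - n0) * alpha))"
          by (simp add: d_def cis_cnj cis_mult algebra_simps)
        then have "d n * cnj (d n0) \<noteq> 1" using irr_Ints[of "n - n0"] False by (simp only: cis_2pi_eq_1) simp
        then show ?thesis using False by (simp add: unimod_mean_tendsto_0 norm_mult)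
      qed
      show "(\<lambda>M. B M n) \<longlonglongrightarrow> (if n = n0 then 1 else 0)"
        unfolding B1 using tendsto_diff[OF l1 l2] by simp
    qed
    show "AE n in cZ. norm (w n * B M n) \<le> 2 * (cmod (p n))\<^sup>2" for M
    proof (rule AE_I2)
      fix n
      have "cmod (\<Sum>m<M. (d n ^ m - cnj (d n) ^ m) * cnj (d n0) ^ m) \<le> (\<Sum>m<M. 2)"
      proof (rule sum_norm_le)
        fix m
        show "cmod ((d n ^ m - cnj (d n) ^ m) * cnj (d n0) ^ m) \<le> 2"
          using norm_triangle_ineq4[of "d n ^ m" "cnj (d n) ^ m"] by (simp add: norm_power norm_mult)
      qed
      then have "cmod (B M n) \<le> 2"
        by (cases "M = 0") (auto simp: B_def norm_divide divide_le_eq)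
      then show "norm (w n * B M n) \<le> 2 * (cmod (p n))\<^sup>2"
        unfolding w_def norm_mult norm_of_real by (simp add: mult.commute mult_right_mono)
    qed
  qed (use pi in auto)
  then have "(\<integral>n. w n * (if n = n0 then 1 else 0) \<partial>cZ) = 0"
    unfolding Bz using LIMSEQ_unique tendsto_const by blast
  moreover have "(\<integral>n. w n * (if n = n0 then 1 else 0) \<partial>cZ) = w n0"
  proof -
    have "(\<integral>n. w n * (if n = n0 then 1 else 0) \<partial>cZ) = (\<integral>n. indicator {n0} n *\<^sub>R w n \<partial>cZ)"
      by (intro Bochner_Integration.integral_cong) (auto simp: indicator_def)
    also have "\<dots> = w n0"
      using integral_restrict_space[of "{n0}" cZ w]
      by (simp add: restrict_count_space lebesgue_integral_count_space_finite)
    finally show ?thesis .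
  qed
  ultimately show ?thesis by (simp add: w_def)
qed

text \<open>With p = 0 the two relations combine to (lam cnj d + E) q = 0. Its imaginary part would
  make the sine of the phase at n vanish, which the phase hypothesis at index 2n excludes.\<close>

lemma q_zero: "q n = 0"
proof (rule ccontr)
  assume nz: "q n \<noteq> 0"
  have "(\<lambda>n. p n + q n) = q" using p_zero by simp
  then have "Ct 1 q n + of_real lam * (cnj (d n) * q n) = 0" "Ct 1 q n = of_real E * q n"
    using R1[of n] R2[of n] p_zero[of n] by (simp_all add: d_def)
  then have "(of_real lam * cnj (d n) + of_real E) * q n = 0" by (simp add: algebra_simps)
  then have "Im (of_real lam * cnj (d n) + of_real E) = 0" using nz by simp
  then have s: "sin (2 * pi * (omega + 2 * real_of_int n * alpha)) = 0" using lam by (simp add: d_def)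
  then obtain j :: int where "2 * pi * (omega + 2 * real_of_int n * alpha) = of_int j * pi"
    by (auto simp: sin_zero_iff_int2)
  then have "pi * (2 * alpha * real_of_int (2 * n) + 2 * omega) = pi * of_int j" by (simp add: algebra_simps)
  then have "2 * alpha * real_of_int (2 * n) + 2 * omega = of_int j" by simp
  then show False using nonres[of "2 * n"] by (metis Ints_of_int)
qed

end

theorem no_eigenvector:
  assumes irr: "alpha \<notin> \<rat>" and lam: "lam > 0"
    and nonres: "\<forall>k::int. 2 * alpha * real_of_int k + 2 * omega \<notin> \<int>"
    and sq: "sqZ (\<lambda>n. fst (u n))" "sqZ (\<lambda>n. snd (u n))"
    and eig: "\<And>n. S_op lam alpha omega u n = (of_real E * fst (u n), of_real E * snd (u n))"
  shows "u n = (0, 0)"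
proof -
  define p where "p n = fst (u n) + snd (u n)" for n
  define q where "q n = fst (u n) - snd (u n)" for n
  interpret eigen_relation alpha lam omega E p q
  proof
    fix n
    define th where "th = 2 * pi * (omega + 2 * real_of_int n * alpha)"
    define a b where "a = fst (u n)" and "b = snd (u n)"
    have e1: "fst (u (n + 1)) + fst (u (n - 1)) + of_real lam * (of_real (cos th) * a + \<i> * of_real (sin th) * b) = of_real E * a"
      and e2: "of_real lam * (- \<i> * of_real (sin th) * a - of_real (cos th) * b) = of_real E * b"
      using eig[of n] by (simp_all add: S_op_def Let_def th_def a_def b_def)
    have C: "Ct 1 (\<lambda>n. p n + q n) n = fst (u (n + 1)) + fst (u (n - 1))"
      by (simp add: Ct_def p_def q_def)
    have cis: "cis th = of_real (cos th) + \<i> * of_real (sin th)" "cnj (cis th) = of_real (cos th) - \<i> * of_real (sin th)"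
      by (simp_all add: complex_eq_iff)
    have pq: "p n = a + b" "q n = a - b" by (simp_all add: p_def q_def a_def b_def)
    show "Ct 1 (\<lambda>n. p n + q n) n + of_real lam * (cnj (cis (2 * pi * (omega + 2 * real_of_int n * alpha))) * q n) = of_real E * p n"
      unfolding C th_def[symmetric] pq cis using arg_cong2[OF e1 e2, of "(+)"] by (simp add: algebra_simps)
    show "Ct 1 (\<lambda>n. p n + q n) n + of_real lam * (cis (2 * pi * (omega + 2 * real_of_int n * alpha)) * p n) = of_real E * q n"
      unfolding C th_def[symmetric] pq cis using arg_cong2[OF e1 e2, of "(-)"] by (simp add: algebra_simps)
  qed (use irr lam nonres sq in \<open>auto simp: p_def[abs_def] q_def[abs_def] intro: sqint_add sqint_diff\<close>)
  show ?thesis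
    using p_zero[of n] q_zero[of n] by (simp add: p_def q_def prod_eq_iff)
qed

section \<open>The Wronskian estimate\<close>

text \<open>Green's identity between a solution f at energy x and a solution g at energy x + i
  \<epsilon> with source w. The Hermitian potential cancels; the second component has no hopping and
  enters only through its own equation.\<close>

lemma wronskian_step:
  fixes lam c s x \<epsilon> :: real and f1 f2 fp fm g1 g2 gp gm w1 w2 :: complex
  assumes f1: "fp + fm + of_real lam * (of_real c * f1 + \<i> * of_real s * f2) = of_real x * f1"
    and f2: "of_real lam * (- \<i> * of_real s * f1 - of_real c * f2) = of_real x * f2"
    and g1: "gp + gm + of_real lam * (of_real c * g1 + \<i> * of_real s * g2) = w1 + (of_real x + \<i> * of_real \<epsilon>) * g1"
    and g2: "of_real lam * (- \<i> * of_real s * g1 - of_real c * g2) = w2 + (of_real x + \<i> * of_real \<epsilon>) * g2"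
  shows "(gp * cnj f1 - g1 * cnj fp) - (g1 * cnj fm - gm * cnj f1)
    = (w1 * cnj f1 + w2 * cnj f2) + \<i> * of_real \<epsilon> * (g1 * cnj f1 + g2 * cnj f2)"
proof -
  have F1: "cnj fp + cnj fm = of_real x * cnj f1 - of_real lam * (of_real c * cnj f1 - \<i> * of_real s * cnj f2)"
    using arg_cong[OF f1, of cnj] by (simp add: algebra_simps)
  have F2: "of_real lam * (\<i> * of_real s * cnj f1 - of_real c * cnj f2) = of_real x * cnj f2"
    using arg_cong[OF f2, of cnj] by simp
  have G1: "gp + gm = w1 + (of_real x + \<i> * of_real \<epsilon>) * g1 - of_real lam * (of_real c * g1 + \<i> * of_real s * g2)"
    using g1 by (simp add: algebra_simps)
  have "(gp * cnj f1 - g1 * cnj fp) - (g1 * cnj fm - gm * cnj f1) = (gp + gm) * cnj f1 - g1 * (cnj fp + cnj fm)"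
    by (simp add: algebra_simps)
  also have "\<dots> = w1 * cnj f1 + \<i> * of_real \<epsilon> * (g1 * cnj f1)
      + (of_real lam * (- \<i> * of_real s * g1 - of_real c * g2)) * cnj f2
      - g2 * (of_real lam * (\<i> * of_real s * cnj f1 - of_real c * cnj f2))"
    unfolding F1 G1 by (simp add: algebra_simps)
  also have "\<dots> = (w1 * cnj f1 + w2 * cnj f2) + \<i> * of_real \<epsilon> * (g1 * cnj f1 + g2 * cnj f2)"
    unfolding g2 F2 by (simp add: algebra_simps)
  finally show ?thesis .
qed

text \<open>Eliminating \<open>g2\<close> multiplies by x + lam c, up to sign a diagonal entry of V
  - x. The surviving coefficient is the determinant up to sign, and c^2 + s^2 = 1 makes it
  independent of the site.\<close>

lemma site_identity:
  fixes lam c s x :: real and g1 g2 gp gm r1 r2 :: complex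
  assumes cs: "c\<^sup>2 + s\<^sup>2 = 1"
    and g1: "gp + gm + of_real lam * (of_real c * g1 + \<i> * of_real s * g2) = r1 + of_real x * g1"
    and g2: "of_real lam * (- \<i> * of_real s * g1 - of_real c * g2) = r2 + of_real x * g2"
  shows "of_real (lam\<^sup>2 - x\<^sup>2) * g1 = of_real (x + lam * c) * (r1 - gp - gm) + \<i> * of_real (lam * s) * r2"
proof -
  have G1: "gp + gm - r1 = of_real (x - lam * c) * g1 - \<i> * of_real (lam * s) * g2"
    using g1 by (simp add: algebra_simps)
  have G2: "of_real (x + lam * c) * g2 = - \<i> * of_real (lam * s) * g1 - r2"
    using g2 by (simp add: algebra_simps)
  have "of_real (x + lam * c) * (gp + gm - r1) = of_real ((x + lam * c) * (x - lam * c)) * g1 - \<i> * of_real (lam * s) * (of_real (x + lam * c) * g2)"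
    unfolding G1 by (simp add: algebra_simps)
  also have "\<dots> = of_real (x\<^sup>2 - lam\<^sup>2 * (c\<^sup>2 + s\<^sup>2)) * g1 + \<i> * of_real (lam * s) * r2"
    unfolding G2 by (simp add: algebra_simps power2_eq_square)
  finally have "of_real (x + lam * c) * (gp + gm - r1) = of_real (x\<^sup>2 - lam\<^sup>2) * g1 + \<i> * of_real (lam * s) * r2"
    unfolding cs by simp
  then show ?thesis by (simp add: algebra_simps)
qed

text \<open>The factor D supplied by \<open>site_identity\<close> is absorbed by 1/(D + \<eta>). On
  the residuals \<open>r1\<close>, \<open>r2\<close> only D <= 2 lam and 1/(D + \<eta>) <= 1/\<eta>
  are used.\<close>

lemma site_bound:
  fixes lam c s x \<eta> :: real and g1 g2 gp gm r1 r2 :: complex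
  assumes cs: "c\<^sup>2 + s\<^sup>2 = 1" and lam: "lam > 0" and x: "\<bar>x\<bar> \<le> lam" and \<eta>: "\<eta> > 0"
    and c0: "c0 \<le> lam\<^sup>2 - x\<^sup>2" "c0 > 0"
    and g1: "gp + gm + of_real lam * (of_real c * g1 + \<i> * of_real s * g2) = r1 + of_real x * g1"
    and g2: "of_real lam * (- \<i> * of_real s * g1 - of_real c * g2) = r2 + of_real x * g2"
  shows "c0 * (1 / (\<bar>x + lam * c\<bar> + \<eta>)) * cmod g1 \<le> cmod gp + cmod gm + (2 * lam / \<eta>) * (cmod r1 + cmod r2)"
proof -
  define D where "D = \<bar>x + lam * c\<bar>"
  have "c\<^sup>2 \<le> 1" "s\<^sup>2 \<le> 1" using cs by (metis le_add_same_cancel1 zero_le_power2, metis le_add_same_cancel2 zero_le_power2)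
  then have c1: "\<bar>c\<bar> \<le> 1" and s1: "\<bar>s\<bar> \<le> 1" by (simp_all add: abs_square_le_1)
  have D0: "D \<ge> 0" by (simp add: D_def)
  have "\<bar>lam * c\<bar> \<le> lam * 1" unfolding abs_mult using lam c1 by (intro mult_mono) auto
  then have D2: "D \<le> 2 * lam" using x unfolding D_def by linarith
  have "c0 * cmod g1 \<le> (lam\<^sup>2 - x\<^sup>2) * cmod g1" using c0 by (intro mult_right_mono) auto
  also have "\<dots> = cmod (of_real (lam\<^sup>2 - x\<^sup>2) * g1)" using c0 unfolding norm_mult norm_of_real by simp
  also have "\<dots> \<le> cmod (of_real (x + lam * c) * (r1 - gp - gm)) + cmod (\<i> * of_real (lam * s) * r2)"
    unfolding site_identity[OF cs g1 g2] by (rule norm_triangle_ineq)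
  also have "\<dots> = D * cmod (r1 - gp - gm) + lam * \<bar>s\<bar> * cmod r2"
    using lam unfolding norm_mult norm_of_real D_def by (simp add: abs_mult)
  also have "\<dots> \<le> D * (cmod r1 + cmod gp + cmod gm) + lam * 1 * cmod r2"
  proof (intro add_mono mult_left_mono mult_right_mono D0 s1)
    show "cmod (r1 - gp - gm) \<le> cmod r1 + cmod gp + cmod gm"
      by (metis add_right_mono norm_triangle_ineq4 order_trans)
  qed (use lam in auto)
  finally have main: "c0 * cmod g1 \<le> D * (cmod gp + cmod gm) + (D * cmod r1 + lam * cmod r2)"
    by (simp add: algebra_simps)
  have "D * cmod r1 + lam * cmod r2 \<le> 2 * lam * (cmod r1 + cmod r2)"
  proof -
    have "D * cmod r1 \<le> 2 * lam * cmod r1" by (rule mult_right_mono[OF D2]) simp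
    moreover have "lam * cmod r2 \<le> 2 * lam * cmod r2" using lam by (intro mult_right_mono) auto
    ultimately show ?thesis unfolding distrib_left by linarith
  qed
  with main have m2: "c0 * cmod g1 \<le> D * (cmod gp + cmod gm) + 2 * lam * (cmod r1 + cmod r2)" by linarith
  have De: "D + \<eta> > 0" using D0 \<eta> by simp
  have "c0 * (1 / (D + \<eta>)) * cmod g1 = (c0 * cmod g1) / (D + \<eta>)" by simp
  also have "\<dots> \<le> (D * (cmod gp + cmod gm) + 2 * lam * (cmod r1 + cmod r2)) / (D + \<eta>)"
    using m2 De by (intro divide_right_mono) auto
  also have "\<dots> = D / (D + \<eta>) * (cmod gp + cmod gm) + 2 * lam * (cmod r1 + cmod r2) / (D + \<eta>)"
    by (simp add: add_divide_distrib)
  also have "\<dots> \<le> 1 * (cmod gp + cmod gm) + 2 * lam * (cmod r1 + cmod r2) / \<eta>"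
    using De D0 \<eta> lam by (intro add_mono mult_right_mono divide_left_mono mult_pos_pos) auto
  finally show ?thesis by (simp add: D_def)
qed

section \<open>Wronskians of a generalised eigenfunction and its Cauchy transform\<close>

definition vec :: "(int \<times> bool \<Rightarrow> real \<Rightarrow> complex) \<Rightarrow> real \<Rightarrow> int \<Rightarrow> complex \<times> complex" where
  "vec f x n = (f (n, False) x, f (n, True) x)"

text \<open>\<open>M\<close> will be the spectral measure restricted to a set A of bounded density.
  \<open>par\<close> is Parseval for the indicator of A, which is the constant 1 under
  \<open>M\<close>; \<open>sq\<close> and \<open>bes\<close> survive the restriction because norms
  only decrease.\<close>

locale ac_setting = lipschitz_measure M K for M :: "real measure" and K :: real +
  fixes \<Phi> :: "int \<times> bool \<Rightarrow> real \<Rightarrow> complex" and lam alpha omega c0 :: real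
  assumes irr: "alpha \<notin> \<rat>" and lam: "lam > 0" and c0: "c0 > 0"
    and rng: "AE x in M. \<bar>x\<bar> \<le> lam \<and> c0 \<le> lam\<^sup>2 - x\<^sup>2"
    and sq: "\<And>i. sqint M (\<Phi> i)"
    and bes: "\<And>c F. finite F \<Longrightarrow> l2n M (\<lambda>x. \<Sum>i\<in>F. c i * \<Phi> i x) \<le> L2_set (\<lambda>i. cmod (c i)) F"
    and par: "\<And>e. e > 0 \<Longrightarrow> \<exists>F. finite F \<and> (\<forall>F'. finite F' \<longrightarrow> F \<subseteq> F' \<longrightarrow>
        l2n M (\<lambda>x. (\<Sum>i\<in>F'. cnj (\<integral>y. \<Phi> i y \<partial>M) * \<Phi> i x) - 1) < e)"
    and rec: "AE x in M. \<forall>n. S_op lam alpha omega (vec \<Phi> x) n = (of_real x * \<Phi> (n, False) x, of_real x * \<Phi> (n, True) x)"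
begin

text \<open>The coordinates of 1_A(S)u, and the source terms in the equation of the Cauchy
  transforms.\<close>

definition w :: "int \<times> bool \<Rightarrow> complex" where "w i = (\<integral>y. \<Phi> i y \<partial>M)"
definition cs :: "int \<Rightarrow> real" where "cs n = cos (2 * pi * (omega + 2 * real_of_int n * alpha))"
definition sn :: "int \<Rightarrow> real" where "sn n = sin (2 * pi * (omega + 2 * real_of_int n * alpha))"
definition m :: real where "m = l2n M (\<lambda>x. 1)"
definition B :: real where "B = 2 * pi * K"

lemma B0: "B > 0" using K by (simp add: B_def)
lemma m0: "m \<ge> 0" by (simp add: m_def)

lemma cs_sn: "(cs n)\<^sup>2 + (sn n)\<^sup>2 = 1" by (simp add: cs_def sn_def)

lemma l2n_\<Phi>: "l2n M (\<Phi> i) \<le> 1"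
  using bes[of "{i}" "\<lambda>_. 1"] by simp

definition \<Psi> :: "real \<Rightarrow> int \<times> bool \<Rightarrow> real \<Rightarrow> complex" where "\<Psi> \<epsilon> i = T \<epsilon> (\<Phi> i)"

lemma sq_\<Psi>: "\<epsilon> > 0 \<Longrightarrow> sqint M (\<Psi> \<epsilon> i)"
  unfolding \<Psi>_def by (rule sqint_T(1)[OF sq])

lemma l2n_\<Psi>: assumes "\<epsilon> > 0" shows "l2n M (\<Psi> \<epsilon> i) \<le> B"
proof -
  have "l2n M (\<Psi> \<epsilon> i) \<le> B * l2n M (\<Phi> i)" unfolding \<Psi>_def B_def by (rule l2n_T[OF sq assms])
  also have "\<dots> \<le> B * 1" using B0 l2n_\<Phi> by (intro mult_left_mono) auto
  finally show ?thesis by simp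
qed

lemma \<Psi>\<Phi>: assumes "\<epsilon> > 0" shows "integrable M (\<lambda>x. cmod (\<Psi> \<epsilon> i x) * cmod (\<Phi> j x))" "(\<integral>x. cmod (\<Psi> \<epsilon> i x) * cmod (\<Phi> j x) \<partial>M) \<le> B"
proof -
  show "integrable M (\<lambda>x. cmod (\<Psi> \<epsilon> i x) * cmod (\<Phi> j x))" by (rule sqint_norm_mult[OF sq_\<Psi>[OF assms] sq])
  have "(\<integral>x. cmod (\<Psi> \<epsilon> i x) * cmod (\<Phi> j x) \<partial>M) \<le> l2n M (\<Psi> \<epsilon> i) * l2n M (\<Phi> j)"
    by (rule l2n_Cauchy_Schwarz_norm[OF sq_\<Psi>[OF assms] sq])
  also have "\<dots> \<le> B * 1" using l2n_\<Psi>[OF assms] l2n_\<Phi> B0 by (intro mult_mono) auto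
  finally show "(\<integral>x. cmod (\<Psi> \<epsilon> i x) * cmod (\<Phi> j x) \<partial>M) \<le> B" by simp
qed

lemma L1_le: assumes "sqint M f" shows "integrable M (\<lambda>x. cmod (f x))" "(\<integral>x. cmod (f x) \<partial>M) \<le> m * l2n M f"
  using sqint_norm_mult[OF assms sqint_const[of 1]] l2n_Cauchy_Schwarz_norm[OF assms sqint_const[of 1]]
  by (simp_all add: m_def mult.commute)

text \<open>x/(x - z) = 1 + z/(x - z) with z = s + i \<epsilon>; the 1 produces the source
  \<open>w i\<close>.\<close>

lemma T_xmult:
  assumes f: "sqint M f" and ae: "AE x in M. f x = of_real x * \<Phi> i x" and e: "\<epsilon> > 0"
  shows "T \<epsilon> f s = w i + (of_real s + \<i> * of_real \<epsilon>) * \<Psi> \<epsilon> i s"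
proof -
  let ?z = "of_real s + \<i> * of_real \<epsilon>"
  have i1: "integrable M (\<Phi> i)" using sqint_mult[OF sq sqint_const[of 1]] by simp
  have i2: "integrable M (\<lambda>x. \<Phi> i x * ck \<epsilon> x s)" by (rule sqint_mult[OF sq sqint_ckM[OF e]])
  have "T \<epsilon> f s = (\<integral>x. \<Phi> i x + ?z * (\<Phi> i x * ck \<epsilon> x s) \<partial>M)"
    unfolding T_def
  proof (rule integral_cong_AE)
    show "(\<lambda>x. f x * ck \<epsilon> x s) \<in> borel_measurable M"
      using sqint_mult[OF f sqint_ckM[OF e]] by (rule borel_measurable_integrable)
    show "(\<lambda>x. \<Phi> i x + ?z * (\<Phi> i x * ck \<epsilon> x s)) \<in> borel_measurable M"
      using i1 i2 by (intro borel_measurable_integrable) simp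
    show "AE x in M. f x * ck \<epsilon> x s = \<Phi> i x + ?z * (\<Phi> i x * ck \<epsilon> x s)"
      using ae
    proof eventually_elim
      case (elim x)
      have "(of_real x - of_real s - \<i> * of_real \<epsilon>) * ck \<epsilon> x s = 1"
        using ck_denom_nz[OF e, of x s] by (simp add: ck_def)
      then have "of_real x * ck \<epsilon> x s = 1 + ?z * ck \<epsilon> x s" by (simp add: algebra_simps)
      then have "\<Phi> i x * (of_real x * ck \<epsilon> x s) = \<Phi> i x * (1 + ?z * ck \<epsilon> x s)" by simp
      then show ?case by (simp add: elim algebra_simps)
    qed
  qed
  also have "\<dots> = w i + ?z * \<Psi> \<epsilon> i s" unfolding w_def \<Psi>_def T_def using i1 i2 by simp
  finally show ?thesis .
qed

lemma T_add: "sqint M f \<Longrightarrow> sqint M g \<Longrightarrow> \<epsilon> > 0 \<Longrightarrow> T \<epsilon> (\<lambda>x. f x + g x) s = T \<epsilon> f s + T \<epsilon> g s"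
  unfolding T_def using sqint_mult[OF _ sqint_ckM] by (simp add: distrib_right)

lemma T_diff: "sqint M f \<Longrightarrow> sqint M g \<Longrightarrow> \<epsilon> > 0 \<Longrightarrow> T \<epsilon> (\<lambda>x. f x - g x) s = T \<epsilon> f s - T \<epsilon> g s"
  unfolding T_def using sqint_mult[OF _ sqint_ckM] by (simp add: left_diff_distrib)

lemma T_cmult: "T \<epsilon> (\<lambda>x. c * f x) s = c * T \<epsilon> f s"
  unfolding T_def by (simp add: mult.assoc)

lemma S_vec: "S_op lam alpha omega (vec f x) n =
  (f (n + 1, False) x + f (n - 1, False) x + of_real lam * (of_real (cs n) * f (n, False) x + \<i> * of_real (sn n) * f (n, True) x),
   of_real lam * (- \<i> * of_real (sn n) * f (n, False) x - of_real (cs n) * f (n, True) x))"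
  by (simp add: S_op_def Let_def vec_def cs_def sn_def)

text \<open>The resolvent equation (S - z) Psi = w. It holds at every real s and not just almost
  everywhere, since the recursion of \<Phi> is used only under the integral.\<close>

lemma rec_\<Psi>:
  assumes e: "\<epsilon> > 0"
  shows "S_op lam alpha omega (vec (\<Psi> \<epsilon>) s) n =
    (w (n, False) + (of_real s + \<i> * of_real \<epsilon>) * \<Psi> \<epsilon> (n, False) s, w (n, True) + (of_real s + \<i> * of_real \<epsilon>) * \<Psi> \<epsilon> (n, True) s)"
proof -
  let ?f = "\<lambda>x. fst (S_op lam alpha omega (vec \<Phi> x) n)" and ?g = "\<lambda>x. snd (S_op lam alpha omega (vec \<Phi> x) n)"
  have sf: "sqint M ?f" and sg: "sqint M ?g"
    unfolding S_vec fst_conv snd_conv by (intro sqint_add sqint_diff sqint_cmult sq)+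
  have "AE x in M. ?f x = of_real x * \<Phi> (n, False) x" "AE x in M. ?g x = of_real x * \<Phi> (n, True) x"
    using rec by (eventually_elim, simp)+
  note T_xmult[OF sf this(1) e, of s] T_xmult[OF sg this(2) e, of s]
  moreover have "T \<epsilon> ?f s = fst (S_op lam alpha omega (vec (\<Psi> \<epsilon>) s) n)" "T \<epsilon> ?g s = snd (S_op lam alpha omega (vec (\<Psi> \<epsilon>) s) n)"
    unfolding S_vec fst_conv snd_conv \<Psi>_def
    by (simp_all only: T_add T_diff T_cmult sqint_add sqint_diff sqint_cmult sq e)
  ultimately show ?thesis by (simp add: prod_eq_iff)
qed

definition W :: "real \<Rightarrow> int \<Rightarrow> real \<Rightarrow> complex" where
  "W \<epsilon> n x = \<Psi> \<epsilon> (n + 1, False) x * cnj (\<Phi> (n, False) x) - \<Psi> \<epsilon> (n, False) x * cnj (\<Phi> (n + 1, False) x)"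

definition err :: "real \<Rightarrow> int \<Rightarrow> real \<Rightarrow> complex" where
  "err \<epsilon> n x = \<Psi> \<epsilon> (n, False) x * cnj (\<Phi> (n, False) x) + \<Psi> \<epsilon> (n, True) x * cnj (\<Phi> (n, True) x)"

text \<open>The weight \<open>1/|D\<^sub>n|\<close>, regularised by \<open>\<eta>\<close> because division by \<open>0\<close> gives \<open>0\<close>.\<close>

definition \<kappa> :: "real \<Rightarrow> int \<Rightarrow> real \<Rightarrow> real" where
  "\<kappa> \<eta> n x = 1 / (\<bar>x + lam * cs n\<bar> + \<eta>)"

lemma W_int: "\<epsilon> > 0 \<Longrightarrow> integrable M (W \<epsilon> n)"
  unfolding W_def[abs_def] by (intro Bochner_Integration.integrable_diff sqint_mult sqint_cnj sq sq_\<Psi>)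

lemma \<kappa>_bound: "\<eta> > 0 \<Longrightarrow> 0 \<le> \<kappa> \<eta> n x" "\<eta> > 0 \<Longrightarrow> \<kappa> \<eta> n x \<le> 1 / \<eta>"
  unfolding \<kappa>_def by (auto intro!: divide_left_mono mult_pos_pos add_nonneg_pos)

lemma \<kappa>_int:
  assumes "\<eta> > 0" "integrable M f"
  shows "integrable M (\<lambda>x. \<kappa> \<eta> n x * cmod (f x))"
proof (rule integrable_le)
  show "integrable M (\<lambda>x. 1 / \<eta> * cmod (f x))" using assms(2) by (intro integrable_mult_right integrable_norm)
  have [measurable]: "f \<in> borel_measurable M" using assms(2) by simp
  show "(\<lambda>x. \<kappa> \<eta> n x * cmod (f x)) \<in> borel_measurable M" unfolding \<kappa>_def by measurable
  fix x
  have "\<kappa> \<eta> n x * cmod (f x) \<le> 1 / \<eta> * cmod (f x)"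
    by (intro mult_right_mono \<kappa>_bound assms) simp
  then show "norm (\<kappa> \<eta> n x * cmod (f x)) \<le> 1 / \<eta> * cmod (f x)" using \<kappa>_bound(1)[OF assms(1), of n x] by (simp add: abs_mult)
qed

lemma W_step:
  assumes e: "\<epsilon> > 0"
  shows "AE x in M. \<forall>n. W \<epsilon> n x - W \<epsilon> (n - 1) x =
    (w (n, False) * cnj (\<Phi> (n, False) x) + w (n, True) * cnj (\<Phi> (n, True) x)) + \<i> * of_real \<epsilon> * err \<epsilon> n x"
  using rec
proof eventually_elim
  case (elim x)
  show ?case
  proof
    fix n
    note f = elim[rule_format, of n, unfolded S_vec prod.inject] and g = rec_\<Psi>[OF e, of x n, unfolded S_vec prod.inject]
    from wronskian_step[OF f[THEN conjunct1] f[THEN conjunct2] g[THEN conjunct1] g[THEN conjunct2]]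
    show "W \<epsilon> n x - W \<epsilon> (n - 1) x =
      (w (n, False) * cnj (\<Phi> (n, False) x) + w (n, True) * cnj (\<Phi> (n, True) x)) + \<i> * of_real \<epsilon> * err \<epsilon> n x"
      by (simp add: W_def err_def algebra_simps)
  qed
qed

lemma err_int:
  assumes e: "\<epsilon> > 0"
  shows "integrable M (\<lambda>x. cmod (err \<epsilon> n x))" "(\<integral>x. cmod (err \<epsilon> n x) \<partial>M) \<le> 2 * B"
proof -
  let ?P = "\<lambda>b x. cmod (\<Psi> \<epsilon> (n, b) x) * cmod (\<Phi> (n, b) x)"
  show i: "integrable M (\<lambda>x. cmod (err \<epsilon> n x))"
    unfolding err_def by (intro integrable_norm Bochner_Integration.integrable_add sqint_mult sqint_cnj sq_\<Psi> sq e)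
  have "(\<integral>x. cmod (err \<epsilon> n x) \<partial>M) \<le> (\<integral>x. ?P False x + ?P True x \<partial>M)"
  proof (rule integral_mono[OF i])
    show "integrable M (\<lambda>x. ?P False x + ?P True x)" by (intro Bochner_Integration.integrable_add \<Psi>\<Phi>(1) e)
    show "cmod (err \<epsilon> n x) \<le> ?P False x + ?P True x" for x
      unfolding err_def by (rule order_trans[OF norm_triangle_ineq]) (simp add: norm_mult)
  qed
  also have "\<dots> = (\<integral>x. ?P False x \<partial>M) + (\<integral>x. ?P True x \<partial>M)"
    by (intro Bochner_Integration.integral_add \<Psi>\<Phi>(1) e)
  also have "\<dots> \<le> B + B" by (intro add_mono \<Psi>\<Phi>(2) e)
  also have "B + B = 2 * B" by simp
  finally show "(\<integral>x. cmod (err \<epsilon> n x) \<partial>M) \<le> 2 * B" .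
qed

text \<open>In each product of the Wronskian the factor at site n takes up the weight by
  \<open>site_bound\<close> and is traded for its two neighbours. The four resulting products give
  \<open>4 * B\<close>; the source and the height of z give the term with 1/\<eta>.\<close>

lemma W_small:
  assumes e: "\<epsilon> > 0" and \<eta>: "\<eta> > 0"
  shows "c0 * (\<integral>x. \<kappa> \<eta> n x * cmod (W \<epsilon> n x) \<partial>M)
     \<le> 4 * B + (2 * lam / \<eta>) * (m * (cmod (w (n, False)) + cmod (w (n, True))) + 2 * \<epsilon> * B)"
proof -
  let ?P = "\<lambda>i x. cmod (\<Psi> \<epsilon> i x)" and ?F = "\<lambda>i x. cmod (\<Phi> i x)"
  let ?n = "(n, False)" and ?n2 = "(n, True)" and ?p = "(n + 1, False)" and ?q = "(n - 1, False)"
  let ?R = "\<lambda>x. ?P ?p x * ?F ?p x + ?P ?p x * ?F ?q x + ?P ?p x * ?F ?p x + ?P ?q x * ?F ?p x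
       + (2 * lam / \<eta>) * ((cmod (w ?n) + cmod (w ?n2)) * ?F ?p x + \<epsilon> * (?P ?n x * ?F ?p x) + \<epsilon> * (?P ?n2 x * ?F ?p x))"
  note I = \<Psi>\<Phi>[OF e]
  have Fi: "integrable M (?F i)" "(\<integral>x. ?F i x \<partial>M) \<le> m" for i
    using L1_le[OF sq[of i]] mult_left_mono[OF l2n_\<Phi>[of i] m0] by auto
  have Ri: "integrable M ?R" using I(1) Fi(1) by (intro Bochner_Integration.integrable_add integrable_mult_right) auto
  have "c0 * (\<integral>x. \<kappa> \<eta> n x * cmod (W \<epsilon> n x) \<partial>M) = (\<integral>x. c0 * (\<kappa> \<eta> n x * cmod (W \<epsilon> n x)) \<partial>M)" by simp
  also have "\<dots> \<le> (\<integral>x. ?R x \<partial>M)"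
  proof (rule integral_mono_AE[OF _ Ri])
    show "integrable M (\<lambda>x. c0 * (\<kappa> \<eta> n x * cmod (W \<epsilon> n x)))"
      using \<kappa>_int[OF \<eta> W_int[OF e]] by simp
    show "AE x in M. c0 * (\<kappa> \<eta> n x * cmod (W \<epsilon> n x)) \<le> ?R x"
      using rec rng
    proof eventually_elim
      case (elim x)
      note f = elim(1)[rule_format, of n, unfolded S_vec prod.inject] and g = rec_\<Psi>[OF e, of x n, unfolded S_vec prod.inject]
      have x: "\<bar>x\<bar> \<le> lam" "c0 \<le> lam\<^sup>2 - x\<^sup>2" using elim by auto
      have k: "c0 * \<kappa> \<eta> n x \<ge> 0" using c0 \<kappa>_bound(1)[OF \<eta>, of n x] by simp
      \<comment> \<open>\<Phi> solves the homogeneous equation, hence residuals 0 here; for \<Psi>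
        they are \<open>?r1\<close> and \<open>?r2\<close>.\<close>
      have 1: "c0 * \<kappa> \<eta> n x * ?F ?n x \<le> ?F ?p x + ?F ?q x"
        using site_bound[OF cs_sn lam x(1) \<eta> x(2) c0, of "\<Phi> ?p x" "\<Phi> ?q x" n "\<Phi> ?n x" "\<Phi> ?n2 x" 0 0]
          f by (simp add: \<kappa>_def)
      let ?r1 = "w ?n + \<i> * of_real \<epsilon> * \<Psi> \<epsilon> ?n x" and ?r2 = "w ?n2 + \<i> * of_real \<epsilon> * \<Psi> \<epsilon> ?n2 x"
      have 2: "c0 * \<kappa> \<eta> n x * ?P ?n x \<le> ?P ?p x + ?P ?q x + (2 * lam / \<eta>) * (cmod ?r1 + cmod ?r2)"
        unfolding \<kappa>_def
      proof (rule site_bound[OF cs_sn lam x(1) \<eta> x(2) c0])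
        show "\<Psi> \<epsilon> ?p x + \<Psi> \<epsilon> ?q x + of_real lam * (of_real (cs n) * \<Psi> \<epsilon> ?n x + \<i> * of_real (sn n) * \<Psi> \<epsilon> ?n2 x) = ?r1 + of_real x * \<Psi> \<epsilon> ?n x"
          using g by (simp add: algebra_simps)
        show "of_real lam * (- \<i> * of_real (sn n) * \<Psi> \<epsilon> ?n x - of_real (cs n) * \<Psi> \<epsilon> ?n2 x) = ?r2 + of_real x * \<Psi> \<epsilon> ?n2 x"
          using g by (simp add: algebra_simps)
      qed
      have r: "cmod ?r1 + cmod ?r2 \<le> (cmod (w ?n) + cmod (w ?n2)) + \<epsilon> * ?P ?n x + \<epsilon> * ?P ?n2 x"
        using norm_triangle_ineq[of "w ?n" "\<i> * of_real \<epsilon> * \<Psi> \<epsilon> ?n x"] norm_triangle_ineq[of "w ?n2" "\<i> * of_real \<epsilon> * \<Psi> \<epsilon> ?n2 x"] e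
        by (simp add: norm_mult)
      have "(2 * lam / \<eta>) * (cmod ?r1 + cmod ?r2) \<le> (2 * lam / \<eta>) * ((cmod (w ?n) + cmod (w ?n2)) + \<epsilon> * ?P ?n x + \<epsilon> * ?P ?n2 x)"
        using r lam \<eta> by (intro mult_left_mono) auto
      with 2 have 3: "c0 * \<kappa> \<eta> n x * ?P ?n x \<le> ?P ?p x + ?P ?q x + (2 * lam / \<eta>) * ((cmod (w ?n) + cmod (w ?n2)) + \<epsilon> * ?P ?n x + \<epsilon> * ?P ?n2 x)"
        by linarith
      have "cmod (W \<epsilon> n x) \<le> ?P ?p x * ?F ?n x + ?P ?n x * ?F ?p x"
        unfolding W_def by (rule order_trans[OF norm_triangle_ineq4]) (simp add: norm_mult)
      then have "c0 * \<kappa> \<eta> n x * cmod (W \<epsilon> n x) \<le> c0 * \<kappa> \<eta> n x * (?P ?p x * ?F ?n x + ?P ?n x * ?F ?p x)"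
        using k by (rule mult_left_mono)
      also have "\<dots> = ?P ?p x * (c0 * \<kappa> \<eta> n x * ?F ?n x) + (c0 * \<kappa> \<eta> n x * ?P ?n x) * ?F ?p x"
        by (simp add: algebra_simps)
      also have "\<dots> \<le> ?P ?p x * (?F ?p x + ?F ?q x) + (?P ?p x + ?P ?q x + (2 * lam / \<eta>) * ((cmod (w ?n) + cmod (w ?n2)) + \<epsilon> * ?P ?n x + \<epsilon> * ?P ?n2 x)) * ?F ?p x"
        by (intro add_mono mult_left_mono mult_right_mono 1 3) auto
      also have "\<dots> = ?R x" by (simp add: algebra_simps)
      finally show ?case by (simp add: mult.assoc)
    qed
  qed
  also have "\<dots> = (\<integral>x. ?P ?p x * ?F ?p x \<partial>M) + (\<integral>x. ?P ?p x * ?F ?q x \<partial>M) + (\<integral>x. ?P ?p x * ?F ?p x \<partial>M) + (\<integral>x. ?P ?q x * ?F ?p x \<partial>M)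
       + (2 * lam / \<eta>) * ((cmod (w ?n) + cmod (w ?n2)) * (\<integral>x. ?F ?p x \<partial>M) + \<epsilon> * (\<integral>x. ?P ?n x * ?F ?p x \<partial>M) + \<epsilon> * (\<integral>x. ?P ?n2 x * ?F ?p x \<partial>M))"
    by (simp only: Bochner_Integration.integral_add integral_mult_right_zero I(1) Fi(1) Bochner_Integration.integrable_add integrable_mult_right)
  also have "\<dots> \<le> B + B + B + B + (2 * lam / \<eta>) * ((cmod (w ?n) + cmod (w ?n2)) * m + \<epsilon> * B + \<epsilon> * B)"
    using lam \<eta> e by (intro add_mono mult_left_mono I(2) Fi(2)) auto
  finally show ?thesis by (simp add: algebra_simps)
qed

text \<open>A block of the expansion of the constant 1; up to conjugation, the sources that the
  Wronskian collects between two sites.\<close>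

definition G :: "int \<Rightarrow> int \<Rightarrow> real \<Rightarrow> complex" where
  "G a b x = (\<Sum>i\<in>{a..b} \<times> UNIV. cnj (w i) * \<Phi> i x)"

lemma G_sq: "sqint M (G a b)"
  unfolding G_def by (intro sqint_sum sqint_cmult sq)

lemma G_diff:
  assumes "a \<le> b" "b \<le> c" shows "G a c x - G a b x = G (b + 1) c x"
proof -
  have "{a..c} \<times> (UNIV::bool set) = ({a..b} \<times> UNIV) \<union> ({b+1..c} \<times> UNIV)" using assms by auto
  then have "G a c x = G a b x + G (b + 1) c x"
    unfolding G_def by (simp add: sum.union_disjoint Times_Int_distrib1[symmetric] disjoint_iff)
  then show ?thesis by simp
qed

lemma G_empty: "G (a + 1) a x = 0"
  by (simp add: G_def)

lemma G_Suc:
  assumes "a \<le> b"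
  shows "G a (b + 1) x = G a b x + cnj (w (b + 1, False)) * \<Phi> (b + 1, False) x + cnj (w (b + 1, True)) * \<Phi> (b + 1, True) x"
    and "G (b + 1) (b + 1) x = cnj (w (b + 1, False)) * \<Phi> (b + 1, False) x + cnj (w (b + 1, True)) * \<Phi> (b + 1, True) x"
proof -
  show 1: "G (b + 1) (b + 1) x = cnj (w (b + 1, False)) * \<Phi> (b + 1, False) x + cnj (w (b + 1, True)) * \<Phi> (b + 1, True) x" for b
    by (simp add: G_def sum.cartesian_product'[symmetric] UNIV_bool)
  show "G a (b + 1) x = G a b x + cnj (w (b + 1, False)) * \<Phi> (b + 1, False) x + cnj (w (b + 1, True)) * \<Phi> (b + 1, True) x"
    using G_diff[OF assms, of "b + 1" x] 1[of b] by (simp add: algebra_simps)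
qed

text \<open>\<open>W_step\<close> telescopes: the sources add up to the conjugate of
  \<open>G\<close>, and what remains is at most \<open>2 * \<epsilon> * B\<close> per site in
  mean.\<close>

lemma W_sum:
  assumes e: "\<epsilon> > 0"
  shows "(\<integral>x. cmod (W \<epsilon> (a + int k) x - W \<epsilon> a x - cnj (G (a + 1) (a + int k) x)) \<partial>M) \<le> 2 * \<epsilon> * B * real k"
proof -
  let ?E = "\<lambda>x. W \<epsilon> (a + int k) x - W \<epsilon> a x - cnj (G (a + 1) (a + int k) x)"
  have ae: "AE x in M. cmod (?E x) \<le> (\<Sum>j\<in>{1..k}. \<epsilon> * cmod (err \<epsilon> (a + int j) x))"
    using W_step[OF e]
  proof eventually_elim
    case (elim x)
    have "?E x = (\<Sum>j\<in>{1..k}. \<i> * of_real \<epsilon> * err \<epsilon> (a + int j) x)"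
    proof (induction k)
      case 0 then show ?case by (simp add: G_empty)
    next
      case (Suc k)
      have n: "a + int (Suc k) = a + int k + 1" by simp
      have "G (a + 1) (a + int k + 1) x = G (a + 1) (a + int k) x + (cnj (w (a + int k + 1, False)) * \<Phi> (a + int k + 1, False) x + cnj (w (a + int k + 1, True)) * \<Phi> (a + int k + 1, True) x)"
        using G_Suc[of "a + 1" "a + int k" x] G_Suc(2)[of a a x] by (cases k) (simp_all add: G_empty)
      then show ?case
        using Suc elim[rule_format, of "a + int k + 1"] unfolding n by (simp add: algebra_simps)
    qed
    also have "cmod \<dots> \<le> (\<Sum>j\<in>{1..k}. \<epsilon> * cmod (err \<epsilon> (a + int j) x))"
      by (rule sum_norm_le) (use e in \<open>simp add: norm_mult\<close>)
    finally show ?case .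
  qed
  have "integrable M (\<lambda>x. cnj (G (a + 1) (a + int k) x))"
    using sqint_mult[OF sqint_cnj[OF G_sq] sqint_const[of 1]] by simp
  then have "(\<integral>x. cmod (?E x) \<partial>M) \<le> (\<integral>x. (\<Sum>j\<in>{1..k}. \<epsilon> * cmod (err \<epsilon> (a + int j) x)) \<partial>M)"
    by (intro integral_mono_AE[OF _ _ ae] integrable_norm Bochner_Integration.integrable_diff W_int[OF e])
       (assumption, intro Bochner_Integration.integrable_sum integrable_mult_right err_int(1)[OF e])
  also have "\<dots> = (\<Sum>j\<in>{1..k}. \<epsilon> * (\<integral>x. cmod (err \<epsilon> (a + int j) x) \<partial>M))"
    by (simp only: Bochner_Integration.integral_sum integrable_mult_right integral_mult_right_zero err_int(1)[OF e])
  also have "\<dots> \<le> (\<Sum>j\<in>{1..k}. \<epsilon> * (2 * B))"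
    using e by (intro sum_mono mult_left_mono err_int(2)) auto
  finally show ?thesis by (simp add: algebra_simps)
qed

text \<open>Beyond the central window the blocks of \<open>G\<close> have small norm, so the
  Wronskian is nearly constant there.\<close>

lemma W_diff:
  assumes e: "\<epsilon> > 0"
  shows "(\<integral>x. cmod (W \<epsilon> (a + int k) x - W \<epsilon> a x) \<partial>M) \<le> m * l2n M (G (a + 1) (a + int k)) + 2 * \<epsilon> * B * real k"
proof -
  have Gi: "integrable M (\<lambda>x. cnj (G (a + 1) (a + int k) x))"
    using sqint_mult[OF sqint_cnj[OF G_sq] sqint_const[of 1]] by simp
  have i1: "integrable M (\<lambda>x. cmod (W \<epsilon> (a + int k) x - W \<epsilon> a x - cnj (G (a + 1) (a + int k) x)))"
    using W_int[OF e] Gi by (intro integrable_norm Bochner_Integration.integrable_diff)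
  have "(\<integral>x. cmod (W \<epsilon> (a + int k) x - W \<epsilon> a x) \<partial>M)
     \<le> (\<integral>x. cmod (W \<epsilon> (a + int k) x - W \<epsilon> a x - cnj (G (a + 1) (a + int k) x)) + cmod (G (a + 1) (a + int k) x) \<partial>M)"
  proof (rule integral_mono)
    show "integrable M (\<lambda>x. cmod (W \<epsilon> (a + int k) x - W \<epsilon> a x))"
      using W_int[OF e] by (intro integrable_norm Bochner_Integration.integrable_diff)
    show "integrable M (\<lambda>x. cmod (W \<epsilon> (a + int k) x - W \<epsilon> a x - cnj (G (a + 1) (a + int k) x)) + cmod (G (a + 1) (a + int k) x))"
      using i1 L1_le(1)[OF G_sq] by (rule Bochner_Integration.integrable_add)
    fix x
    show "cmod (W \<epsilon> (a + int k) x - W \<epsilon> a x) \<le> cmod (W \<epsilon> (a + int k) x - W \<epsilon> a x - cnj (G (a + 1) (a + int k) x)) + cmod (G (a + 1) (a + int k) x)"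
      using norm_triangle_ineq[of "W \<epsilon> (a + int k) x - W \<epsilon> a x - cnj (G (a + 1) (a + int k) x)" "cnj (G (a + 1) (a + int k) x)"] by simp
  qed
  also have "\<dots> = (\<integral>x. cmod (W \<epsilon> (a + int k) x - W \<epsilon> a x - cnj (G (a + 1) (a + int k) x)) \<partial>M) + (\<integral>x. cmod (G (a + 1) (a + int k) x) \<partial>M)"
    by (rule Bochner_Integration.integral_add[OF i1 L1_le(1)[OF G_sq]])
  also have "\<dots> \<le> 2 * \<epsilon> * B * real k + m * l2n M (G (a + 1) (a + int k))"
    by (intro add_mono W_sum[OF e] L1_le(2)[OF G_sq])
  finally show ?thesis by simp
qed

text \<open>Near infinity \<open>W\<close> barely depends on the site, so the bound of \<open>W_small\<close> can be summed over a block
  of sites with \<open>W\<close> frozen at a reference site \<open>r\<close>.\<close>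

lemma block_bound:
  assumes e: "\<epsilon> > 0" and \<eta>: "\<eta> > 0" and N: "N > 0"
    and kap: "AE x in M. L * real N \<le> (\<Sum>k=1..N. \<kappa> \<eta> (r0 + int k) x)"
    and wb: "\<And>k b. k \<in> {1..N} \<Longrightarrow> cmod (w (r0 + int k, b)) \<le> \<omega>"
    and d: "\<And>k. k \<in> {1..N} \<Longrightarrow> (\<integral>x. cmod (W \<epsilon> (r0 + int k) x - W \<epsilon> r x) \<partial>M) \<le> \<delta>"
  shows "L * (\<integral>x. cmod (W \<epsilon> r x) \<partial>M) \<le> (4 * B + (2 * lam / \<eta>) * (m * (2 * \<omega>) + 2 * \<epsilon> * B)) / c0 + \<delta> / \<eta>"
proof -
  let ?Q = "(4 * B + (2 * lam / \<eta>) * (m * (2 * \<omega>) + 2 * \<epsilon> * B)) / c0 + \<delta> / \<eta>"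
  note Wi = W_int[OF e]
  have "real N * (L * (\<integral>x. cmod (W \<epsilon> r x) \<partial>M)) = (\<integral>x. (L * real N) * cmod (W \<epsilon> r x) \<partial>M)" by simp
  also have "\<dots> \<le> (\<integral>x. (\<Sum>k=1..N. \<kappa> \<eta> (r0 + int k) x * cmod (W \<epsilon> r x)) \<partial>M)"
  proof (rule integral_mono_AE)
    show "integrable M (\<lambda>x. L * real N * cmod (W \<epsilon> r x))" using Wi by simp
    show "integrable M (\<lambda>x. \<Sum>k=1..N. \<kappa> \<eta> (r0 + int k) x * cmod (W \<epsilon> r x))"
      by (intro Bochner_Integration.integrable_sum \<kappa>_int \<eta> Wi)
    show "AE x in M. L * real N * cmod (W \<epsilon> r x) \<le> (\<Sum>k=1..N. \<kappa> \<eta> (r0 + int k) x * cmod (W \<epsilon> r x))"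
      using kap
    proof eventually_elim
      case (elim x)
      from mult_right_mono[OF elim, of "cmod (W \<epsilon> r x)"] show ?case by (simp add: sum_distrib_right)
    qed
  qed
  also have "\<dots> = (\<Sum>k=1..N. \<integral>x. \<kappa> \<eta> (r0 + int k) x * cmod (W \<epsilon> r x) \<partial>M)"
    by (intro Bochner_Integration.integral_sum \<kappa>_int \<eta> Wi)
  also have "\<dots> \<le> (\<Sum>k=1..N. ?Q)"
  proof (rule sum_mono)
    fix k assume k: "k \<in> {1..N}"
    have di: "integrable M (\<lambda>x. cmod (W \<epsilon> (r0 + int k) x - W \<epsilon> r x))"
      by (intro integrable_norm Bochner_Integration.integrable_diff Wi)
    have "(\<integral>x. \<kappa> \<eta> (r0 + int k) x * cmod (W \<epsilon> r x) \<partial>M)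
      \<le> (\<integral>x. \<kappa> \<eta> (r0 + int k) x * cmod (W \<epsilon> (r0 + int k) x) + 1 / \<eta> * cmod (W \<epsilon> (r0 + int k) x - W \<epsilon> r x) \<partial>M)"
    proof (rule integral_mono)
      show "integrable M (\<lambda>x. \<kappa> \<eta> (r0 + int k) x * cmod (W \<epsilon> r x))" by (intro \<kappa>_int \<eta> Wi)
      show "integrable M (\<lambda>x. \<kappa> \<eta> (r0 + int k) x * cmod (W \<epsilon> (r0 + int k) x) + 1 / \<eta> * cmod (W \<epsilon> (r0 + int k) x - W \<epsilon> r x))"
        by (intro Bochner_Integration.integrable_add \<kappa>_int \<eta> Wi integrable_mult_right di)
      fix x
      \<comment> \<open>The weight is at most 1/\<eta>, so freezing the site costs the mean
        increment divided by \<eta>.\<close>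
      have "\<kappa> \<eta> (r0 + int k) x * cmod (W \<epsilon> r x) \<le> \<kappa> \<eta> (r0 + int k) x * (cmod (W \<epsilon> (r0 + int k) x) + cmod (W \<epsilon> (r0 + int k) x - W \<epsilon> r x))"
        using norm_triangle_sub[of "W \<epsilon> r x" "W \<epsilon> (r0 + int k) x"]
        by (intro mult_left_mono \<kappa>_bound(1)[OF \<eta>]) (simp add: norm_minus_commute)
      also have "\<dots> \<le> \<kappa> \<eta> (r0 + int k) x * cmod (W \<epsilon> (r0 + int k) x) + 1 / \<eta> * cmod (W \<epsilon> (r0 + int k) x - W \<epsilon> r x)"
        unfolding distrib_left by (intro add_mono mult_right_mono \<kappa>_bound(2)[OF \<eta>]) auto
      finally show "\<kappa> \<eta> (r0 + int k) x * cmod (W \<epsilon> r x) \<le> \<kappa> \<eta> (r0 + int k) x * cmod (W \<epsilon> (r0 + int k) x) + 1 / \<eta> * cmod (W \<epsilon> (r0 + int k) x - W \<epsilon> r x)" .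
    qed
    also have "\<dots> = (\<integral>x. \<kappa> \<eta> (r0 + int k) x * cmod (W \<epsilon> (r0 + int k) x) \<partial>M) + 1 / \<eta> * (\<integral>x. cmod (W \<epsilon> (r0 + int k) x - W \<epsilon> r x) \<partial>M)"
      by (simp only: Bochner_Integration.integral_add[OF \<kappa>_int[OF \<eta> Wi] integrable_mult_right[OF di]] integral_mult_right_zero)
    also have "\<dots> \<le> (4 * B + (2 * lam / \<eta>) * (m * (2 * \<omega>) + 2 * \<epsilon> * B)) / c0 + 1 / \<eta> * \<delta>"
    proof (intro add_mono mult_left_mono d k)
      have "m * (cmod (w (r0 + int k, False)) + cmod (w (r0 + int k, True))) \<le> m * (2 * \<omega>)"
        using wb[OF k, of False] wb[OF k, of True] m0 by (intro mult_left_mono) auto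
      then have "(2 * lam / \<eta>) * (m * (cmod (w (r0 + int k, False)) + cmod (w (r0 + int k, True))) + 2 * \<epsilon> * B)
          \<le> (2 * lam / \<eta>) * (m * (2 * \<omega>) + 2 * \<epsilon> * B)"
        using lam \<eta> by (intro mult_left_mono) auto
      with W_small[OF e \<eta>, of "r0 + int k"]
      have "c0 * (\<integral>x. \<kappa> \<eta> (r0 + int k) x * cmod (W \<epsilon> (r0 + int k) x) \<partial>M) \<le> 4 * B + (2 * lam / \<eta>) * (m * (2 * \<omega>) + 2 * \<epsilon> * B)"
        by linarith
      then show "(\<integral>x. \<kappa> \<eta> (r0 + int k) x * cmod (W \<epsilon> (r0 + int k) x) \<partial>M) \<le> (4 * B + (2 * lam / \<eta>) * (m * (2 * \<omega>) + 2 * \<epsilon> * B)) / c0"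
        using c0 by (simp add: le_divide_eq mult.commute)
    qed (use \<eta> in auto)
    finally show "(\<integral>x. \<kappa> \<eta> (r0 + int k) x * cmod (W \<epsilon> r x) \<partial>M) \<le> ?Q" by simp
  qed
  also have "\<dots> = real N * ?Q" by simp
  finally show ?thesis using N by (simp only: mult_le_cancel_left_pos of_nat_0_less_iff)
qed

lemma ex_small:
  fixes f g :: "real \<Rightarrow> real"
  assumes "(f \<longlongrightarrow> 0) (at_right 0)" "(g \<longlongrightarrow> 0) (at_right 0)" "a > 0" "b > 0"
  shows "\<exists>e>0. f e < a \<and> g e < b"
proof -
  have "\<forall>\<^sub>F e in at_right 0. f e < a \<and> g e < b \<and> e > 0"
    using order_tendstoD(2)[OF assms(1,3)] order_tendstoD(2)[OF assms(2,4)] eventually_at_right_less[of 0]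
    by eventually_elim auto
  then show ?thesis using eventually_happens[of _ "at_right (0::real)"] by fastforce
qed

text \<open>Suppose \<open>m\<close>, the norm of 1, is positive. The Wronskian has mean at most Q/L
  at each end, yet both ends together must carry at least half of m^2, since it changes by about 1
  across the central window.\<close>

lemma m_zero: "m = 0"
proof (rule ccontr)
  assume "m \<noteq> 0"
  then have m: "m > 0" using m0 by simp
  \<comment> \<open>The main term of \<open>block_bound\<close>, plus 1 for two errors below 1/2
    each: one governed by \<open>e\<close>, the other by \<epsilon>.\<close>
  define Q where "Q = 4 * B / c0 + 1"
  have Q: "Q > 0" using B0 c0 by (simp add: Q_def add_pos_pos)
  \<comment> \<open>Chosen so that L m^2 / 2 exceeds 2 Q.\<close>
  define L where "L = (4 * Q + 1) / m\<^sup>2"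
  have L: "L > 0" using Q m by (simp add: L_def)
  obtain \<eta> N where \<eta>: "\<eta> > 0" and N: "N > 0"
    and large: "\<And>th E. \<bar>E\<bar> \<le> lam \<Longrightarrow> L * real N \<le> (\<Sum>n=1..N. 1 / (\<bar>E + lam * cos (2 * pi * (th + 2 * real n * alpha))\<bar> + \<eta>))"
    using dirichlet_sum_large[OF irr lam, of L] by blast
  have kap: "AE x in M. L * real N \<le> (\<Sum>k=1..N. \<kappa> \<eta> (r0 + int k) x)" for r0
    using rng
  proof eventually_elim
    case (elim x)
    have "omega + 2 * real_of_int r0 * alpha + 2 * real k * alpha = omega + 2 * real_of_int (r0 + int k) * alpha" for k
      by (simp add: algebra_simps)
    note eq = this
    show ?case
      unfolding \<kappa>_def cs_def eq[symmetric] using elim by (intro large) simp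
  qed
  have "\<exists>e>0. (2 * lam / \<eta>) * (m * (2 * sqrt (2 * e * m))) / c0 + 2 * e * m / \<eta> < 1/2 \<and> m * e < m\<^sup>2 / 4"
  proof (rule ex_small)
    have "((\<lambda>e. (2 * lam / \<eta>) * (m * (2 * sqrt (2 * e * m))) / c0 + 2 * e * m / \<eta>) \<longlongrightarrow> (2 * lam / \<eta>) * (m * (2 * sqrt (2 * 0 * m))) / c0 + 2 * 0 * m / \<eta>) (at_right 0)"
      using c0 \<eta> by (intro tendsto_intros) auto
    then show "((\<lambda>e. (2 * lam / \<eta>) * (m * (2 * sqrt (2 * e * m))) / c0 + 2 * e * m / \<eta>) \<longlongrightarrow> 0) (at_right 0)" by simp
    have "((\<lambda>e. m * e) \<longlongrightarrow> m * 0) (at_right 0)" by (intro tendsto_intros)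
    then show "((\<lambda>e. m * e) \<longlongrightarrow> 0) (at_right 0)" by simp
  qed (use m in auto)
  then obtain e where e: "e > 0" and e1: "(2 * lam / \<eta>) * (m * (2 * sqrt (2 * e * m))) / c0 + 2 * e * m / \<eta> < 1/2" and e2: "m * e < m\<^sup>2 / 4"
    by blast
  obtain F where F: "finite F" and Fe: "\<And>F'. finite F' \<Longrightarrow> F \<subseteq> F' \<Longrightarrow> l2n M (\<lambda>x. (\<Sum>i\<in>F'. cnj (w i) * \<Phi> i x) - 1) < e"
    using par[OF e] unfolding w_def by blast
  have S: "sqint M (\<lambda>x. \<Sum>i\<in>F'. cnj (w i) * \<Phi> i x)" for F' by (intro sqint_sum sqint_cmult sq)
  have two: "l2n M (\<lambda>x. (\<Sum>i\<in>F'. cnj (w i) * \<Phi> i x) - (\<Sum>i\<in>F''. cnj (w i) * \<Phi> i x)) \<le> 2 * e"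
    if "finite F'" "F \<subseteq> F'" "finite F''" "F \<subseteq> F''" for F' F''
    using l2n_triangle_diff[OF S[of F'] sqint_const[of 1] S[of F'']] Fe[OF that(1,2)] Fe[OF that(3,4)]
      l2n_minus_commute[of M "\<lambda>x. \<Sum>i\<in>F''. cnj (w i) * \<Phi> i x" "\<lambda>x. 1"] by linarith
  \<comment> \<open>Adding the single index \<open>i\<close> changes the partial sum by at most 2e
    in norm, and the integral of the added term is |w i|^2.\<close>
  have wsmall: "cmod (w i) \<le> sqrt (2 * e * m)" if "i \<notin> F" for i
  proof -
    have "(\<lambda>x. (\<Sum>j\<in>insert i F. cnj (w j) * \<Phi> j x) - (\<Sum>j\<in>F. cnj (w j) * \<Phi> j x)) = (\<lambda>x. cnj (w i) * \<Phi> i x)"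
      using F that by (auto simp: fun_eq_iff)
    with two[of "insert i F" F] F have l: "l2n M (\<lambda>x. cnj (w i) * \<Phi> i x) \<le> 2 * e" by auto
    have "cnj (w i) * w i = (\<integral>x. cnj (w i) * \<Phi> i x \<partial>M)" by (simp add: w_def)
    then have "cmod (w i) * cmod (w i) = cmod (\<integral>x. cnj (w i) * \<Phi> i x \<partial>M)" by (metis complex_mod_cnj norm_mult)
    also have "\<dots> \<le> (\<integral>x. cmod (cnj (w i) * \<Phi> i x) \<partial>M)" by (rule integral_norm_bound)
    also have "\<dots> \<le> m * l2n M (\<lambda>x. cnj (w i) * \<Phi> i x)" by (rule L1_le(2)[OF sqint_cmult[OF sq]])
    also have "\<dots> \<le> m * (2 * e)" using l m by (intro mult_left_mono) auto
    finally have "(cmod (w i))\<^sup>2 \<le> 2 * e * m" by (simp add: power2_eq_square mult_ac)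
    then show ?thesis by (rule real_le_rsqrt)
  qed
  \<comment> \<open>The inserted 0 covers an empty \<open>F\<close> and makes \<open>R\<close>
    nonnegative.\<close>
  define R where "R = Max (insert 0 ((\<lambda>i. \<bar>fst i\<bar>) ` F))"
  have R0: "R \<ge> 0" unfolding R_def using F by (intro Max_ge) auto
  have FR: "F \<subseteq> {a..b} \<times> UNIV" if "a \<le> - R" "R \<le> b" for a b
  proof
    fix i assume "i \<in> F"
    then have "\<bar>fst i\<bar> \<le> R" unfolding R_def using F by (intro Max_ge) auto
    then show "i \<in> {a..b} \<times> UNIV" using that by (cases i) auto
  qed
  have iF: "(n, b) \<notin> F" if "\<bar>n\<bar> > R" for n b
  proof
    assume "(n, b) \<in> F"
    then have "(n, b) \<in> {-R..R} \<times> (UNIV::bool set)" using FR[of "-R" R] by blast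
    then show False using that by auto
  qed
  have Gr: "l2n M (G (R + 1) b) \<le> 2 * e" if "b \<ge> R" for b
  proof -
    have "G (R + 1) b = (\<lambda>x. G (-R) b x - G (-R) R x)" using G_diff[of "-R" R b] that R0 by auto
    then show ?thesis using two[of "{-R..b} \<times> UNIV" "{-R..R} \<times> UNIV"] FR that by (simp add: G_def)
  qed
  have Gl: "l2n M (G a (- R - 1)) \<le> 2 * e" if "a \<le> - R" for a
  proof -
    have "G a (-R - 1) x = G a R x - G (-R) R x" for x
    proof -
      have "{a..R} \<times> (UNIV::bool set) = ({a..-R-1} \<times> UNIV) \<union> ({-R..R} \<times> UNIV)" using that R0 by auto
      then have "G a R x = G a (-R-1) x + G (-R) R x"
        unfolding G_def by (simp add: sum.union_disjoint Times_Int_distrib1[symmetric] disjoint_iff)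
      then show ?thesis by simp
    qed
    then have "G a (-R - 1) = (\<lambda>x. G a R x - G (-R) R x)" by auto
    then show ?thesis using two[of "{a..R} \<times> UNIV" "{-R..R} \<times> UNIV"] FR that by (simp add: G_def)
  qed
  \<comment> \<open>The height is fixed only now because it must beat both the block length N and
    the window length 2R + 1.\<close>
  have "\<exists>\<epsilon>>0. (2 * lam / \<eta>) * (2 * \<epsilon> * B) / c0 + 2 * \<epsilon> * B * real N / \<eta> < 1/2 \<and> 2 * \<epsilon> * B * (2 * real_of_int R + 1) < m\<^sup>2 / 4"
  proof (rule ex_small)
    have "((\<lambda>\<epsilon>. (2 * lam / \<eta>) * (2 * \<epsilon> * B) / c0 + 2 * \<epsilon> * B * real N / \<eta>) \<longlongrightarrow> (2 * lam / \<eta>) * (2 * 0 * B) / c0 + 2 * 0 * B * real N / \<eta>) (at_right 0)"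
      using c0 \<eta> by (intro tendsto_intros) auto
    then show "((\<lambda>\<epsilon>. (2 * lam / \<eta>) * (2 * \<epsilon> * B) / c0 + 2 * \<epsilon> * B * real N / \<eta>) \<longlongrightarrow> 0) (at_right 0)" by simp
    have "((\<lambda>\<epsilon>. 2 * \<epsilon> * B * (2 * real_of_int R + 1)) \<longlongrightarrow> 2 * 0 * B * (2 * real_of_int R + 1)) (at_right 0)"
      by (intro tendsto_intros)
    then show "((\<lambda>\<epsilon>. 2 * \<epsilon> * B * (2 * real_of_int R + 1)) \<longlongrightarrow> 0) (at_right 0)" by simp
  qed (use m in auto)
  then obtain \<epsilon> where ep: "\<epsilon> > 0" and ep1: "(2 * lam / \<eta>) * (2 * \<epsilon> * B) / c0 + 2 * \<epsilon> * B * real N / \<eta> < 1/2"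
    and ep2: "2 * \<epsilon> * B * (2 * real_of_int R + 1) < m\<^sup>2 / 4" by blast
  define \<delta> where "\<delta> = m * (2 * e) + 2 * \<epsilon> * B * real N"
  have bnd: "(4 * B + (2 * lam / \<eta>) * (m * (2 * sqrt (2 * e * m)) + 2 * \<epsilon> * B)) / c0 + \<delta> / \<eta> \<le> Q"
  proof -
    have "(4 * B + (2 * lam / \<eta>) * (m * (2 * sqrt (2 * e * m)) + 2 * \<epsilon> * B)) / c0 + \<delta> / \<eta>
      = 4 * B / c0 + ((2 * lam / \<eta>) * (m * (2 * sqrt (2 * e * m))) / c0 + 2 * e * m / \<eta>) + ((2 * lam / \<eta>) * (2 * \<epsilon> * B) / c0 + 2 * \<epsilon> * B * real N / \<eta>)"
      by (simp add: \<delta>_def add_divide_distrib distrib_left mult_ac)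
    then show ?thesis using e1 ep1 unfolding Q_def by linarith
  qed
  have right: "L * (\<integral>x. cmod (W \<epsilon> R x) \<partial>M) \<le> Q"
  proof (rule order_trans[OF block_bound[OF ep \<eta> N kap[of R], of "sqrt (2 * e * m)" R \<delta>] bnd])
    fix k assume k: "k \<in> {1..N}"
    show "cmod (w (R + int k, b)) \<le> sqrt (2 * e * m)" for b using k R0 by (intro wsmall iF) auto
    have "(\<integral>x. cmod (W \<epsilon> (R + int k) x - W \<epsilon> R x) \<partial>M) \<le> m * l2n M (G (R + 1) (R + int k)) + 2 * \<epsilon> * B * real k"
      by (rule W_diff[OF ep])
    also have "\<dots> \<le> \<delta>" unfolding \<delta>_def
      using m ep B0 k by (intro add_mono mult_left_mono Gr) auto
    finally show "(\<integral>x. cmod (W \<epsilon> (R + int k) x - W \<epsilon> R x) \<partial>M) \<le> \<delta>" .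
  qed
  \<comment> \<open>The block of N sites then ends at - R - 2, just left of the reference site - R -
    1.\<close>
  define r0 where "r0 = - R - 2 - int N"
  have left: "L * (\<integral>x. cmod (W \<epsilon> (- R - 1) x) \<partial>M) \<le> Q"
  proof (rule order_trans[OF block_bound[OF ep \<eta> N kap[of r0], of "sqrt (2 * e * m)" "- R - 1" \<delta>] bnd])
    fix k assume k: "k \<in> {1..N}"
    show "cmod (w (r0 + int k, b)) \<le> sqrt (2 * e * m)" for b using k R0 by (intro wsmall iF) (auto simp: r0_def)
    define k' where "k' = N + 1 - k"
    have k': "r0 + int k + int k' = - R - 1" "k' \<le> N" using k by (auto simp: k'_def r0_def)
    have "(\<integral>x. cmod (W \<epsilon> (r0 + int k + int k') x - W \<epsilon> (r0 + int k) x) \<partial>M)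
        \<le> m * l2n M (G (r0 + int k + 1) (r0 + int k + int k')) + 2 * \<epsilon> * B * real k'"
      by (rule W_diff[OF ep])
    also have "\<dots> \<le> \<delta>" unfolding \<delta>_def k'(1)
      using m ep B0 k k'(2) by (intro add_mono mult_left_mono Gl) (auto simp: r0_def)
    finally show "(\<integral>x. cmod (W \<epsilon> (r0 + int k) x - W \<epsilon> (- R - 1) x) \<partial>M) \<le> \<delta>"
      unfolding k'(1) by (simp add: norm_minus_commute)
  qed
  let ?G = "G (- R) R"
  have sG: "sqint M (\<lambda>x. ?G x - 1)" by (intro sqint_diff G_sq sqint_const)
  let ?H = "\<lambda>x. cmod (W \<epsilon> R x - W \<epsilon> (- R - 1) x - cnj (?G x))"
  have Hi: "integrable M ?H"
  proof -
    have "integrable M (\<lambda>x. cnj (?G x))"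
      using sqint_mult[OF sqint_cnj[OF G_sq] sqint_const[of 1]] by simp
    then show ?thesis using W_int[OF ep] by (intro integrable_norm Bochner_Integration.integrable_diff)
  qed
  have mid: "(\<integral>x. ?H x \<partial>M) \<le> 2 * \<epsilon> * B * (2 * real_of_int R + 1)"
  proof -
    have "- R - 1 + int (nat (2 * R + 1)) = R" "real (nat (2 * R + 1)) = 2 * real_of_int R + 1" using R0 by auto
    with W_sum[OF ep, of "- R - 1" "nat (2 * R + 1)"] show ?thesis by simp
  qed
  have Wi: "integrable M (\<lambda>x. cmod (W \<epsilon> n x))" for n using W_int[OF ep] by (rule integrable_norm)
  have "m\<^sup>2 = (\<integral>x. 1 \<partial>M)" unfolding m_def l2n_power2 by simp
  also have "\<dots> \<le> (\<integral>x. cmod (?G x - 1) + ?H x + cmod (W \<epsilon> R x) + cmod (W \<epsilon> (- R - 1) x) \<partial>M)"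
  proof (rule integral_mono)
    show "integrable M (\<lambda>x. cmod (?G x - 1) + ?H x + cmod (W \<epsilon> R x) + cmod (W \<epsilon> (- R - 1) x))"
      by (intro Bochner_Integration.integrable_add L1_le(1)[OF sG] Hi Wi)
    fix x
    have "cnj (?G x) - 1 = cnj (?G x - 1)" by simp
    then have c: "cmod (cnj (?G x) - 1) = cmod (?G x - 1)" by (simp only: complex_mod_cnj)
    \<comment> \<open>The constant 1 is split into the two outer Wronskians, the error of the
      central sum and the Parseval error.\<close>
    have "1 = cmod (W \<epsilon> R x - W \<epsilon> (- R - 1) x - (W \<epsilon> R x - W \<epsilon> (- R - 1) x - cnj (?G x)) - (cnj (?G x) - 1))" by simp
    also have "\<dots> \<le> cmod (W \<epsilon> R x) + cmod (W \<epsilon> (- R - 1) x) + ?H x + cmod (cnj (?G x) - 1)"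
      by (intro order_trans[OF norm_triangle_ineq4] add_mono order_refl)
    finally show "1 \<le> cmod (?G x - 1) + ?H x + cmod (W \<epsilon> R x) + cmod (W \<epsilon> (- R - 1) x)"
      unfolding c by linarith
  qed simp
  also have "\<dots> = (\<integral>x. cmod (?G x - 1) \<partial>M) + (\<integral>x. ?H x \<partial>M) + (\<integral>x. cmod (W \<epsilon> R x) \<partial>M) + (\<integral>x. cmod (W \<epsilon> (- R - 1) x) \<partial>M)"
    by (simp only: Bochner_Integration.integral_add Bochner_Integration.integrable_add L1_le(1)[OF sG] Hi Wi)
  also have "(\<integral>x. cmod (?G x - 1) \<partial>M) \<le> m * e"
  proof -
    have "l2n M (\<lambda>x. ?G x - 1) \<le> e" using Fe[of "{-R..R} \<times> UNIV"] FR by (simp add: G_def less_imp_le)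
    then show ?thesis using L1_le(2)[OF sG] m by (meson mult_left_mono less_imp_le order_trans)
  qed
  finally have "m\<^sup>2 \<le> m\<^sup>2 / 4 + m\<^sup>2 / 4 + (\<integral>x. cmod (W \<epsilon> R x) \<partial>M) + (\<integral>x. cmod (W \<epsilon> (- R - 1) x) \<partial>M)"
    using mid e2 ep2 by linarith
  then have "m\<^sup>2 / 2 \<le> (\<integral>x. cmod (W \<epsilon> R x) \<partial>M) + (\<integral>x. cmod (W \<epsilon> (- R - 1) x) \<partial>M)" by simp
  then have "L * (m\<^sup>2 / 2) \<le> L * ((\<integral>x. cmod (W \<epsilon> R x) \<partial>M) + (\<integral>x. cmod (W \<epsilon> (- R - 1) x) \<partial>M))"
    using L by (intro mult_left_mono) auto
  also have "\<dots> \<le> Q + Q" using left right by (simp add: distrib_left)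
  also have "L * (m\<^sup>2 / 2) = (4 * Q + 1) / 2" using m by (simp add: L_def)
  finally show False by simp
qed

end

section \<open>Spectral measures and generalised eigenfunctions\<close>

lemma integral_cZ_indicator:
  fixes f :: "int \<Rightarrow> 'a :: {banach, second_countable_topology}"
  assumes "finite F"
  shows "(\<integral>n. indicator F n *\<^sub>R f n \<partial>cZ) = (\<Sum>n\<in>F. f n)"
  using assms integral_restrict_space[of F cZ f]
  by (simp add: restrict_count_space lebesgue_integral_count_space_finite)

lemma sum_le_integral_cZ:
  fixes f :: "int \<Rightarrow> real"
  assumes "finite F" "integrable cZ f" "\<And>n. 0 \<le> f n"
  shows "(\<Sum>n\<in>F. f n) \<le> (\<integral>n. f n \<partial>cZ)"
  unfolding integral_cZ_indicator[OF assms(1), symmetric]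
proof (rule integral_mono)
  show "integrable cZ (\<lambda>n. indicator F n *\<^sub>R f n)"
    by (rule Bochner_Integration.integrable_bound[OF assms(2)]) (auto simp: indicator_def)
qed (use assms in \<open>auto simp: indicator_def\<close>)

lemma sum_tendsto_integral_cZ:
  fixes f :: "int \<Rightarrow> real"
  assumes "integrable cZ f"
  shows "(\<lambda>N. \<Sum>n\<in>{- int N..int N}. f n) \<longlonglongrightarrow> (\<integral>n. f n \<partial>cZ)"
proof -
  have "(\<lambda>N. \<integral>n. indicator {- int N..int N} n *\<^sub>R f n \<partial>cZ) \<longlonglongrightarrow> (\<integral>n. f n \<partial>cZ)"
  proof (rule integral_dominated_convergence[where w = "\<lambda>n. \<bar>f n\<bar>"])
    show "AE n in cZ. (\<lambda>N. indicator {- int N..int N} n *\<^sub>R f n) \<longlonglongrightarrow> f n"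
    proof (rule AE_I2)
      fix n
      show "(\<lambda>N. indicator {- int N..int N} n *\<^sub>R f n) \<longlonglongrightarrow> f n"
        by (intro tendsto_eventually eventually_sequentiallyI[of "nat \<bar>n\<bar>"]) (auto simp: indicator_def)
    qed
  qed (use assms in \<open>auto simp: indicator_def\<close>)
  then show ?thesis by (simp only: integral_cZ_indicator finite_atLeastAtMost_int)
qed

text \<open>The bridge from \<open>summable_on\<close> in the definition of \<open>l2\<close> to
  counting measure, through absolute summability.\<close>

lemma summable_on_iff_integrable_cZ:
  fixes f :: "int \<Rightarrow> real"
  shows "f summable_on UNIV \<longleftrightarrow> integrable cZ f"
proof -
  have "f summable_on UNIV \<longleftrightarrow> Infinite_Sum.abs_summable_on f UNIV"
    by (rule summable_on_iff_abs_summable_on_real)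
  also have "\<dots> \<longleftrightarrow> Infinite_Set_Sum.abs_summable_on f UNIV" by (rule abs_summable_equivalent)
  also have "\<dots> \<longleftrightarrow> integrable cZ f" by (rule abs_summable_on_def)
  finally show ?thesis .
qed

lemma integrable_cZ_bounded_sums:
  fixes f :: "int \<Rightarrow> real"
  assumes nn: "\<And>n. 0 \<le> f n" and b: "\<And>F. finite F \<Longrightarrow> (\<Sum>n\<in>F. f n) \<le> C"
  shows "integrable cZ f"
proof -
  have "f summable_on UNIV"
    by (rule nonneg_bdd_above_summable_on) (use nn b in \<open>auto simp: bdd_above_def\<close>)
  then show ?thesis by (simp only: summable_on_iff_integrable_cZ)
qed

lemma l2_iff: "u \<in> l2 \<longleftrightarrow> sqZ (\<lambda>n. fst (u n)) \<and> sqZ (\<lambda>n. snd (u n))"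
proof -
  let ?g = "\<lambda>n. (cmod (fst (u n)))\<^sup>2 + (cmod (snd (u n)))\<^sup>2"
  have "u \<in> l2 \<longleftrightarrow> integrable cZ ?g"
    by (simp only: l2_def mem_Collect_eq summable_on_iff_integrable_cZ)
  also have "\<dots> \<longleftrightarrow> sqZ (\<lambda>n. fst (u n)) \<and> sqZ (\<lambda>n. snd (u n))"
  proof
    assume i: "integrable cZ ?g"
    have "integrable cZ (\<lambda>n. (cmod (fst (u n)))\<^sup>2)" "integrable cZ (\<lambda>n. (cmod (snd (u n)))\<^sup>2)"
      by (rule Bochner_Integration.integrable_bound[OF i]; simp)+
    then show "sqZ (\<lambda>n. fst (u n)) \<and> sqZ (\<lambda>n. snd (u n))" by (simp add: sqint_def)
  qed (simp add: sqint_def)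
  finally show ?thesis .
qed

definition coord :: "(int \<Rightarrow> complex \<times> complex) \<Rightarrow> int \<times> bool \<Rightarrow> complex" where
  "coord v i = (if snd i then snd (v (fst i)) else fst (v (fst i)))"

definition ip :: "(int \<Rightarrow> complex \<times> complex) \<Rightarrow> (int \<Rightarrow> complex \<times> complex) \<Rightarrow> complex" where
  "ip v w = (\<integral>n. cnj (fst (v n)) * fst (w n) + cnj (snd (v n)) * snd (w n) \<partial>cZ)"

lemma ip_integrable:
  assumes "v \<in> l2" "w \<in> l2"
  shows "integrable cZ (\<lambda>n. cnj (fst (v n)) * fst (w n) + cnj (snd (v n)) * snd (w n))"
  using assms by (intro Bochner_Integration.integrable_add sqint_mult sqint_cnj) (auto simp: l2_iff)

lemma l2_inner_eq_ip: assumes "v \<in> l2" "w \<in> l2" shows "l2_inner v w = ip v w"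
proof -
  have "Infinite_Set_Sum.abs_summable_on (\<lambda>n. cnj (fst (v n)) * fst (w n) + cnj (snd (v n)) * snd (w n)) UNIV"
    using ip_integrable[OF assms] by (simp add: abs_summable_on_def)
  from infsetsum_infsum[OF this] show ?thesis
    unfolding l2_inner_def ip_def infsetsum_def by simp
qed

text \<open>A crude bound for the sum of the component norms: hopping costs 2 and each entry of V at
  most |lam|. It serves to confine the support of the spectral measure.\<close>

lemma l2_S:
  assumes "u \<in> l2" shows "S_op lam alpha omega u \<in> l2"
    and "l2n cZ (\<lambda>n. fst (S_op lam alpha omega u n)) + l2n cZ (\<lambda>n. snd (S_op lam alpha omega u n))
      \<le> (2 + 2 * \<bar>lam\<bar>) * (l2n cZ (\<lambda>n. fst (u n)) + l2n cZ (\<lambda>n. snd (u n)))"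
proof -
  define a b where "a n = fst (u n)" and "b n = snd (u n)" for n
  have ab: "sqZ a" "sqZ b" using assms by (simp_all add: l2_iff a_def[abs_def] b_def[abs_def])
  define th where "th n = 2 * pi * (omega + 2 * real_of_int n * alpha)" for n :: int
  have trig: "sqZ (\<lambda>n. of_real (g (th n)) * f n) \<and> l2n cZ (\<lambda>n. of_real (g (th n)) * f n) \<le> l2n cZ f"
    if f: "sqZ f" and g: "\<And>x. \<bar>g x\<bar> \<le> 1" for g :: "real \<Rightarrow> real" and f
  proof (intro conjI)
    have le: "cmod (of_real (g (th n)) * f n) \<le> cmod (f n)" for n
      using mult_right_mono[OF g[of "th n"], of "cmod (f n)"] by (simp add: norm_mult)
    show "sqZ (\<lambda>n. of_real (g (th n)) * f n)" "l2n cZ (\<lambda>n. of_real (g (th n)) * f n) \<le> l2n cZ f"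
      by (rule sqint_bound[OF f]; use le in auto)+
  qed
  define ca sa cb sb where "ca n = of_real (cos (th n)) * a n" and "sa n = of_real (sin (th n)) * a n"
    and "cb n = of_real (cos (th n)) * b n" and "sb n = of_real (sin (th n)) * b n" for n
  have s: "sqZ ca" "sqZ sa" "sqZ cb" "sqZ sb"
    and le: "l2n cZ ca \<le> l2n cZ a" "l2n cZ sa \<le> l2n cZ a" "l2n cZ cb \<le> l2n cZ b" "l2n cZ sb \<le> l2n cZ b"
    using trig[OF ab(1), of cos] trig[OF ab(1), of sin] trig[OF ab(2), of cos] trig[OF ab(2), of sin]
    by (simp_all add: ca_def[abs_def] sa_def[abs_def] cb_def[abs_def] sb_def[abs_def])
  have F: "(\<lambda>n. fst (S_op lam alpha omega u n)) = (\<lambda>n. (a (n + 1) + a (n + -1)) + of_real lam * (ca n + \<i> * sb n))"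
    by (auto simp: S_op_def Let_def a_def b_def ca_def sb_def th_def fun_eq_iff mult_ac)
  have G: "(\<lambda>n. snd (S_op lam alpha omega u n)) = (\<lambda>n. of_real lam * ((- \<i>) * sa n + (-1) * cb n))"
    by (auto simp: S_op_def Let_def a_def b_def sa_def cb_def th_def fun_eq_iff mult_ac)
  note sh = sqZ_shift[OF ab(1), of 1] sqZ_shift[OF ab(1), of "-1"]
  have sF: "sqZ (\<lambda>n. fst (S_op lam alpha omega u n))" and sG: "sqZ (\<lambda>n. snd (S_op lam alpha omega u n))"
    unfolding F G by (intro sqint_add sqint_cmult sh s)+
  then show "S_op lam alpha omega u \<in> l2" by (simp add: l2_iff)
  have tl: "l2n cZ (\<lambda>n. a (n + 1) + a (n + -1)) \<le> l2n cZ a + l2n cZ a"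
    using l2n_triangle[OF sh] by (simp only: l2n_shift)
  have ti: "l2n cZ (\<lambda>n. ca n + \<i> * sb n) \<le> l2n cZ a + l2n cZ b"
    using l2n_triangle[OF s(1) sqint_cmult[OF s(4), of \<i>]] le unfolding l2n_cmult by simp
  have tj: "l2n cZ (\<lambda>n. (- \<i>) * sa n + (-1) * cb n) \<le> l2n cZ a + l2n cZ b"
    using l2n_triangle[OF sqint_cmult[OF s(2), of "-\<i>"] sqint_cmult[OF s(3), of "-1"]] le unfolding l2n_cmult by simp
  have "l2n cZ (\<lambda>n. fst (S_op lam alpha omega u n)) \<le> (l2n cZ a + l2n cZ a) + \<bar>lam\<bar> * (l2n cZ a + l2n cZ b)"
  proof -
    have "l2n cZ (\<lambda>n. fst (S_op lam alpha omega u n)) \<le> l2n cZ (\<lambda>n. a (n + 1) + a (n + -1)) + l2n cZ (\<lambda>n. of_real lam * (ca n + \<i> * sb n))"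
      unfolding F by (intro l2n_triangle sqint_add sqint_cmult sh s)
    also have "\<dots> \<le> (l2n cZ a + l2n cZ a) + \<bar>lam\<bar> * (l2n cZ a + l2n cZ b)"
      unfolding l2n_cmult norm_of_real using tl ti by (intro add_mono mult_left_mono) auto
    finally show ?thesis .
  qed
  moreover have "l2n cZ (\<lambda>n. snd (S_op lam alpha omega u n)) \<le> \<bar>lam\<bar> * (l2n cZ a + l2n cZ b)"
    unfolding G l2n_cmult norm_of_real using tj by (intro mult_left_mono) auto
  ultimately have "l2n cZ (\<lambda>n. fst (S_op lam alpha omega u n)) + l2n cZ (\<lambda>n. snd (S_op lam alpha omega u n))
      \<le> ((l2n cZ a + l2n cZ a) + \<bar>lam\<bar> * (l2n cZ a + l2n cZ b)) + \<bar>lam\<bar> * (l2n cZ a + l2n cZ b)"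
    by (rule add_mono)
  also have "\<dots> \<le> (2 + 2 * \<bar>lam\<bar>) * (l2n cZ a + l2n cZ b)"
    by (simp add: algebra_simps)
  finally show "l2n cZ (\<lambda>n. fst (S_op lam alpha omega u n)) + l2n cZ (\<lambda>n. snd (S_op lam alpha omega u n))
      \<le> (2 + 2 * \<bar>lam\<bar>) * (l2n cZ (\<lambda>n. fst (u n)) + l2n cZ (\<lambda>n. snd (u n)))"
    by (simp only: a_def[abs_def] b_def[abs_def])
qed

text \<open>V is Hermitian site by site, so only hopping terms remain, and these cancel in pairs
  under a shift of the summation index.\<close>

lemma ip_S_sym:
  assumes v: "v \<in> l2" and w: "w \<in> l2"
  shows "ip v (S_op lam alpha omega w) = ip (S_op lam alpha omega v) w"
proof -
  define h k where "h n = cnj (fst (v (n - 1))) * fst (w n)" and "k n = cnj (fst (v n)) * fst (w (n - 1))" for n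
  have sv: "sqZ (\<lambda>n. fst (v n))" "sqZ (\<lambda>n. fst (w n))" using v w by (auto simp: l2_iff)
  have hi: "integrable cZ h" and ki: "integrable cZ k"
    unfolding h_def k_def using sv by (auto intro!: sqint_mult sqint_cnj sqZ_shift')
  have hi': "integrable cZ (\<lambda>n. h (n + 1))" and ki': "integrable cZ (\<lambda>n. k (n + 1))"
    using hi ki by (simp_all add: integrable_cZ_shift)
  have "ip v (S_op lam alpha omega w) - ip (S_op lam alpha omega v) w = (\<integral>n. (h (n + 1) - h n) + (k n - k (n + 1)) \<partial>cZ)"
    unfolding ip_def
  proof (subst Bochner_Integration.integral_diff[symmetric, OF ip_integrable[OF v l2_S(1)[OF w]] ip_integrable[OF l2_S(1)[OF v] w]],
      rule Bochner_Integration.integral_cong[OF refl])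
    fix n
    show "cnj (fst (v n)) * fst (S_op lam alpha omega w n) + cnj (snd (v n)) * snd (S_op lam alpha omega w n) -
         (cnj (fst (S_op lam alpha omega v n)) * fst (w n) + cnj (snd (S_op lam alpha omega v n)) * snd (w n)) =
         h (n + 1) - h n + (k n - k (n + 1))"
      by (simp add: S_op_def Let_def h_def k_def algebra_simps)
  qed
  also have "\<dots> = 0"
    using hi ki hi' ki' by (simp add: integral_cZ_shift)
  finally show ?thesis by simp
qed

locale spectral_setting =
  fixes lam alpha omega :: real and u :: "int \<Rightarrow> complex \<times> complex" and \<mu> :: "real measure"
  assumes u: "u \<in> l2" and spec: "is_spectral_measure (S_op lam alpha omega) u \<mu>"
begin

abbreviation S where "S \<equiv> S_op lam alpha omega"

definition \<rho> :: real where "\<rho> = 2 + 2 * \<bar>lam\<bar>"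

lemma sets_mu: "sets \<mu> = sets borel" and fin_mu: "finite_measure \<mu>"
  using spec by (auto simp: is_spectral_measure_def)

definition v :: "nat \<Rightarrow> int \<Rightarrow> complex \<times> complex" where "v k = (S ^^ k) u"

lemma v_Suc: "v (Suc k) = S (v k)" by (simp add: v_def)

lemma v_l2: "v k \<in> l2"
  by (induction k) (auto simp: v_Suc l2_S(1), simp add: v_def u)

lemma moment: "integrable \<mu> (\<lambda>x. x ^ k)" "complex_of_real (\<integral>x. x ^ k \<partial>\<mu>) = ip (v 0) (v k)"
proof -
  show "integrable \<mu> (\<lambda>x. x ^ k)" using spec by (auto simp: is_spectral_measure_def)
  have "complex_of_real (\<integral>x. x ^ k \<partial>\<mu>) = l2_inner u ((S ^^ k) u)"
    using spec by (simp add: is_spectral_measure_def)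
  then show "complex_of_real (\<integral>x. x ^ k \<partial>\<mu>) = ip (v 0) (v k)"
    using l2_inner_eq_ip[OF v_l2[of 0] v_l2[of k]] by (simp add: v_def)
qed

text \<open>Symmetry moves all powers of S to one side, so the Gram matrix of the Krylov vectors is
  the Hankel matrix of the moments.\<close>

lemma ip_v: "ip (v j) (v k) = complex_of_real (\<integral>x. x ^ (j + k) \<partial>\<mu>)"
proof (induction j arbitrary: k)
  case 0 show ?case by (simp add: moment(2))
next
  case (Suc j)
  have "ip (v (Suc j)) (v k) = ip (v j) (v (Suc k))"
    unfolding v_Suc by (rule ip_S_sym[symmetric]) (rule v_l2)+
  also have "\<dots> = complex_of_real (\<integral>x. x ^ (Suc j + k) \<partial>\<mu>)" using Suc[of "Suc k"] by simp
  finally show ?case .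
qed

lemma ip_self:
  assumes "w \<in> l2" shows "ip w w = complex_of_real ((l2n cZ (\<lambda>n. fst (w n)))\<^sup>2 + (l2n cZ (\<lambda>n. snd (w n)))\<^sup>2)"
proof -
  have s: "integrable cZ (\<lambda>n. (cmod (fst (w n)))\<^sup>2)" "integrable cZ (\<lambda>n. (cmod (snd (w n)))\<^sup>2)"
    using assms by (auto simp: l2_iff sqint_def)
  have "ip w w = (\<integral>n. complex_of_real ((cmod (fst (w n)))\<^sup>2 + (cmod (snd (w n)))\<^sup>2) \<partial>cZ)"
    unfolding ip_def by (intro Bochner_Integration.integral_cong) (auto simp: complex_norm_square mult.commute simp del: of_real_power)
  also have "\<dots> = complex_of_real (\<integral>n. (cmod (fst (w n)))\<^sup>2 + (cmod (snd (w n)))\<^sup>2 \<partial>cZ)" by (rule integral_complex_of_real)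
  finally show ?thesis using s by (simp add: l2n_power2)
qed

definition norm_sum where "norm_sum w = l2n cZ (\<lambda>n. fst (w n)) + l2n cZ (\<lambda>n. snd (w n))" for w :: "int \<Rightarrow> complex \<times> complex"

lemma norm_sum_v: "norm_sum (v k) \<le> \<rho> ^ k * norm_sum u"
proof (induction k)
  case 0 show ?case by (simp add: v_def)
next
  case (Suc k)
  have "norm_sum (v (Suc k)) \<le> \<rho> * norm_sum (v k)" unfolding v_Suc norm_sum_def \<rho>_def by (rule l2_S(2)[OF v_l2])
  also have "\<dots> \<le> \<rho> * (\<rho> ^ k * norm_sum u)" using Suc by (intro mult_left_mono) (auto simp: \<rho>_def)
  finally show ?case by (simp add: mult_ac)
qed

lemma even_moment: "(\<integral>x. x ^ (2 * k) \<partial>\<mu>) \<le> (\<rho> ^ k * norm_sum u)\<^sup>2"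
proof -
  have "complex_of_real (\<integral>x. x ^ (2 * k) \<partial>\<mu>) = ip (v k) (v k)" by (simp add: ip_v mult_2)
  then have "(\<integral>x. x ^ (2 * k) \<partial>\<mu>) = (l2n cZ (\<lambda>n. fst (v k n)))\<^sup>2 + (l2n cZ (\<lambda>n. snd (v k n)))\<^sup>2"
    unfolding ip_self[OF v_l2] by (simp only: of_real_eq_iff)
  also have "\<dots> \<le> (norm_sum (v k))\<^sup>2" by (simp add: norm_sum_def power2_sum)
  also have "\<dots> \<le> (\<rho> ^ k * norm_sum u)\<^sup>2" by (intro power_mono norm_sum_v) (simp add: norm_sum_def)
  finally show ?thesis .
qed

text \<open>Even moments grow at most like powers of \<rho>^2, so Markov's inequality for x^(2k)
  gives |x| >= r a mass bounded by a geometric sequence in k whenever r > \<rho>. Then r decreases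
  to \<rho> along a sequence.\<close>

lemma support_mu: "AE x in \<mu>. \<bar>x\<bar> \<le> \<rho>"
proof -
  interpret finite_measure \<mu> by (rule fin_mu)
  have \<rho>0: "\<rho> > 0" by (simp add: \<rho>_def)
  have r: "AE x in \<mu>. \<bar>x\<bar> < r" if r: "r > \<rho>" for r
  proof -
    have r0: "r > 0" using r \<rho>0 by simp
    have mset: "{x \<in> space \<mu>. r \<le> \<bar>x\<bar>} \<in> sets \<mu>" unfolding sets_mu sets_eq_imp_space_eq[OF sets_mu] by measurable
    have "measure \<mu> {x \<in> space \<mu>. r \<le> \<bar>x\<bar>} \<le> ((\<rho> / r)\<^sup>2) ^ k * (norm_sum u)\<^sup>2" for k
    proof -
      have "emeasure \<mu> {x \<in> space \<mu>. r ^ (2 * k) \<le> x ^ (2 * k)} \<le> (1 / r ^ (2 * k)) * (\<integral>x. x ^ (2 * k) \<partial>\<mu>)"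
        by (rule integral_Markov_inequality[OF moment(1)]) (use r0 in auto)
      moreover have "{x \<in> space \<mu>. r \<le> \<bar>x\<bar>} \<subseteq> {x \<in> space \<mu>. r ^ (2 * k) \<le> x ^ (2 * k)}"
      proof safe
        fix x :: real assume "r \<le> \<bar>x\<bar>"
        then have "r ^ (2 * k) \<le> \<bar>x\<bar> ^ (2 * k)" using r0 by (intro power_mono) auto
        then show "r ^ (2 * k) \<le> x ^ (2 * k)" by (simp add: power_even_abs)
      qed
      moreover have "{x \<in> space \<mu>. r ^ (2 * k) \<le> x ^ (2 * k)} \<in> sets \<mu>"
        unfolding sets_mu sets_eq_imp_space_eq[OF sets_mu] by measurable
      ultimately have "emeasure \<mu> {x \<in> space \<mu>. r \<le> \<bar>x\<bar>} \<le> (1 / r ^ (2 * k)) * (\<integral>x. x ^ (2 * k) \<partial>\<mu>)"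
        by (meson emeasure_mono order_trans)
      then have "measure \<mu> {x \<in> space \<mu>. r \<le> \<bar>x\<bar>} \<le> (1 / r ^ (2 * k)) * (\<integral>x. x ^ (2 * k) \<partial>\<mu>)"
        using r0 by (simp add: emeasure_eq_measure ennreal_le_iff)
      also have "\<dots> \<le> (1 / r ^ (2 * k)) * (\<rho> ^ k * norm_sum u)\<^sup>2"
        using r0 by (intro mult_left_mono even_moment) auto
      also have "\<dots> = ((\<rho> / r)\<^sup>2) ^ k * (norm_sum u)\<^sup>2"
        by (simp add: power_mult_distrib power_divide power_mult[symmetric] mult.commute)
      finally show ?thesis .
    qed
    moreover have "(\<lambda>k. ((\<rho> / r)\<^sup>2) ^ k * (norm_sum u)\<^sup>2) \<longlonglongrightarrow> 0 * (norm_sum u)\<^sup>2"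
      by (intro tendsto_mult LIMSEQ_realpow_zero tendsto_const) (use r \<rho>0 in \<open>auto simp: power_less_one_iff\<close>)
    ultimately have "measure \<mu> {x \<in> space \<mu>. r \<le> \<bar>x\<bar>} \<le> 0"
      by (intro LIMSEQ_le_const[of _ 0]) auto
    then have "emeasure \<mu> {x \<in> space \<mu>. r \<le> \<bar>x\<bar>} = 0"
      by (simp add: emeasure_eq_measure measure_le_0_iff)
    then show ?thesis
      by (intro AE_I[where N = "{x \<in> space \<mu>. r \<le> \<bar>x\<bar>}"]) (use mset in auto)
  qed
  have "AE x in \<mu>. \<forall>n::nat. \<bar>x\<bar> < \<rho> + 1 / real (Suc n)"
    unfolding AE_all_countable by (intro allI r) simp
  then show ?thesis
  proof eventually_elim
    case (elim x)
    show ?case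
    proof (rule ccontr)
      assume "\<not> \<bar>x\<bar> \<le> \<rho>"
      then obtain n where "inverse (real (Suc n)) < \<bar>x\<bar> - \<rho>" using reals_Archimedean[of "\<bar>x\<bar> - \<rho>"] by auto
      then show False using elim[rule_format, of n] by (simp add: inverse_eq_divide)
    qed
  qed
qed

sublocale compact_measure \<mu> \<rho>
proof -
  interpret finite_measure \<mu> by (rule fin_mu)
  show "compact_measure \<mu> \<rho>" by unfold_locales (auto simp: sets_mu support_mu)
qed

text \<open>The vector p(S)u, written through Krylov vectors.\<close>

definition VV :: "complex poly \<Rightarrow> int \<Rightarrow> complex \<times> complex" where
  "VV p n = ((\<Sum>k\<le>degree p. coeff p k * fst (v k n)), (\<Sum>k\<le>degree p. coeff p k * snd (v k n)))"

lemma VV_bound: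
  assumes "degree p \<le> N"
  shows "fst (VV p n) = (\<Sum>k\<le>N. coeff p k * fst (v k n))" "snd (VV p n) = (\<Sum>k\<le>N. coeff p k * snd (v k n))"
  unfolding VV_def fst_conv snd_conv
  by (rule sum.mono_neutral_left; use assms in \<open>auto simp: coeff_eq_0\<close>)+

lemma VV_add: "fst (VV (p + q) n) = fst (VV p n) + fst (VV q n)" "snd (VV (p + q) n) = snd (VV p n) + snd (VV q n)"
proof -
  define N where "N = max (degree p) (degree q)"
  have "degree (p + q) \<le> N" unfolding N_def by (rule degree_add_le_max)
  note b = VV_bound[OF this, of n] VV_bound[of p N n] VV_bound[of q N n]
  show "fst (VV (p + q) n) = fst (VV p n) + fst (VV q n)" "snd (VV (p + q) n) = snd (VV p n) + snd (VV q n)"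
    using b by (simp_all add: N_def sum.distrib distrib_right)
qed

lemma VV_smult: "fst (VV (smult c p) n) = c * fst (VV p n)" "snd (VV (smult c p) n) = c * snd (VV p n)"
  using VV_bound[OF degree_smult_le[of c p], of n] by (simp_all add: VV_def sum_distrib_left mult.assoc)

lemma VV_l2: "VV p \<in> l2"
  using v_l2 by (auto simp: VV_def l2_iff intro!: sqint_sum sqint_cmult)

lemma VV_x: "VV (pCons 0 p) = S (VV p)"
proof
  fix n
  define N where "N = degree p"
  have d: "degree (pCons 0 p) \<le> Suc N" by (simp add: N_def degree_pCons_le)
  have f: "fst (VV p m) = (\<Sum>k\<le>N. coeff p k * fst (v k m))" "snd (VV p m) = (\<Sum>k\<le>N. coeff p k * snd (v k m))" for m
    by (simp_all add: VV_def N_def)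
  have "fst (VV (pCons 0 p) n) = (\<Sum>k\<le>N. coeff p k * fst (S (v k) n))"
    unfolding VV_bound(1)[OF d] sum.atMost_Suc_shift by (simp add: v_Suc)
  also have "\<dots> = fst (S (VV p) n)"
    by (simp add: S_op_def Let_def f sum_distrib_left sum.distrib algebra_simps)
  finally have 1: "fst (VV (pCons 0 p) n) = fst (S (VV p) n)" .
  have "snd (VV (pCons 0 p) n) = (\<Sum>k\<le>N. coeff p k * snd (S (v k) n))"
    unfolding VV_bound(2)[OF d] sum.atMost_Suc_shift by (simp add: v_Suc)
  also have "\<dots> = snd (S (VV p) n)"
    by (simp add: S_op_def Let_def f sum_distrib_left sum_subtractf sum_negf algebra_simps)
  finally show "VV (pCons 0 p) n = S (VV p) n" using 1 by (simp add: prod_eq_iff)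
qed

text \<open>The isometry p -> p(S)u: both sides are the same quadratic form in the coefficients of
  p, with the moments as matrix.\<close>

lemma VV_norm: "(l2n \<mu> (pev p))\<^sup>2 = (\<integral>n. (cmod (fst (VV p n)))\<^sup>2 + (cmod (snd (VV p n)))\<^sup>2 \<partial>cZ)"
proof -
  define N where "N = degree p"
  have mi: "integrable \<mu> (\<lambda>x. complex_of_real (x ^ k))" for k
    unfolding complex_of_real_integrable_eq by (rule moment(1))
  have "complex_of_real ((l2n \<mu> (pev p))\<^sup>2) = (\<integral>x. cnj (pev p x) * pev p x \<partial>\<mu>)"
    unfolding l2n_power2 integral_complex_of_real[symmetric]
    by (intro Bochner_Integration.integral_cong) (auto simp: complex_norm_square mult.commute simp del: of_real_power)
  also have "\<dots> = (\<integral>x. (\<Sum>j\<le>N. \<Sum>k\<le>N. (cnj (coeff p j) * coeff p k) * complex_of_real (x ^ (j + k))) \<partial>\<mu>)"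
  proof (intro Bochner_Integration.integral_cong refl)
    fix x
    have 1: "cnj (pev p x) = (\<Sum>j\<le>N. cnj (coeff p j) * of_real x ^ j)" by (simp add: poly_altdef N_def)
    have 2: "pev p x = (\<Sum>k\<le>N. coeff p k * of_real x ^ k)" by (simp add: poly_altdef N_def)
    have "cnj (pev p x) * pev p x = (\<Sum>j\<le>N. cnj (coeff p j) * of_real x ^ j) * (\<Sum>k\<le>N. coeff p k * of_real x ^ k)"
      by (rule arg_cong2[OF 1 2])
    also have "\<dots> = (\<Sum>j\<le>N. \<Sum>k\<le>N. (cnj (coeff p j) * coeff p k) * complex_of_real (x ^ (j + k)))"
      unfolding sum_product by (intro sum.cong refl) (simp add: power_add mult_ac)
    finally show "cnj (pev p x) * pev p x = (\<Sum>j\<le>N. \<Sum>k\<le>N. (cnj (coeff p j) * coeff p k) * complex_of_real (x ^ (j + k)))" .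
  qed
  also have "\<dots> = (\<Sum>j\<le>N. \<Sum>k\<le>N. (cnj (coeff p j) * coeff p k) * complex_of_real (\<integral>x. x ^ (j + k) \<partial>\<mu>))"
    using mi by (simp only: Bochner_Integration.integral_sum Bochner_Integration.integrable_sum integrable_mult_right integral_mult_right_zero integral_complex_of_real)
  also have "\<dots> = (\<Sum>j\<le>N. \<Sum>k\<le>N. (cnj (coeff p j) * coeff p k) * ip (v j) (v k))" by (simp only: ip_v)
  also have "\<dots> = (\<integral>n. (\<Sum>j\<le>N. \<Sum>k\<le>N. (cnj (coeff p j) * coeff p k) * (cnj (fst (v j n)) * fst (v k n) + cnj (snd (v j n)) * snd (v k n))) \<partial>cZ)"
    unfolding ip_def using ip_integrable[OF v_l2 v_l2]
    by (simp only: Bochner_Integration.integral_sum Bochner_Integration.integrable_sum integrable_mult_right integral_mult_right_zero)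
  also have "\<dots> = ip (VV p) (VV p)"
    unfolding ip_def VV_def fst_conv snd_conv N_def[symmetric]
    by (intro Bochner_Integration.integral_cong refl) (simp only: cnj_sum complex_cnj_mult sum_product sum.distrib[symmetric], intro sum.cong refl, simp add: algebra_simps)
  also have "\<dots> = complex_of_real (\<integral>n. (cmod (fst (VV p n)))\<^sup>2 + (cmod (snd (VV p n)))\<^sup>2 \<partial>cZ)"
    unfolding ip_def integral_complex_of_real[symmetric]
    by (intro Bochner_Integration.integral_cong) (auto simp: complex_norm_square mult.commute simp del: of_real_power)
  finally show ?thesis by (simp only: of_real_eq_iff)
qed

lemma VV_int: "integrable cZ (\<lambda>n. (cmod (fst (VV p n)))\<^sup>2 + (cmod (snd (VV p n)))\<^sup>2)"
  using VV_l2[of p] by (auto simp: l2_iff sqint_def)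

lemma sum_coord: "(\<Sum>i\<in>A \<times> UNIV. (cmod (coord w i))\<^sup>2) = (\<Sum>n\<in>A. (cmod (fst (w n)))\<^sup>2 + (cmod (snd (w n)))\<^sup>2)"
proof -
  have "(\<Sum>i\<in>A \<times> UNIV. (cmod (coord w i))\<^sup>2) = (\<Sum>n\<in>A. \<Sum>b\<in>UNIV. (cmod (coord w (n, b)))\<^sup>2)"
    by (simp add: sum.cartesian_product)
  then show ?thesis by (simp add: coord_def UNIV_bool add.commute)
qed

lemma VV_bessel: assumes "finite F" shows "(\<Sum>i\<in>F. (cmod (coord (VV p) i))\<^sup>2) \<le> (l2n \<mu> (pev p))\<^sup>2"
proof -
  have "(\<Sum>i\<in>F. (cmod (coord (VV p) i))\<^sup>2) \<le> (\<Sum>i\<in>fst ` F \<times> UNIV. (cmod (coord (VV p) i))\<^sup>2)"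
    using assms by (intro sum_mono2) force+
  also have "\<dots> \<le> (l2n \<mu> (pev p))\<^sup>2"
    unfolding sum_coord VV_norm by (rule sum_le_integral_cZ[OF _ VV_int]) (use assms in auto)
  finally show ?thesis .
qed

lemma VV_parseval: assumes "e > 0" shows "\<exists>F. finite F \<and> (l2n \<mu> (pev p))\<^sup>2 - (\<Sum>i\<in>F. (cmod (coord (VV p) i))\<^sup>2) < e"
proof -
  have "(\<lambda>N. \<Sum>n\<in>{- int N..int N}. (cmod (fst (VV p n)))\<^sup>2 + (cmod (snd (VV p n)))\<^sup>2) \<longlonglongrightarrow> (l2n \<mu> (pev p))\<^sup>2"
    unfolding VV_norm by (rule sum_tendsto_integral_cZ[OF VV_int])
  from order_tendstoD(1)[OF this, of "(l2n \<mu> (pev p))\<^sup>2 - e"] assms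
  obtain N where "(l2n \<mu> (pev p))\<^sup>2 - e < (\<Sum>n\<in>{- int N..int N}. (cmod (fst (VV p n)))\<^sup>2 + (cmod (snd (VV p n)))\<^sup>2)"
    by (auto simp: eventually_sequentially)
  then show ?thesis
    unfolding sum_coord[symmetric] by (intro exI[of _ "{- int N..int N} \<times> UNIV"]) auto
qed

lemma ex_kernel:
  "\<exists>\<Phi>. spectral_kernel \<mu> \<rho> \<Phi> \<and> (\<forall>p i. coord (VV p) i = (\<integral>x. pev p x * \<Phi> i x \<partial>\<mu>))"
proof -
  have "\<exists>\<Phi>. \<forall>i. pl2 (\<Phi> i) \<and> (\<forall>p. coord (VV p) i = (\<integral>x. pev p x * \<Phi> i x \<partial>\<mu>))"
    by (rule kernel_exists) (auto simp: coord_def VV_add VV_smult intro: VV_bessel[unfolded coord_def])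
  then obtain \<Phi> where \<Phi>: "\<And>i. pl2 (\<Phi> i)" "\<And>p i. coord (VV p) i = (\<integral>x. pev p x * \<Phi> i x \<partial>\<mu>)" by blast
  have "spectral_kernel \<mu> \<rho> \<Phi>"
    by unfold_locales (use \<Phi> VV_bessel VV_parseval in \<open>auto simp flip: \<Phi>(2)\<close>)
  then show ?thesis using \<Phi> by blast
qed

end

section \<open>Absence of atoms and of an absolutely continuous part\<close>

context spectral_setting
begin

text \<open>Multiplying p by x corresponds to applying S to p(S)u. Hence the defect of the
  eigenvalue equation is orthogonal to all polynomials and, lying in \<open>pl2\<close>, vanishes
  almost everywhere; there are countably many sites.\<close>

lemma ex_kernel_rec:
  "\<exists>\<Phi>. spectral_kernel \<mu> \<rho> \<Phi> \<and>
     (AE x in \<mu>. \<forall>n. S (vec \<Phi> x) n = (of_real x * \<Phi> (n, False) x, of_real x * \<Phi> (n, True) x))"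
proof -
  obtain \<Phi> where sk: "spectral_kernel \<mu> \<rho> \<Phi>" and V: "\<And>p i. coord (VV p) i = (\<integral>x. pev p x * \<Phi> i x \<partial>\<mu>)"
    using ex_kernel by blast
  interpret spectral_kernel \<mu> \<rho> \<Phi> by (rule sk)
  have zero: "AE x in \<mu>. f x = 0" if f: "pl2 f" and "\<And>p. (\<integral>x. pev p x * f x \<partial>\<mu>) = 0" for f
  proof -
    have "l2n \<mu> f \<le> 0" by (rule pl2_norm_bound[OF f]) (use that in auto)
    then have "l2n \<mu> f = 0" using l2n_nonneg[of \<mu> f] by linarith
    then show ?thesis by (rule l2n_eq_0_AE[OF pl2_sqint[OF f]])
  qed
  have pi: "integrable \<mu> (\<lambda>x. pev p x * \<Phi> i x)" for p i by (rule sqint_mult[OF sqint_pev sqint_\<Phi>])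
  have "AE x in \<mu>. S (vec \<Phi> x) n = (of_real x * \<Phi> (n, False) x, of_real x * \<Phi> (n, True) x)" for n
  proof -
    define c where "c = complex_of_real lam * complex_of_real (cos (2 * pi * (omega + 2 * real_of_int n * alpha)))"
    define s where "s = complex_of_real lam * (\<i> * complex_of_real (sin (2 * pi * (omega + 2 * real_of_int n * alpha))))"
    let ?f = "\<lambda>x. (\<Phi> (n + 1, False) x + \<Phi> (n - 1, False) x + (c * \<Phi> (n, False) x + s * \<Phi> (n, True) x)) - of_real x * \<Phi> (n, False) x"
    let ?g = "\<lambda>x. ((- s) * \<Phi> (n, False) x + (- c) * \<Phi> (n, True) x) - of_real x * \<Phi> (n, True) x"
    have Sf: "fst (S w n) = fst (w (n + 1)) + fst (w (n - 1)) + (c * fst (w n) + s * snd (w n))"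
      and Sg: "snd (S w n) = (- s) * fst (w n) + (- c) * snd (w n)" for w
      by (simp_all add: S_op_def Let_def c_def s_def algebra_simps)
    have "AE x in \<mu>. ?f x = 0"
    proof (rule zero)
      show "pl2 ?f" by (intro pl2_diff pl2_add pl2_cmult pl2_xmult pl2_\<Phi>)
      fix p
      have "(\<integral>x. pev p x * ?f x \<partial>\<mu>) = (\<integral>x. (pev p x * \<Phi> (n + 1, False) x + pev p x * \<Phi> (n - 1, False) x + (c * (pev p x * \<Phi> (n, False) x) + s * (pev p x * \<Phi> (n, True) x))) - pev (pCons 0 p) x * \<Phi> (n, False) x \<partial>\<mu>)"
        by (intro Bochner_Integration.integral_cong) (auto simp: algebra_simps)
      also have "\<dots> = (coord (VV p) (n + 1, False) + coord (VV p) (n - 1, False) + (c * coord (VV p) (n, False) + s * coord (VV p) (n, True))) - coord (VV (pCons 0 p)) (n, False)"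
        unfolding V
        by (simp only: Bochner_Integration.integral_add Bochner_Integration.integral_diff Bochner_Integration.integrable_add integrable_mult_right integral_mult_right_zero pi)
      also have "\<dots> = 0" unfolding VV_x by (simp add: coord_def Sf)
      finally show "(\<integral>x. pev p x * ?f x \<partial>\<mu>) = 0" .
    qed
    moreover have "AE x in \<mu>. ?g x = 0"
    proof (rule zero)
      show "pl2 ?g" by (intro pl2_diff pl2_add pl2_cmult pl2_xmult pl2_\<Phi>)
      fix p
      have "(\<integral>x. pev p x * ?g x \<partial>\<mu>) = (\<integral>x. ((- s) * (pev p x * \<Phi> (n, False) x) + (- c) * (pev p x * \<Phi> (n, True) x)) - pev (pCons 0 p) x * \<Phi> (n, True) x \<partial>\<mu>)"
        by (intro Bochner_Integration.integral_cong) (auto simp: algebra_simps)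
      also have "\<dots> = ((- s) * coord (VV p) (n, False) + (- c) * coord (VV p) (n, True)) - coord (VV (pCons 0 p)) (n, True)"
        unfolding V
        by (simp only: Bochner_Integration.integral_add Bochner_Integration.integral_diff Bochner_Integration.integrable_add integrable_mult_right integral_mult_right_zero pi)
      also have "\<dots> = 0" unfolding VV_x by (simp add: coord_def Sg)
      finally show "(\<integral>x. pev p x * ?g x \<partial>\<mu>) = 0" .
    qed
    ultimately show ?thesis
      by eventually_elim (simp add: prod_eq_iff Sf Sg vec_def)
  qed
  then have "AE x in \<mu>. \<forall>n. S (vec \<Phi> x) n = (of_real x * \<Phi> (n, False) x, of_real x * \<Phi> (n, True) x)"
    unfolding AE_all_countable by blast
  with sk show ?thesis by blast
qed

lemma no_atoms:
  assumes irr: "alpha \<notin> \<rat>" and lam: "lam > 0"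
    and nonres: "\<forall>k::int. 2 * alpha * real_of_int k + 2 * omega \<notin> \<int>"
  shows "emeasure \<mu> {E} = 0"
proof (rule ccontr)
  assume nz: "emeasure \<mu> {E} \<noteq> 0"
  obtain \<Phi> where sk: "spectral_kernel \<mu> \<rho> \<Phi>"
    and rec: "AE x in \<mu>. \<forall>n. S (vec \<Phi> x) n = (of_real x * \<Phi> (n, False) x, of_real x * \<Phi> (n, True) x)"
    using ex_kernel_rec by blast
  interpret spectral_kernel \<mu> \<rho> \<Phi> by (rule sk)
  define m where "m = measure \<mu> {E}"
  have m: "m > 0" using nz by (simp add: m_def emeasure_eq_measure zero_less_measure_iff)
  \<comment> \<open>What holds almost everywhere holds at a point of positive mass.\<close>
  have eig: "S (vec \<Phi> E) n = (of_real E * \<Phi> (n, False) E, of_real E * \<Phi> (n, True) E)" for n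
  proof (rule ccontr)
    assume neq: "\<not> ?thesis"
    from rec obtain N where N: "{x \<in> space \<mu>. \<not> (\<forall>n. S (vec \<Phi> x) n = (of_real x * \<Phi> (n, False) x, of_real x * \<Phi> (n, True) x))} \<subseteq> N"
       "emeasure \<mu> N = 0" "N \<in> sets \<mu>" by (auto elim: AE_E)
    have "E \<in> N" using N(1) neq sets_eq_imp_space_eq[OF sets_M] by auto
    then have "emeasure \<mu> {E} \<le> emeasure \<mu> N" by (intro emeasure_mono N) auto
    then show False using nz N by simp
  qed
  have ind: "pl2 (indicator {E})" by (rule pl2_indicator) simp
  have ii: "(\<integral>x. indicator {E} x * \<Phi> i x \<partial>\<mu>) = of_real m * \<Phi> i E" for i
  proof -
    have "(\<integral>x. indicator {E} x * \<Phi> i x \<partial>\<mu>) = (\<integral>x. indicator {E} x *\<^sub>R \<Phi> i E \<partial>\<mu>)"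
      by (intro Bochner_Integration.integral_cong) (auto simp: indicator_def)
    also have "\<dots> = (\<integral>x. indicator {E} x \<partial>\<mu>) *\<^sub>R \<Phi> i E"
      by (rule integral_scaleR_left, rule integrable_real_indicator) (simp_all add: emeasure_eq_measure)
    finally show ?thesis by (simp add: m_def sets_eq_imp_space_eq[OF sets_M] scaleR_conv_of_real)
  qed
  have li: "l2n \<mu> (indicator {E}) = sqrt m"
  proof -
    have "(\<integral>x. (cmod (indicator {E} x))\<^sup>2 \<partial>\<mu>) = (\<integral>x. indicator {E} x \<partial>\<mu>)"
      by (intro Bochner_Integration.integral_cong) (auto simp: indicator_def)
    then show ?thesis unfolding l2n_def by (simp add: m_def sets_eq_imp_space_eq[OF sets_M])
  qed
  \<comment> \<open>Bessel for the indicator of {E}: m^2 times the sum is at most m.\<close>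
  have bd: "(\<Sum>i\<in>F. (cmod (\<Phi> i E))\<^sup>2) \<le> 1 / m" if "finite F" for F
  proof -
    have "L2_set (\<lambda>i. cmod (of_real m * \<Phi> i E)) F \<le> sqrt m"
      using bessel[OF that pl2_sqint[OF ind]] unfolding ii li .
    then have "sqrt (\<Sum>i\<in>F. m\<^sup>2 * (cmod (\<Phi> i E))\<^sup>2) \<le> sqrt m"
      using m by (simp add: L2_set_def norm_mult power_mult_distrib)
    then have "m * (m * (\<Sum>i\<in>F. (cmod (\<Phi> i E))\<^sup>2)) \<le> m * 1"
      by (simp add: sum_distrib_left power2_eq_square mult.assoc)
    then have "m * (\<Sum>i\<in>F. (cmod (\<Phi> i E))\<^sup>2) \<le> 1" using m by (simp only: mult_le_cancel_left_pos)
    then show ?thesis using m by (simp add: le_divide_eq mult.commute)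
  qed
  have sq: "sqZ (\<lambda>n. \<Phi> (n, b) E)" for b
    unfolding sqint_def
  proof
    show "integrable cZ (\<lambda>n. (cmod (\<Phi> (n, b) E))\<^sup>2)"
    proof (rule integrable_cZ_bounded_sums)
      fix F :: "int set" assume F: "finite F"
      have "(\<Sum>n\<in>F. (cmod (\<Phi> (n, b) E))\<^sup>2) = (\<Sum>i\<in>(\<lambda>n. (n, b)) ` F. (cmod (\<Phi> i E))\<^sup>2)"
        by (subst sum.reindex) (auto simp: inj_on_def)
      also have "\<dots> \<le> 1 / m" using F by (intro bd) simp
      finally show "(\<Sum>n\<in>F. (cmod (\<Phi> (n, b) E))\<^sup>2) \<le> 1 / m" .
    qed simp
  qed simp
  have "((\<Phi> (n, False) E, \<Phi> (n, True) E) :: complex \<times> complex) = (0, 0)" for n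
    using no_eigenvector[OF irr lam nonres, of "vec \<Phi> E" E n] sq eig by (simp add: vec_def)
  then have z: "\<Phi> i E = 0" for i by (cases i; cases "snd i") auto
  \<comment> \<open>If \<Phi> vanishes at E, the whole expansion of the indicator is 0, although the
    indicator has norm sqrt m.\<close>
  have "sqrt m > 0" using m by simp
  from parseval[OF ind this] obtain F where "finite F"
    "l2n \<mu> (\<lambda>x. (\<Sum>i\<in>F. cnj (\<integral>y. indicator {E} y * \<Phi> i y \<partial>\<mu>) * \<Phi> i x) - cnj (indicator {E} x)) < sqrt m" by blast
  then have "l2n \<mu> (\<lambda>x. - cnj (indicator {E} x)) < sqrt m" unfolding ii z by simp
  moreover have "l2n \<mu> (\<lambda>x. - cnj (indicator {E} x)) = sqrt m"
    using li by (simp add: l2n_def)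
  ultimately show False by simp
qed

text \<open>Restrict the spectral measure to A and keep \<Phi>: the recursion and Bessel pass to the
  restriction, Parseval for the indicator of A becomes an expansion of 1, and
  \<open>ac_setting\<close> leaves no mass.\<close>

lemma ac_null:
  assumes irr: "alpha \<notin> \<rat>" and lam: "lam > 0" and c0: "c0 > 0" and K: "K > 0"
    and A: "A \<in> sets borel" "\<And>x. x \<in> A \<Longrightarrow> \<bar>x\<bar> \<le> lam \<and> c0 \<le> lam\<^sup>2 - x\<^sup>2"
    and lip: "\<And>B. B \<in> sets borel \<Longrightarrow> B \<subseteq> A \<Longrightarrow> emeasure \<mu> B \<le> ennreal K * emeasure lborel B"
  shows "emeasure \<mu> A = 0"
proof -
  obtain \<Phi> where sk: "spectral_kernel \<mu> \<rho> \<Phi>"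
    and rec: "AE x in \<mu>. \<forall>n. S (vec \<Phi> x) n = (of_real x * \<Phi> (n, False) x, of_real x * \<Phi> (n, True) x)"
    using ex_kernel_rec by blast
  interpret spectral_kernel \<mu> \<rho> \<Phi> by (rule sk)
  define \<nu> where "\<nu> = density \<mu> (\<lambda>x. ennreal (indicator A x))"
  have Am [measurable]: "A \<in> sets \<mu>" using A by simp
  have iA [measurable]: "(indicator A :: real \<Rightarrow> real) \<in> borel_measurable \<mu>" by measurable
  have sets_nu: "sets \<nu> = sets borel" by (simp add: \<nu>_def)
  have em: "emeasure \<nu> B = emeasure \<mu> (A \<inter> B)" if "B \<in> sets borel" for B
  proof -
    have "emeasure \<nu> B = (\<integral>\<^sup>+x. ennreal (indicator A x) * indicator B x \<partial>\<mu>)"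
      unfolding \<nu>_def by (rule emeasure_density) (use that in auto)
    also have "\<dots> = (\<integral>\<^sup>+x. indicator (A \<inter> B) x \<partial>\<mu>)"
      by (intro nn_integral_cong) (auto simp: indicator_def)
    also have "\<dots> = emeasure \<mu> (A \<inter> B)" using that by (intro nn_integral_indicator) auto
    finally show ?thesis .
  qed
  have meas: "f \<in> borel_measurable \<nu> \<longleftrightarrow> f \<in> borel_measurable \<mu>" for f :: "real \<Rightarrow> complex"
    by (intro measurable_cong_sets arg_cong2[where f = "(\<in>)"] refl) (simp add: measurable_cong_sets[of \<nu> \<mu>] sets_nu)
  have int: "(\<integral>x. f x \<partial>\<nu>) = (\<integral>x. indicator A x *\<^sub>R f x \<partial>\<mu>)" if "f \<in> borel_measurable \<mu>" for f :: "real \<Rightarrow> 'b :: {banach, second_countable_topology}"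
    unfolding \<nu>_def by (rule integral_density[OF that iA]) simp
  have intb: "integrable \<nu> f \<longleftrightarrow> integrable \<mu> (\<lambda>x. indicator A x *\<^sub>R f x)" if "f \<in> borel_measurable \<mu>" for f :: "real \<Rightarrow> real"
    unfolding \<nu>_def by (rule integrable_density[OF that iA]) simp
  have sqn: "sqint \<nu> f" "l2n \<nu> f \<le> l2n \<mu> f" if "sqint \<mu> f" for f
  proof -
    have fm [measurable]: "f \<in> borel_measurable \<mu>" and fi: "integrable \<mu> (\<lambda>x. (cmod (f x))\<^sup>2)" using that by (auto simp: sqint_def)
    have i: "integrable \<mu> (\<lambda>x. indicator A x *\<^sub>R (cmod (f x))\<^sup>2)"
      by (rule Bochner_Integration.integrable_bound[OF fi]) (auto simp: indicator_def)
    show "sqint \<nu> f" unfolding sqint_def using i by (simp add: meas fm intb)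
    have "(\<integral>x. (cmod (f x))\<^sup>2 \<partial>\<nu>) = (\<integral>x. indicator A x *\<^sub>R (cmod (f x))\<^sup>2 \<partial>\<mu>)" by (rule int) measurable
    also have "\<dots> \<le> (\<integral>x. (cmod (f x))\<^sup>2 \<partial>\<mu>)"
      by (rule integral_mono[OF i fi]) (auto simp: indicator_def)
    finally show "l2n \<nu> f \<le> l2n \<mu> f" unfolding l2n_def by (rule real_sqrt_le_mono)
  qed
  have AEn: "AE x in \<nu>. x \<in> A \<and> P x" if "AE x in \<mu>. P x" for P
    unfolding \<nu>_def
  proof (subst AE_density)
    show "AE x in \<mu>. 0 < ennreal (indicator A x) \<longrightarrow> x \<in> A \<and> P x"
      using that by eventually_elim (auto simp: indicator_def split: if_splits)
  qed measurable
  have wA: "(\<integral>y. \<Phi> i y \<partial>\<nu>) = (\<integral>y. indicator A y * \<Phi> i y \<partial>\<mu>)" for i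
  proof -
    have "(\<integral>y. \<Phi> i y \<partial>\<nu>) = (\<integral>y. indicator A y *\<^sub>R \<Phi> i y \<partial>\<mu>)"
      by (rule int) (use sqint_\<Phi>[of i] in \<open>simp add: sqint_def\<close>)
    also have "\<dots> = (\<integral>y. indicator A y * \<Phi> i y \<partial>\<mu>)"
      by (intro Bochner_Integration.integral_cong) (auto simp: indicator_def)
    finally show ?thesis .
  qed
  have recs: "AE x in \<nu>. x \<in> A \<and> (\<forall>n. S (vec \<Phi> x) n = (of_real x * \<Phi> (n, False) x, of_real x * \<Phi> (n, True) x))"
    by (rule AEn[OF rec])
  interpret F: finite_measure \<nu>
    by (rule finite_measureI) (use em[of UNIV] in \<open>simp add: sets_eq_imp_space_eq[OF sets_nu]\<close>)
  interpret N: ac_setting \<nu> K \<Phi> lam alpha omega c0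
  proof
    show "sets \<nu> = sets borel" by (rule sets_nu)
    show "K > 0" "alpha \<notin> \<rat>" "lam > 0" "c0 > 0" by fact+
    show "emeasure \<nu> B \<le> ennreal K * emeasure lborel B" if B: "B \<in> sets borel" for B
    proof -
      have "emeasure \<nu> B = emeasure \<mu> (A \<inter> B)" by (rule em[OF B])
      also have "\<dots> \<le> ennreal K * emeasure lborel (A \<inter> B)" using A B by (intro lip) auto
      also have "\<dots> \<le> ennreal K * emeasure lborel B" using B by (intro mult_left_mono emeasure_mono) auto
      finally show ?thesis .
    qed
    show "AE x in \<nu>. \<bar>x\<bar> \<le> lam \<and> c0 \<le> lam\<^sup>2 - x\<^sup>2" using recs by eventually_elim (use A in auto)
    show "sqint \<nu> (\<Phi> i)" for i by (rule sqn(1)[OF sqint_\<Phi>])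
    show "l2n \<nu> (\<lambda>x. \<Sum>i\<in>F. c i * \<Phi> i x) \<le> L2_set (\<lambda>i. cmod (c i)) F" if "finite F" for c F
      using sqn(2)[of "\<lambda>x. \<Sum>i\<in>F. c i * \<Phi> i x"] l2n_sum_\<Phi>[OF that, of c] by (fastforce intro: sqint_sum sqint_cmult)
    show "AE x in \<nu>. \<forall>n. S (vec \<Phi> x) n = (of_real x * \<Phi> (n, False) x, of_real x * \<Phi> (n, True) x)"
      using recs by eventually_elim simp
    fix e :: real assume e: "e > 0"
    have ind: "pl2 (indicator A)" by (rule pl2_indicator[OF A(1)])
    obtain F where F: "finite F" "\<And>F'. finite F' \<Longrightarrow> F \<subseteq> F' \<Longrightarrow>
       l2n \<mu> (\<lambda>x. (\<Sum>i\<in>F'. cnj (\<integral>y. indicator A y * \<Phi> i y \<partial>\<mu>) * \<Phi> i x) - cnj (indicator A x)) < e"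
      using parseval[OF ind e] by blast
    have "l2n \<nu> (\<lambda>x. (\<Sum>i\<in>F'. cnj (\<integral>y. \<Phi> i y \<partial>\<nu>) * \<Phi> i x) - 1) < e" if F': "finite F'" "F \<subseteq> F'" for F'
    proof -
      let ?g = "\<lambda>x. (\<Sum>i\<in>F'. cnj (\<integral>y. indicator A y * \<Phi> i y \<partial>\<mu>) * \<Phi> i x) - cnj (indicator A x)"
      have sg: "sqint \<mu> ?g" by (intro sqint_diff sqint_sum sqint_cmult sqint_\<Phi> sqint_cnj pl2_sqint ind)
      have "l2n \<nu> (\<lambda>x. (\<Sum>i\<in>F'. cnj (\<integral>y. \<Phi> i y \<partial>\<nu>) * \<Phi> i x) - 1) = l2n \<nu> ?g"
        unfolding l2n_def
      proof (intro arg_cong[where f = sqrt] integral_cong_AE)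
        show "AE x in \<nu>. (cmod ((\<Sum>i\<in>F'. cnj (\<integral>y. \<Phi> i y \<partial>\<nu>) * \<Phi> i x) - 1))\<^sup>2 = (cmod (?g x))\<^sup>2"
          using recs by eventually_elim (simp add: wA)
        have [measurable]: "\<Phi> i \<in> borel_measurable \<nu>" for i using sqn(1)[OF sqint_\<Phi>] by (auto simp: sqint_def)
        show "(\<lambda>x. (cmod ((\<Sum>i\<in>F'. cnj (\<integral>y. \<Phi> i y \<partial>\<nu>) * \<Phi> i x) - 1))\<^sup>2) \<in> borel_measurable \<nu>" by measurable
        have "?g \<in> borel_measurable \<nu>" using sqn(1)[OF sg] by (simp add: sqint_def)
        then show "(\<lambda>x. (cmod (?g x))\<^sup>2) \<in> borel_measurable \<nu>" by measurable
      qed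
      also have "\<dots> \<le> l2n \<mu> ?g" by (rule sqn(2)[OF sg])
      also have "\<dots> < e" by (rule F(2)[OF F'])
      finally show ?thesis .
    qed
    then show "\<exists>F. finite F \<and> (\<forall>F'. finite F' \<longrightarrow> F \<subseteq> F' \<longrightarrow> l2n \<nu> (\<lambda>x. (\<Sum>i\<in>F'. cnj (\<integral>y. \<Phi> i y \<partial>\<nu>) * \<Phi> i x) - 1) < e)"
      using F(1) by blast
  qed
  have "measure \<nu> UNIV = 0"
    using N.m_zero by (simp add: N.m_def l2n_def sets_eq_imp_space_eq[OF sets_nu])
  then have "emeasure \<nu> UNIV = 0" by (simp add: F.emeasure_eq_measure)
  then show ?thesis using em[of UNIV] by simp
qed

end

text \<open>Exhaustion: Lebesgue-null sets approaching the supremum of their M-measures have a null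
  union attaining it, and a null set with mass outside would beat the supremum. Off \<open>N\<close>
  the measure is absolutely continuous.\<close>

lemma ex_maximal_null_set:
  fixes M :: "real measure"
  assumes "finite_measure M" and sets: "sets M = sets borel"
  shows "\<exists>N\<in>sets borel. emeasure lborel N = 0 \<and> (\<forall>B\<in>sets borel. emeasure lborel B = 0 \<longrightarrow> emeasure M (B - N) = 0)"
proof -
  interpret finite_measure M by fact
  define \<N> :: "real set set" where "\<N> = {N \<in> sets borel. emeasure lborel N = (0::ennreal)}"
  have ne: "{} \<in> \<N>" by (simp add: \<N>_def)
  define s where "s = (SUP N\<in>\<N>. measure M N)"
  have bdd: "bdd_above (measure M ` \<N>)" by (auto simp: bdd_above_def intro!: exI[of _ "measure M (space M)"] bounded_measure)
  have le: "measure M N \<le> s" if "N \<in> \<N>" for N unfolding s_def by (rule cSUP_upper[OF that bdd])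
  have "\<exists>N\<in>\<N>. s - 1 / real (Suc k) < measure M N" for k
  proof -
    have "s - 1 / real (Suc k) < (SUP N\<in>\<N>. measure M N)" unfolding s_def[symmetric] by simp
    then show ?thesis using less_cSUP_iff[of \<N> "measure M"] bdd ne by auto
  qed
  then obtain N where N: "\<And>k. N k \<in> \<N>" "\<And>k. s - 1 / real (Suc k) < measure M (N k)" by metis
  define U where "U = (\<Union>k. N k)"
  have U: "U \<in> \<N>"
  proof -
    have "(\<Union>k. N k) \<in> null_sets lborel" using N(1) by (intro null_sets_UN) (auto simp: \<N>_def null_sets_def)
    then show ?thesis by (auto simp: U_def \<N>_def null_sets_def)
  qed
  have sU: "s \<le> measure M U"
  proof (rule field_le_epsilon)
    fix e :: real assume "e > 0"
    then obtain k where "inverse (real (Suc k)) < e" using reals_Archimedean by blast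
    moreover have "measure M (N k) \<le> measure M U"
      using U by (intro finite_measure_mono) (auto simp: U_def \<N>_def sets)
    ultimately show "s \<le> measure M U + e" using N(2)[of k] by (simp add: inverse_eq_divide)
  qed
  have "emeasure M (B - U) = 0" if B: "B \<in> sets borel" "emeasure lborel B = 0" for B
  proof -
    have "U \<union> B \<in> null_sets lborel"
      using U B by (intro null_sets.Un) (auto simp: \<N>_def null_sets_def)
    then have "U \<union> B \<in> \<N>" by (auto simp: \<N>_def null_sets_def)
    then have "measure M (U \<union> B) \<le> measure M U" using le sU by force
    moreover have "measure M (U \<union> B) = measure M U + measure M (B - U)"
    proof -
      have "U \<union> B = U \<union> (B - U)" by auto
      then show ?thesis using finite_measure_Union[of U "B - U"] U B by (auto simp: \<N>_def sets)
    qed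
    ultimately show ?thesis by (simp add: emeasure_eq_measure measure_le_0_iff)
  qed
  then show ?thesis using U unfolding \<N>_def by blast
qed

text \<open>Off the maximal null set Radon-Nikodym gives a density; cutting by its size and by the
  distance to the endpoints yields pieces to which \<open>ac_null\<close> applies.\<close>

lemma (in spectral_setting) singular:
  assumes irr: "alpha \<notin> \<rat>" and lam: "lam > 0"
  shows "\<exists>N\<in>sets borel. emeasure lborel N = 0 \<and> (\<forall>A\<in>sets borel. A \<subseteq> {- lam<..<lam} - N \<longrightarrow> emeasure \<mu> A = 0)"
proof -
  obtain N where N: "N \<in> sets borel" "emeasure lborel N = 0"
    and max: "\<And>B. B \<in> sets borel \<Longrightarrow> emeasure lborel B = 0 \<Longrightarrow> emeasure \<mu> (B - N) = 0"
    using ex_maximal_null_set[OF fin_mu sets_mu] by blast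
  have NN [measurable]: "- N \<in> sets \<mu>" using N by (simp add: sets_mu)
  define \<nu> where "\<nu> = density \<mu> (indicator (- N))"
  have sets_nu: "sets \<nu> = sets borel" by (simp add: \<nu>_def sets_mu)
  have em: "emeasure \<nu> B = emeasure \<mu> (B - N)" if "B \<in> sets borel" for B
  proof -
    have "emeasure \<nu> B = (\<integral>\<^sup>+x. indicator (- N) x * indicator B x \<partial>\<mu>)"
      unfolding \<nu>_def by (rule emeasure_density) (use that in \<open>auto simp: sets_mu\<close>)
    also have "\<dots> = (\<integral>\<^sup>+x. indicator (B - N) x \<partial>\<mu>)"
      by (intro nn_integral_cong) (auto simp: indicator_def)
    also have "\<dots> = emeasure \<mu> (B - N)" using that N by (intro nn_integral_indicator) (auto simp: sets_mu)
    finally show ?thesis .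
  qed
  have ac: "absolutely_continuous (lborel :: real measure) \<nu>"
    unfolding absolutely_continuous_def
  proof
    fix B :: "real set" assume "B \<in> null_sets lborel"
    then show "B \<in> null_sets \<nu>" using max em by (auto simp: null_sets_def sets_nu)
  qed
  obtain f where f [measurable]: "f \<in> borel_measurable lborel" and fd: "density lborel f = \<nu>"
    using sigma_finite_measure.Radon_Nikodym[OF lborel.sigma_finite_measure_axioms ac] sets_nu by auto
  have ef: "emeasure \<nu> B = (\<integral>\<^sup>+x. f x * indicator B x \<partial>lborel)" if "B \<in> sets borel" for B
    unfolding fd[symmetric] by (rule emeasure_density) (use that in auto)
  have "(\<integral>\<^sup>+x. f x \<partial>lborel) = emeasure \<nu> UNIV" using ef[of UNIV] by simp
  also have "\<dots> < \<infinity>" using em[of UNIV] emeasure_finite[of "UNIV - N"] by (simp add: less_top[symmetric])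
  finally have "AE x in lborel. f x \<noteq> \<infinity>" by (intro nn_integral_PInf_AE) auto
  then obtain Z where Z: "{x \<in> space lborel. \<not> f x \<noteq> \<infinity>} \<subseteq> Z" "emeasure lborel Z = 0" "Z \<in> sets lborel" by (rule AE_E)
  \<comment> \<open>One index bounds the density by k + 1 and keeps lam^2 - x^2 above 1/(k + 1);
    these serve as \<open>K\<close> and \<open>c0\<close>.\<close>
  define A where "A k = {x. f x \<le> ennreal (real (Suc k)) \<and> x\<^sup>2 \<le> lam\<^sup>2 - 1 / real (Suc k)} - N" for k
  have Am: "A k \<in> sets borel" for k
  proof -
    have "{x \<in> space lborel. f x \<le> ennreal (real (Suc k)) \<and> x\<^sup>2 \<le> lam\<^sup>2 - 1 / real (Suc k)} \<in> sets lborel" by measurable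
    then show ?thesis using N by (simp add: A_def)
  qed
  have Anull: "emeasure \<mu> (A k) = 0" for k
  proof (rule ac_null[OF irr lam, of "1 / real (Suc k)" "real (Suc k)"])
    fix x assume "x \<in> A k"
    then have x: "x\<^sup>2 \<le> lam\<^sup>2 - 1 / real (Suc k)" by (simp add: A_def)
    moreover have "1 / real (Suc k) > 0" by simp
    ultimately have "x\<^sup>2 \<le> lam\<^sup>2" by linarith
    then have "\<bar>x\<bar> \<le> lam" using lam by (simp add: abs_le_square_iff[symmetric])
    with x show "\<bar>x\<bar> \<le> lam \<and> 1 / real (Suc k) \<le> lam\<^sup>2 - x\<^sup>2" by simp
  next
    fix B assume B: "B \<in> sets borel" "B \<subseteq> A k"
    then have "emeasure \<mu> B = emeasure \<nu> B" using em[OF B(1)] by (auto simp: A_def intro!: arg_cong2[where f = emeasure])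
    also have "\<dots> = (\<integral>\<^sup>+x. f x * indicator B x \<partial>lborel)" by (rule ef[OF B(1)])
    also have "\<dots> \<le> (\<integral>\<^sup>+x. ennreal (real (Suc k)) * indicator B x \<partial>lborel)"
      by (intro nn_integral_mono) (use B in \<open>auto simp: indicator_def A_def\<close>)
    also have "\<dots> = ennreal (real (Suc k)) * emeasure lborel B" using B by (simp add: nn_integral_cmult_indicator)
    finally show "emeasure \<mu> B \<le> ennreal (real (Suc k)) * emeasure lborel B" .
  qed (use Am in auto)
  have cover: "{- lam<..<lam} - (N \<union> Z) \<subseteq> (\<Union>k. A k)"
  proof
    fix x assume x: "x \<in> {- lam<..<lam} - (N \<union> Z)"
    then have "f x \<noteq> \<infinity>" using Z(1) by auto
    then obtain r where r: "f x = ennreal r" "r \<ge> 0" by (cases "f x") auto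
    have "\<bar>x\<bar> < lam" using x by auto
    then have "lam\<^sup>2 - x\<^sup>2 > 0" using power_strict_mono[of "\<bar>x\<bar>" lam 2] by simp
    then obtain k1 where k1: "inverse (real (Suc k1)) < lam\<^sup>2 - x\<^sup>2" using reals_Archimedean by blast
    obtain k2 :: nat where k2: "r \<le> real k2" using real_arch_simple by blast
    define k where "k = max k1 k2"
    have "1 / real (Suc k) \<le> inverse (real (Suc k1))" unfolding inverse_eq_divide by (intro divide_left_mono) (auto simp: k_def)
    moreover have "f x \<le> ennreal (real (Suc k))" unfolding r(1) using k2 by (intro ennreal_leI) (simp add: k_def)
    ultimately have "x \<in> A k" using k1 x unfolding A_def by (auto simp del: of_nat_Suc)
    then show "x \<in> (\<Union>k. A k)" by blast
  qed
  have Unull: "emeasure \<mu> (\<Union>k. A k) = 0"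
  proof -
    have "(\<Union>k. A k) \<in> null_sets \<mu>" using Anull Am by (intro null_sets_UN) (auto simp: null_sets_def sets_mu)
    then show ?thesis by auto
  qed
  show ?thesis
  proof (intro bexI conjI ballI impI)
    show "N \<union> Z \<in> sets borel" using N Z by simp
    have "N \<union> Z \<in> null_sets lborel" using N Z by (intro null_sets.Un) (auto simp: null_sets_def)
    then show "emeasure lborel (N \<union> Z) = 0" by auto
    fix B assume "B \<in> sets borel" "B \<subseteq> {- lam<..<lam} - (N \<union> Z)"
    then have "emeasure \<mu> B \<le> emeasure \<mu> (\<Union>k. A k)"
      using cover Am by (intro emeasure_mono) (auto simp: sets_mu)
    then show "emeasure \<mu> B = 0" using Unull by simp
  qed
qed

theorem theorem7p1:
  fixes alpha lam omega :: real
  assumes "alpha \<notin> \<rat>"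
    and "lam > 0"
    and "\<forall>k::int. 2 * alpha * real_of_int k + 2 * omega \<notin> \<int>"
  shows "purely_sc_spectrum_in (S_op lam alpha omega)
           (op_spectrum (S_op lam alpha omega) \<inter> {- lam <..< lam})"
  unfolding purely_sc_spectrum_in_def
proof (intro ballI allI impI)
  fix u \<mu> assume u: "u \<in> l2" and sp: "is_spectral_measure (S_op lam alpha omega) u \<mu>"
  interpret spectral_setting lam alpha omega u \<mu> by unfold_locales (fact u, fact sp)
  obtain N where N: "N \<in> sets borel" "emeasure lborel N = 0"
    "\<And>A. A \<in> sets borel \<Longrightarrow> A \<subseteq> {- lam<..<lam} - N \<Longrightarrow> emeasure \<mu> A = 0"
    using singular[OF assms(1,2)] by blast
  show "sing_cont_on \<mu> (op_spectrum (S_op lam alpha omega) \<inter> {- lam <..< lam})"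
    unfolding sing_cont_on_def
  proof (intro conjI ballI bexI[OF _ N(1)] impI)
    show "emeasure \<mu> {x} = 0" for x by (rule no_atoms[OF assms])
    fix A :: "real set"
    assume "A \<in> sets borel" "A \<subseteq> op_spectrum (S_op lam alpha omega) \<inter> {- lam <..< lam} - N"
    then show "emeasure \<mu> A = 0" by (intro N(3)) auto
  qed (rule N(2))
qed

end
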